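(* Let $p\in(0,1)$ be a constant and let $k\ge 4$ be an integer. For $n$ divisible by $k-1$, let $X_n(k)$ denote the number of loose Hamilton cycles in the random $k$-uniform hypergraph $H^k(n,p)$, with mean $\mu_n(k)$ and variance $\sigma_n(k)^2$, where all the $H^k(n,p)$ are obtained by restricting a single infinite random hypergraph $H^k(\mathbb N,p)$ to the vertex sets $[n]=\{1,\dots,n\}$. Then, with the limsup taken over $n$ divisible by $k-1$, $$\Pr\left[\limsup_{n\to\infty}\frac{X_n(k)-\mu_n(k)}{\sigma_n(k)\sqrt{2\log\log n}}=1\right]=1.$$
   Context: $H^k(\mathbb N,p)$ is the random $k$-uniform hypergraph on vertex set $\mathbb N=\{1,2,\dots\}$ in which each $k$-element subset of $\mathbb N$ is an edge with probability $p$, independently. $H^k(n,p)$ is its restriction to $[n]$ (all edges contained in $[n]$), so all $H^k(n,p)$ live on one probability space. A loose Hamilton cycle in a $k$-uniform hypergraph on $n$ vertices is a set of $m=n/(k-1)$ edges for which there is a cyclic ordering $v_1,\dots,v_n$ of all the vertices such that each of the edges consists of $k$ consecutive vertices in this cyclic order and each two (cyclically) consecutive edges overlap in exactly one vertex; that is, the edges are $\{v_{i(k-1)+1},\dots,v_{i(k-1)+k}\}$ for $i=0,\dots,m-1$, indices modulo $n$. Loose Hamilton cycles are counted as edge sets, so (for $m\ge3$) the complete $k$-uniform hypergraph on $n$ vertices has $\frac{n!}{2m((k-2)!)^m}$ of them. $\log$ is the natural logarithm. *)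

theory Defs
  imports "HOL-Probability.Probability" "HOL-Library.Ramsey"
begin

text \<open>
  Sample points are indicator functions on the \<open>k\<close>-subsets of \<open>{1, 2, \<dots>}\<close>;
  the coordinates are independent with the Bernoulli distribution of parameter \<open>p\<close>.
\<close>

definition random_hypergraph :: "nat \<Rightarrow> real \<Rightarrow> (nat set \<Rightarrow> bool) measure" where
  "random_hypergraph k p = PiM (nsets {1..} k) (\<lambda>_. measure_pmf (bernoulli_pmf p))"

lemma prob_space_random_hypergraph: "prob_space (random_hypergraph k p)"
  unfolding random_hypergraph_def
  by (intro prob_space_PiM) (rule prob_space_measure_pmf)

definition edges_upto :: "nat \<Rightarrow> nat \<Rightarrow> (nat set \<Rightarrow> bool) \<Rightarrow> nat set set" where
  "edges_upto k n \<omega> = {e \<in> nsets {1..n} k. \<omega> e}"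

text \<open>
  The cyclic ordering of \<open>{1..n}\<close> is indexed from \<open>0\<close>, as \<open>v 0, \<dots>, v (n - 1)\<close>, so that
  the edges are \<open>{v (i * (k - 1)), \<dots>, v (i * (k - 1) + (k - 1))}\<close> for \<open>i < n div (k - 1)\<close>,
  with arguments of \<open>v\<close> taken modulo \<open>n\<close>.
\<close>

definition loose_hamilton_cycle :: "nat \<Rightarrow> nat \<Rightarrow> nat set set \<Rightarrow> bool" where
  "loose_hamilton_cycle k n C \<longleftrightarrow> (k - 1) dvd n \<and>
     (\<exists>v. bij_betw v {..<n} {1..n} \<and>
          C = (\<lambda>i. (\<lambda>j. v ((i * (k - 1) + j) mod n)) ` {..<k}) ` {..<n div (k - 1)})"

definition num_lhc :: "nat \<Rightarrow> nat \<Rightarrow> (nat set \<Rightarrow> bool) \<Rightarrow> real" where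
  "num_lhc k n \<omega> = real (card {C. loose_hamilton_cycle k n C \<and> C \<subseteq> edges_upto k n \<omega>})"

definition lhc_mean :: "nat \<Rightarrow> real \<Rightarrow> nat \<Rightarrow> real" where
  "lhc_mean k p n = prob_space.expectation (random_hypergraph k p) (num_lhc k n)"

definition lhc_sd :: "nat \<Rightarrow> real \<Rightarrow> nat \<Rightarrow> real" where
  "lhc_sd k p n = sqrt (prob_space.variance (random_hypergraph k p) (num_lhc k n))"

end

theory Submission
  imports Defs "HOL-Real_Asymp.Real_Asymp" "HOL-Combinatorics.Permutations" "HOL-Number_Theory.Cong"
begin

text \<open>
  Write \<open>X = \<Sum>\<^sub>C \<Prod>\<^bsub>e\<in>C\<^esub> \<xi>\<^sub>e\<close> over the loose Hamilton cycles \<open>C\<close>, with \<open>\<xi>\<^sub>e\<close> the edge indicators.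
  Since every edge lies in equally many cycles, the orthogonal projection of \<open>X - \<mu>\<close> to the linear functions
  of the \<open>\<xi>\<^sub>e\<close> is a multiple of \<open>T = \<Sum>\<^sub>e (\<xi>\<^sub>e - p)\<close>, the centred number of edges. The remainder has second
  moment \<open>p\<^sup>2\<^sup>m \<Sum>\<^sub>C\<^sub>,\<^sub>D (p\<^sup>-\<^sup>I - 1 - \<lambda> I)\<close> with \<open>I = card (C \<inter> D)\<close> and \<open>\<lambda> = (1 - p) / p\<close>.
  A set \<open>S\<close> of edges of one cycle is contained in a proportion of at most \<open>(B / n\<^sup>k\<^sup>-\<^sup>1)\<^sup>s\<close>,
  \<open>s = card S\<close>, of all cycles, which bounds the remainder by \<open>O(n\<^sup>2\<^sup>-\<^sup>k)\<close> relative to the variance of the linear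
  part. As \<open>k \<ge> 4\<close> this is summable, so the remainder is almost surely negligible, and the claim is the
  law of the iterated logarithm for \<open>T\<close>, a sum of independent increments with nearly Gaussian
  moment generating functions.
\<close>

text \<open>The condition \<open>k \<ge> 4\<close> enters through Borel-Cantelli: a relative
  remainder of order \<open>n\<close> to the power \<open>2 - k\<close> is summable along
  \<open>n = m * (k - 1)\<close> from \<open>k = 4\<close> on, while for \<open>k = 3\<close> the
  bound would be harmonic. The counting estimate must hold for every subset of a cycle, with a loss
  exponential in its size. Proper subsets always offer an edge meeting the others in at most one
  vertex and can be dismantled edge by edge; the full cycle offers none, and the factor
  \<open>n ^ (k - 1)\<close> lost by dropping one of its edges is absorbed by enlarging
  \<open>B\<close>. The total number of cycles is never computed: symmetry under vertex permutations
  yields proportions, and these suffice. The increments of \<open>T\<close> are sums over ever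
  larger edge sets, neither identically distributed nor uniformly bounded. The hypothesis on moment
  generating functions is therefore multiplicative in the variance and asked for on one fixed
  interval \<open>\<bar>t\<bar> \<le> \<tau>\<close>; the relevant tilts, of order
  \<open>sqrt (ln (ln V) / V)\<close>, eventually fall inside. Passing from \<open>ln (ln V)\<close>
  to \<open>ln (ln n)\<close> is harmless, since \<open>V\<close> grows polynomially.\<close>

section \<open>The law of the iterated logarithm\<close>

text \<open>
  Cramer tilting: with \<open>t = x / W\<close>, most of \<open>E (exp (t Z))\<close> comes from \<open>Z\<close> near \<open>x\<close>, the contributions from
  outside \<open>[(1 - \<epsilon>) x, (1 + \<epsilon>) x]\<close> being bounded by the moment generating function at \<open>(1 \<plusminus> \<epsilon>) t\<close>.
\<close>

lemma (in prob_space) tail_lower_bound_of_mgf: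
  fixes Z :: "'a \<Rightarrow> real"
  assumes [measurable]: "random_variable borel Z"
    and W: "0 < W" and x: "0 < x" and eps: "0 < \<epsilon>" "\<epsilon> \<le> 1" and delta: "\<delta> = \<epsilon>\<^sup>2 / 10"
    and large: "8 / \<epsilon>\<^sup>2 \<le> x\<^sup>2 / W"
    and mgf: "\<And>s. 0 \<le> s \<Longrightarrow> s \<le> 2 * x / W \<Longrightarrow> integrable M (\<lambda>\<omega>. exp (s * Z \<omega>)) \<and>
        exp ((1 - \<delta>) * W * s\<^sup>2 / 2) \<le> expectation (\<lambda>\<omega>. exp (s * Z \<omega>)) \<and>
        expectation (\<lambda>\<omega>. exp (s * Z \<omega>)) \<le> exp ((1 + \<delta>) * W * s\<^sup>2 / 2)"
  shows "exp (- (x\<^sup>2 / W) * (1/2 + 2 * \<epsilon>)) / 2 \<le> prob {\<omega>\<in>space M. (1 - \<epsilon>) * x \<le> Z \<omega>}"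
proof -
  define t where "t = x / W"
  define u where "u = x\<^sup>2 / W"
  have t: "0 < t" using W x by (simp add: t_def)
  have tx: "t * x = u" by (simp add: t_def u_def power2_eq_square)
  have Wt: "W * t\<^sup>2 = u" using W by (simp add: t_def u_def power2_eq_square)
  have u: "8 / \<epsilon>\<^sup>2 \<le> u" "0 < u" using large W x by (simp_all add: u_def)
  have le2: "t \<le> 2 * x / W" "t * (1 + \<epsilon>) \<le> 2 * x / W" "t * (1 - \<epsilon>) \<le> 2 * x / W"
    using eps W x by (auto simp: t_def field_simps intro: mult_left_mono)
  let ?A = "{\<omega>\<in>space M. (1 - \<epsilon>) * x \<le> Z \<omega>}"
  have m0: "integrable M (\<lambda>\<omega>. exp (t * Z \<omega>))" "exp ((1 - \<delta>) * u / 2) \<le> expectation (\<lambda>\<omega>. exp (t * Z \<omega>))"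
    using mgf[of t] t le2 Wt by (auto simp: mult.assoc)
  have m1: "integrable M (\<lambda>\<omega>. exp (t * (1 + \<epsilon>) * Z \<omega>))"
     "expectation (\<lambda>\<omega>. exp (t * (1 + \<epsilon>) * Z \<omega>)) \<le> exp ((1 + \<delta>) * u * (1 + \<epsilon>)\<^sup>2 / 2)"
    using mgf[of "t * (1 + \<epsilon>)"] t le2 Wt eps
    by (auto simp: power_mult_distrib mult.assoc)
  have m2: "integrable M (\<lambda>\<omega>. exp (t * (1 - \<epsilon>) * Z \<omega>))"
     "expectation (\<lambda>\<omega>. exp (t * (1 - \<epsilon>) * Z \<omega>)) \<le> exp ((1 + \<delta>) * u * (1 - \<epsilon>)\<^sup>2 / 2)"
    using mgf[of "t * (1 - \<epsilon>)"] t le2 Wt eps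
    by (auto simp: power_mult_distrib mult.assoc)
  let ?R = "\<lambda>\<omega>. exp (u * (1 + \<epsilon>)) * indicator ?A \<omega> +
      (exp (- u * \<epsilon> * (1 + \<epsilon>)) * exp (t * (1 + \<epsilon>) * Z \<omega>) +
       exp (u * \<epsilon> * (1 - \<epsilon>)) * exp (t * (1 - \<epsilon>) * Z \<omega>))"
  have "expectation (\<lambda>\<omega>. exp (t * Z \<omega>)) \<le> expectation ?R"
  proof (rule integral_mono)
    show "integrable M (\<lambda>\<omega>. exp (t * Z \<omega>))" by fact
    show "integrable M ?R" using m1 m2
      by (intro Bochner_Integration.integrable_add integrable_mult_right integrable_real_indicator)
        (auto simp: emeasure_eq_measure)
    fix \<omega> assume w: "\<omega> \<in> space M"
    consider "Z \<omega> < (1 - \<epsilon>) * x" | "(1 - \<epsilon>) * x \<le> Z \<omega>" "Z \<omega> \<le> (1 + \<epsilon>) * x" | "(1 + \<epsilon>) * x < Z \<omega>"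
      by linarith
    then show "exp (t * Z \<omega>) \<le> ?R \<omega>"
    proof cases
      case 1
      have "t * \<epsilon> * Z \<omega> \<le> t * \<epsilon> * ((1 - \<epsilon>) * x)" using 1 t eps by (intro mult_left_mono) auto
      then have "t * Z \<omega> \<le> u * \<epsilon> * (1 - \<epsilon>) + t * (1 - \<epsilon>) * Z \<omega>"
        unfolding tx[symmetric] by (simp add: algebra_simps)
      then have "exp (t * Z \<omega>) \<le> exp (u * \<epsilon> * (1 - \<epsilon>)) * exp (t * (1 - \<epsilon>) * Z \<omega>)"
        by (simp add: exp_add[symmetric])
      then show ?thesis using 1 by (simp add: add_increasing)
    next
      case 2
      have "t * Z \<omega> \<le> t * ((1 + \<epsilon>) * x)" using 2 t by (intro mult_left_mono) auto
      then have "exp (t * Z \<omega>) \<le> exp (u * (1 + \<epsilon>))"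
        unfolding tx[symmetric] by (simp add: algebra_simps)
      then show ?thesis using 2 w by (simp add: add_increasing2)
    next
      case 3
      have "t * \<epsilon> * ((1 + \<epsilon>) * x) \<le> t * \<epsilon> * Z \<omega>" using 3 t eps by (intro mult_left_mono) auto
      then have "t * Z \<omega> \<le> - u * \<epsilon> * (1 + \<epsilon>) + t * (1 + \<epsilon>) * Z \<omega>"
        unfolding tx[symmetric] by (simp add: algebra_simps)
      then have "exp (t * Z \<omega>) \<le> exp (- u * \<epsilon> * (1 + \<epsilon>)) * exp (t * (1 + \<epsilon>) * Z \<omega>)"
        by (simp add: exp_add[symmetric])
      then show ?thesis by (simp add: add_increasing add_increasing2)
    qed
  qed
  also have "expectation ?R = exp (u * (1 + \<epsilon>)) * prob ?A +
      (exp (- u * \<epsilon> * (1 + \<epsilon>)) * expectation (\<lambda>\<omega>. exp (t * (1 + \<epsilon>) * Z \<omega>)) +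
       exp (u * \<epsilon> * (1 - \<epsilon>)) * expectation (\<lambda>\<omega>. exp (t * (1 - \<epsilon>) * Z \<omega>)))"
    using m1 m2 by (subst Bochner_Integration.integral_add Bochner_Integration.integrable_add; simp add: emeasure_eq_measure)+
  also have "\<dots> \<le> exp (u * (1 + \<epsilon>)) * prob ?A +
      (exp (- u * \<epsilon> * (1 + \<epsilon>)) * exp ((1 + \<delta>) * u * (1 + \<epsilon>)\<^sup>2 / 2) +
       exp (u * \<epsilon> * (1 - \<epsilon>)) * exp ((1 + \<delta>) * u * (1 - \<epsilon>)\<^sup>2 / 2))"
    using m1 m2 by (intro add_mono mult_left_mono) auto
  finally have main: "exp ((1 - \<delta>) * u / 2) \<le> exp (u * (1 + \<epsilon>)) * prob ?A +
      (exp (- u * \<epsilon> * (1 + \<epsilon>) + (1 + \<delta>) * u * (1 + \<epsilon>)\<^sup>2 / 2) +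
       exp (u * \<epsilon> * (1 - \<epsilon>) + (1 + \<delta>) * u * (1 - \<epsilon>)\<^sup>2 / 2))"
    unfolding exp_add by (rule order_trans[OF m0(2)])
  have sq: "(1 + \<epsilon>)\<^sup>2 \<le> 4" "(1 - \<epsilon>)\<^sup>2 \<le> 4"
    using eps power_mono[of "1+\<epsilon>" 2 2] power_mono[of "1-\<epsilon>" 2 2] by auto
  have "2 \<le> u * (\<epsilon>\<^sup>2 / 4)" using u eps by (simp add: field_simps)
  \<comment> \<open>Origin of the constants: the errors in the moment generating functions amount to
    \<open>5/2 * \<delta> * u\<close>, which for \<open>\<delta> = \<epsilon>\<^sup>2 / 10\<close>
    is half of the available \<open>\<epsilon>\<^sup>2 / 2 * u\<close>. The other half is at least 2
    by \<open>large\<close>, and \<open>exp 2 \<ge> 4\<close> makes each outer contribution at most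
    a quarter of \<open>exp ((1 - \<delta>) * u / 2)\<close>.\<close>
  have gap: "(1 - \<epsilon>\<^sup>2) / 2 * u + 2 * \<delta> * u + 2 \<le> (1 - \<delta>) * u / 2"
  proof -
    have "(1 - \<delta>) * u / 2 - ((1 - \<epsilon>\<^sup>2) / 2 * u + 2 * \<delta> * u + 2) = u * (\<epsilon>\<^sup>2 / 4) - 2"
      by (simp add: delta field_simps)
    with \<open>2 \<le> u * (\<epsilon>\<^sup>2 / 4)\<close> show ?thesis by linarith
  qed
  have dpos: "0 \<le> \<delta> * u" unfolding delta using u by simp
  have "(1 - \<epsilon>\<^sup>2) / 2 * u + 2 * \<delta> * u - (- u * \<epsilon> * (1 + \<epsilon>) + (1 + \<delta>) * u * (1 + \<epsilon>)\<^sup>2 / 2)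
      = \<delta> * u * (4 - (1 + \<epsilon>)\<^sup>2) / 2"
    by (simp add: field_simps power2_eq_square)
  moreover have "0 \<le> \<delta> * u * (4 - (1 + \<epsilon>)\<^sup>2) / 2"
    using sq dpos by (intro divide_nonneg_pos mult_nonneg_nonneg[OF dpos]) auto
  ultimately have e1: "- u * \<epsilon> * (1 + \<epsilon>) + (1 + \<delta>) * u * (1 + \<epsilon>)\<^sup>2 / 2 \<le> (1 - \<epsilon>\<^sup>2) / 2 * u + 2 * \<delta> * u"
    by linarith
  have "(1 - \<epsilon>\<^sup>2) / 2 * u + 2 * \<delta> * u - (u * \<epsilon> * (1 - \<epsilon>) + (1 + \<delta>) * u * (1 - \<epsilon>)\<^sup>2 / 2)
      = \<delta> * u * (4 - (1 - \<epsilon>)\<^sup>2) / 2"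
    by (simp add: field_simps power2_eq_square)
  moreover have "0 \<le> \<delta> * u * (4 - (1 - \<epsilon>)\<^sup>2) / 2"
    using sq dpos by (intro divide_nonneg_pos mult_nonneg_nonneg[OF dpos]) auto
  ultimately have e2: "u * \<epsilon> * (1 - \<epsilon>) + (1 + \<delta>) * u * (1 - \<epsilon>)\<^sup>2 / 2 \<le> (1 - \<epsilon>\<^sup>2) / 2 * u + 2 * \<delta> * u"
    by linarith
  let ?g = "exp ((1 - \<delta>) * u / 2)"
  have "exp ((1 - \<epsilon>\<^sup>2) / 2 * u + 2 * \<delta> * u) * exp 2 \<le> ?g"
    using gap by (simp add: exp_add[symmetric])
  moreover have "(4::real) \<le> exp 2"
  proof -
    have "(2::real)^2 \<le> exp 1 ^ 2" using exp_ge_add_one_self[of 1] by (intro power_mono) auto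
    then show ?thesis by (simp add: exp_of_nat_mult[symmetric])
  qed
  ultimately have "4 * exp ((1 - \<epsilon>\<^sup>2) / 2 * u + 2 * \<delta> * u) \<le> ?g"
    by (intro order_trans[OF mult_right_mono[of 4 "exp 2"]]) (simp_all add: mult.commute)
  moreover have "exp (- u * \<epsilon> * (1 + \<epsilon>) + (1 + \<delta>) * u * (1 + \<epsilon>)\<^sup>2 / 2)
      \<le> exp ((1 - \<epsilon>\<^sup>2) / 2 * u + 2 * \<delta> * u)"
    "exp (u * \<epsilon> * (1 - \<epsilon>) + (1 + \<delta>) * u * (1 - \<epsilon>)\<^sup>2 / 2)
      \<le> exp ((1 - \<epsilon>\<^sup>2) / 2 * u + 2 * \<delta> * u)"
    using e1 e2 by (simp_all only: exp_le_cancel_iff)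
  ultimately have "?g / 2 \<le> exp (u * (1 + \<epsilon>)) * prob ?A"
    using main by linarith
  then have "?g / 2 * exp (- u * (1 + \<epsilon>)) \<le> (exp (u * (1 + \<epsilon>)) * prob ?A) * exp (- u * (1 + \<epsilon>))"
    by (intro mult_right_mono) auto
  also have "\<dots> = prob ?A" by (simp add: exp_minus)
  finally have le: "exp ((1 - \<delta>) * u / 2 - u * (1 + \<epsilon>)) / 2 \<le> prob ?A"
    by (simp add: exp_add[symmetric])
  \<comment> \<open>The width of the window costs \<open>\<epsilon> * u\<close>, the error
    \<open>\<delta> / 2 * u\<close> is at most as much; hence the
    \<open>2 * \<epsilon>\<close>.\<close>
  have "- u * (1/2 + 2 * \<epsilon>) \<le> (1 - \<delta>) * u / 2 - u * (1 + \<epsilon>)"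
  proof -
    have "\<epsilon>\<^sup>2 \<le> \<epsilon>" using eps by (simp add: power2_eq_square mult_left_le)
    then have "\<delta> / 2 * u \<le> \<epsilon> * u" using delta u eps by (intro mult_right_mono) auto
    then show ?thesis by (simp add: algebra_simps)
  qed
  then have "exp (- u * (1/2 + 2 * \<epsilon>)) / 2 \<le> exp ((1 - \<delta>) * u / 2 - u * (1 + \<epsilon>)) / 2"
    by (intro divide_right_mono iffD2[OF exp_le_cancel_iff]) (assumption, simp)
  then show ?thesis unfolding u_def[symmetric] using le by (rule order_trans)
qed

text \<open>
  Taking \<open>\<delta> = 1\<close> in the lower bound gives \<open>E (exp (t X\<^sub>i)) \<ge> 1\<close>, which is all that the maximal inequality needs.
\<close>

locale lil_sequence = prob_space +
  fixes X :: "nat \<Rightarrow> 'a \<Rightarrow> real" and d :: "nat \<Rightarrow> real"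
  assumes indep: "indep_vars (\<lambda>_. borel) X UNIV"
    and d_nonneg: "0 \<le> d i"
    and mgf: "0 < \<delta> \<Longrightarrow> \<exists>\<tau>>0. \<forall>i t. \<bar>t\<bar> \<le> \<tau> \<longrightarrow> integrable M (\<lambda>\<omega>. exp (t * X i \<omega>)) \<and>
        exp ((1 - \<delta>) * d i * t\<^sup>2 / 2) \<le> expectation (\<lambda>\<omega>. exp (t * X i \<omega>)) \<and>
        expectation (\<lambda>\<omega>. exp (t * X i \<omega>)) \<le> exp ((1 + \<delta>) * d i * t\<^sup>2 / 2)"
begin

definition S :: "nat \<Rightarrow> 'a \<Rightarrow> real" where "S n \<omega> = (\<Sum>i<n. X i \<omega>)"
definition V :: "nat \<Rightarrow> real" where "V n = (\<Sum>i<n. d i)"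

lemma measurable_X [measurable]: "random_variable borel (X i)"
  using indep by (auto simp: indep_vars_def)

lemma measurable_S [measurable]: "random_variable borel (S n)"
  unfolding S_def by measurable

lemma V_mono: "m \<le> n \<Longrightarrow> V m \<le> V n"
  unfolding V_def by (intro sum_mono2) (auto simp: d_nonneg)

lemma V_nonneg: "0 \<le> V n"
  unfolding V_def by (intro sum_nonneg) (auto simp: d_nonneg)

text \<open>By independence the bounds multiply while the variances add, so the
  \<open>\<tau>\<close> of the single variables serves blocks of any length.\<close>

lemma mgf_sum:
  assumes "0 < \<delta>"
  shows "\<exists>\<tau>>0. \<forall>A t. finite A \<longrightarrow> \<bar>t\<bar> \<le> \<tau> \<longrightarrow> integrable M (\<lambda>\<omega>. exp (t * (\<Sum>i\<in>A. X i \<omega>))) \<and>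
        exp ((1 - \<delta>) * (\<Sum>i\<in>A. d i) * t\<^sup>2 / 2) \<le> expectation (\<lambda>\<omega>. exp (t * (\<Sum>i\<in>A. X i \<omega>))) \<and>
        expectation (\<lambda>\<omega>. exp (t * (\<Sum>i\<in>A. X i \<omega>))) \<le> exp ((1 + \<delta>) * (\<Sum>i\<in>A. d i) * t\<^sup>2 / 2)"
proof -
  obtain \<tau> where \<tau>: "\<tau> > 0"
    and int: "\<And>i t. \<bar>t\<bar> \<le> \<tau> \<Longrightarrow> integrable M (\<lambda>\<omega>. exp (t * X i \<omega>))"
    and lo: "\<And>i t. \<bar>t\<bar> \<le> \<tau> \<Longrightarrow> exp ((1 - \<delta>) * d i * t\<^sup>2 / 2) \<le> expectation (\<lambda>\<omega>. exp (t * X i \<omega>))"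
    and up: "\<And>i t. \<bar>t\<bar> \<le> \<tau> \<Longrightarrow> expectation (\<lambda>\<omega>. exp (t * X i \<omega>)) \<le> exp ((1 + \<delta>) * d i * t\<^sup>2 / 2)"
    using mgf[OF assms] by metis
  show ?thesis
  proof (intro exI[of _ \<tau>] conjI allI impI \<tau>)
    fix A :: "nat set" and t :: real assume A: "finite A" and t: "\<bar>t\<bar> \<le> \<tau>"
    have ind: "indep_vars (\<lambda>_. borel) (\<lambda>i \<omega>. exp (t * X i \<omega>)) A"
      by (rule indep_vars_subset[OF indep_vars_compose2[OF indep, of "\<lambda>_ y. exp (t * y)"]]) auto
    have eq: "exp (t * (\<Sum>i\<in>A. X i \<omega>)) = (\<Prod>i\<in>A. exp (t * X i \<omega>))" for \<omega>
      by (simp add: sum_distrib_left exp_sum A)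
    have E: "expectation (\<lambda>\<omega>. exp (t * (\<Sum>i\<in>A. X i \<omega>))) = (\<Prod>i\<in>A. expectation (\<lambda>\<omega>. exp (t * X i \<omega>)))"
      unfolding eq by (rule indep_vars_lebesgue_integral[OF A ind int[OF t]])
    have ex: "exp (c * (\<Sum>i\<in>A. d i) * t\<^sup>2 / 2) = (\<Prod>i\<in>A. exp (c * d i * t\<^sup>2 / 2))" for c
      by (subst exp_sum[symmetric, OF A]) (simp add: sum_distrib_left sum_distrib_right sum_divide_distrib)
    show "integrable M (\<lambda>\<omega>. exp (t * (\<Sum>i\<in>A. X i \<omega>)))"
      unfolding eq by (rule indep_vars_integrable[OF A ind int[OF t]])
    show "exp ((1 - \<delta>) * (\<Sum>i\<in>A. d i) * t\<^sup>2 / 2) \<le> expectation (\<lambda>\<omega>. exp (t * (\<Sum>i\<in>A. X i \<omega>)))"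
      unfolding E ex using lo[OF t] by (intro prod_mono) auto
    show "expectation (\<lambda>\<omega>. exp (t * (\<Sum>i\<in>A. X i \<omega>))) \<le> exp ((1 + \<delta>) * (\<Sum>i\<in>A. d i) * t\<^sup>2 / 2)"
      unfolding E ex using up[OF t] by (intro prod_mono) (auto intro: integral_nonneg)
  qed
qed

text \<open>Doob's inequality for the submartingale \<open>exp (t * S n)\<close>, by induction on
  \<open>n\<close>. Where the level was reached before, one more factor \<open>exp (t * X n)\<close>
  is independent of the past and has mean at least 1; where it is reached only now,
  \<open>S (Suc n)\<close> itself is at least \<open>x\<close>.\<close>

lemma exponential_maximal_ineq:
  assumes t: "0 \<le> t"
    and int: "\<And>A. finite A \<Longrightarrow> integrable M (\<lambda>\<omega>. exp (t * (\<Sum>i\<in>A. X i \<omega>)))"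
    and ge1: "\<And>i. 1 \<le> expectation (\<lambda>\<omega>. exp (t * X i \<omega>))"
  shows "exp (t * x) * prob {\<omega>\<in>space M. \<exists>i\<le>n. x \<le> S i \<omega>} \<le> expectation (\<lambda>\<omega>. exp (t * S n \<omega>))"
proof -
  define B where "B n = {\<omega>\<in>space M. \<exists>i\<le>n. x \<le> S i \<omega>}" for n
  have Bm [measurable]: "B n \<in> events" for n unfolding B_def by measurable
  have intS: "integrable M (\<lambda>\<omega>. exp (t * S n \<omega>))" for n
    unfolding S_def by (rule int) simp
  have intX: "integrable M (\<lambda>\<omega>. exp (t * X n \<omega>))" for n
    using int[of "{n}"] by simp
  have intI: "integrable M (\<lambda>\<omega>. exp (t * S n \<omega>) * indicator A \<omega>)" if "A \<in> events" for n A
    using integrable_mult_indicator[OF that intS[of n]] by (simp add: mult.commute)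
  \<comment> \<open>The indicator of \<open>B n\<close> on the right is what carries the induction;
    it is dropped only afterwards.\<close>
  have "exp (t * x) * prob (B n) \<le> expectation (\<lambda>\<omega>. exp (t * S n \<omega>) * indicator (B n) \<omega>)"
  proof (induction n)
    case 0
    have "exp (t * x) * prob (B 0) = expectation (\<lambda>\<omega>. exp (t * x) * indicator (B 0) \<omega>)" by simp
    also have "\<dots> \<le> expectation (\<lambda>\<omega>. exp (t * S 0 \<omega>) * indicator (B 0) \<omega>)"
    proof (intro integral_mono intI Bm)
      show "exp (t * x) * indicator (B 0) \<omega> \<le> exp (t * S 0 \<omega>) * indicator (B 0) \<omega>" for \<omega>
        using t by (auto simp: B_def indicator_def mult_left_mono)
    qed (auto simp: emeasure_eq_measure)
    finally show ?case .
  next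
    case (Suc n)
    have Bsub: "B n \<subseteq> B (Suc n)" by (auto simp: B_def intro: le_SucI)
    have new: "x \<le> S (Suc n) \<omega>" if "\<omega> \<in> B (Suc n) - B n" for \<omega>
      using that by (auto simp: B_def le_Suc_eq)
    \<comment> \<open>The past, indicator included, is written as a function of the coordinates
      below \<open>n\<close>, so that disjointness of index sets gives independence from
      \<open>X n\<close>. The event in it is not intersected with \<open>space M\<close>; under the
      integral it agrees with \<open>B n\<close>.\<close>
    let ?f = "\<lambda>f. exp (t * (\<Sum>i<n. f i)) * indicator {f. \<exists>j\<le>n. x \<le> (\<Sum>i<j. f i)} f"
    have [measurable]: "(\<lambda>f. \<Sum>i<j. f i) \<in> borel_measurable (PiM {..<n} (\<lambda>_. borel :: real measure))" if "j \<le> n" for j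
      using that by (intro borel_measurable_sum measurable_component_singleton) auto
    have Bf: "{f \<in> space (PiM {..<n} (\<lambda>_. borel :: real measure)). \<exists>j\<le>n. x \<le> (\<Sum>i<j. f i)} \<in> sets (PiM {..<n} (\<lambda>_. borel))"
    proof -
      have *: "{f \<in> space (PiM {..<n} (\<lambda>_. borel :: real measure)). \<exists>j\<le>n. x \<le> (\<Sum>i<j. f i)} =
        (\<Union>j\<in>{..n}. {f \<in> space (PiM {..<n} (\<lambda>_. borel :: real measure)). x \<le> (\<Sum>i<j. f i)})" by auto
      show ?thesis unfolding * by (intro sets.finite_UN) auto
    qed
    have fm: "?f \<in> borel_measurable (PiM {..<n} (\<lambda>_. borel))"
      by (intro borel_measurable_times borel_measurable_exp borel_measurable_const borel_measurable_indicator')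
        (use Bf in auto)
    have "indep_var borel (?f \<circ> (\<lambda>\<omega>. restrict (\<lambda>i. X i \<omega>) {..<n})) borel ((\<lambda>f. exp (t * f n)) \<circ> (\<lambda>\<omega>. restrict (\<lambda>i. X i \<omega>) {n}))"
      by (intro indep_var_compose[OF indep_var_restrict[OF indep]] fm) auto
    also have "?f \<circ> (\<lambda>\<omega>. restrict (\<lambda>i. X i \<omega>) {..<n}) = (\<lambda>\<omega>. exp (t * S n \<omega>) * indicator {\<omega>. \<exists>j\<le>n. x \<le> S j \<omega>} \<omega>)"
    proof
      fix \<omega>
      have "(\<Sum>i<j. restrict (\<lambda>i. X i \<omega>) {..<n} i) = S j \<omega>" if "j \<le> n" for j
        using that by (auto simp: S_def intro!: sum.cong)
      then show "(?f \<circ> (\<lambda>\<omega>. restrict (\<lambda>i. X i \<omega>) {..<n})) \<omega> = exp (t * S n \<omega>) * indicator {\<omega>. \<exists>j\<le>n. x \<le> S j \<omega>} \<omega>"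
        by (auto simp: indicator_def)
    qed
    also have "(\<lambda>f. exp (t * f n)) \<circ> (\<lambda>\<omega>. restrict (\<lambda>i. X i \<omega>) {n}) = (\<lambda>\<omega>. exp (t * X n \<omega>))" by auto
    finally have ind: "indep_var borel (\<lambda>\<omega>. exp (t * S n \<omega>) * indicator {\<omega>. \<exists>j\<le>n. x \<le> S j \<omega>} \<omega>) borel (\<lambda>\<omega>. exp (t * X n \<omega>))" .
    have i1: "integrable M (\<lambda>\<omega>. exp (t * S n \<omega>) * indicator {\<omega>. \<exists>j\<le>n. x \<le> S j \<omega>} \<omega>)"
      by (rule Bochner_Integration.integrable_cong[THEN iffD1, OF refl _ intI[OF Bm, of n n]]) (auto simp: B_def indicator_def)
    have E1: "expectation (\<lambda>\<omega>. exp (t * S n \<omega>) * indicator {\<omega>. \<exists>j\<le>n. x \<le> S j \<omega>} \<omega>) = expectation (\<lambda>\<omega>. exp (t * S n \<omega>) * indicator (B n) \<omega>)"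
      by (rule Bochner_Integration.integral_cong) (auto simp: B_def indicator_def)
    have prodE: "expectation (\<lambda>\<omega>. exp (t * S n \<omega>) * indicator (B n) \<omega> * exp (t * X n \<omega>)) =
       expectation (\<lambda>\<omega>. exp (t * S n \<omega>) * indicator (B n) \<omega>) * expectation (\<lambda>\<omega>. exp (t * X n \<omega>))"
      unfolding E1[symmetric] indep_var_lebesgue_integral[OF ind i1 intX, symmetric]
      by (rule Bochner_Integration.integral_cong) (auto simp: B_def indicator_def)
    have split: "exp (t * S (Suc n) \<omega>) * indicator (B (Suc n)) \<omega> =
       exp (t * S n \<omega>) * indicator (B n) \<omega> * exp (t * X n \<omega>) + exp (t * S (Suc n) \<omega>) * indicator (B (Suc n) - B n) \<omega>" for \<omega>
      using Bsub by (auto simp: indicator_def S_def distrib_left exp_add)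
    have intp: "integrable M (\<lambda>\<omega>. exp (t * S n \<omega>) * indicator (B n) \<omega> * exp (t * X n \<omega>))"
      by (rule Bochner_Integration.integrable_cong[THEN iffD1, OF refl _ intI[OF Bm, of "Suc n" n]])
         (auto simp: S_def distrib_left exp_add mult_ac)
    have "exp (t * x) * prob (B (Suc n)) = exp (t * x) * prob (B n) + exp (t * x) * prob (B (Suc n) - B n)"
      using finite_measure_Diff[of "B (Suc n)" "B n"] Bsub by (simp add: distrib_left[symmetric])
    also have "exp (t * x) * prob (B n) \<le> expectation (\<lambda>\<omega>. exp (t * S n \<omega>) * indicator (B n) \<omega>) * 1"
      using Suc by simp
    also have "\<dots> \<le> expectation (\<lambda>\<omega>. exp (t * S n \<omega>) * indicator (B n) \<omega>) * expectation (\<lambda>\<omega>. exp (t * X n \<omega>))"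
      by (intro mult_left_mono ge1 integral_nonneg) auto
    also have "\<dots> = expectation (\<lambda>\<omega>. exp (t * S n \<omega>) * indicator (B n) \<omega> * exp (t * X n \<omega>))"
      by (rule prodE[symmetric])
    also have "exp (t * x) * prob (B (Suc n) - B n) = expectation (\<lambda>\<omega>. exp (t * x) * indicator (B (Suc n) - B n) \<omega>)"
      by simp
    also have "\<dots> \<le> expectation (\<lambda>\<omega>. exp (t * S (Suc n) \<omega>) * indicator (B (Suc n) - B n) \<omega>)"
    proof (intro integral_mono intI)
      fix \<omega>
      show "exp (t * x) * indicator (B (Suc n) - B n) \<omega> \<le> exp (t * S (Suc n) \<omega>) * indicator (B (Suc n) - B n) \<omega>"
        using new[of \<omega>] t by (cases "\<omega> \<in> B (Suc n) - B n") (simp_all add: mult_left_mono)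
    qed (auto simp: emeasure_eq_measure)
    also have "expectation (\<lambda>\<omega>. exp (t * S n \<omega>) * indicator (B n) \<omega> * exp (t * X n \<omega>)) + \<dots>
       = expectation (\<lambda>\<omega>. exp (t * S (Suc n) \<omega>) * indicator (B (Suc n)) \<omega>)"
      unfolding split by (rule Bochner_Integration.integral_add[OF intp intI, symmetric]) simp
    finally show ?case by simp
  qed
  also have "\<dots> \<le> expectation (\<lambda>\<omega>. exp (t * S n \<omega>))"
    by (intro integral_mono intI intS) (auto simp: indicator_def)
  finally show ?thesis by (simp add: B_def)
qed

end

section \<open>The normalising function and the second Borel-Cantelli lemma\<close>

definition lil_scale :: "real \<Rightarrow> real" where
  "lil_scale y = sqrt (2 * y * ln (ln y))"

lemma ln_ge_one: "exp 1 \<le> y \<Longrightarrow> 1 \<le> ln (y::real)"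
  by (metis exp_gt_zero ln_exp ln_le_cancel_iff less_le_trans)

lemma ln_ln_nonneg: "exp 1 \<le> y \<Longrightarrow> 0 \<le> ln (ln (y::real))"
  using ln_ge_one[of y] by simp

lemma lil_scale_mono:
  assumes "exp 1 \<le> a" "a \<le> b"
  shows "lil_scale a \<le> lil_scale b"
proof -
  have "0 < a" using assms(1) by (meson exp_gt_zero less_le_trans)
  moreover have "ln a \<le> ln b" "1 \<le> ln a" using assms \<open>0 < a\<close> ln_ge_one by auto
  moreover from this have "ln (ln a) \<le> ln (ln b)"
    using ln_le_cancel_iff[of "ln a" "ln b"] by linarith
  ultimately show ?thesis unfolding lil_scale_def using assms
    by (intro real_sqrt_le_mono mult_mono) auto
qed

lemma lil_scale_nonneg: "exp 1 \<le> y \<Longrightarrow> 0 \<le> lil_scale y"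
  unfolding lil_scale_def using ln_ln_nonneg[of y] exp_ge_zero[of 1]
  by (meson mult_nonneg_nonneg order_trans real_sqrt_ge_zero zero_le_numeral)

lemma lil_scale_square: "exp 1 \<le> y \<Longrightarrow> (lil_scale y)\<^sup>2 = 2 * y * ln (ln y)"
  unfolding lil_scale_def using ln_ln_nonneg[of y] exp_ge_zero[of 1]
  by (intro real_sqrt_pow2) (meson mult_nonneg_nonneg order_trans zero_le_numeral)

lemma lil_scale_over_self: "((\<lambda>y. lil_scale y / y) \<longlongrightarrow> 0) at_top"
  unfolding lil_scale_def by real_asymp

lemma power_bracket:
  fixes \<theta> y :: real
  assumes "1 < \<theta>" "\<theta> ^ J \<le> y"
  obtains j where "J \<le> j" "\<theta> ^ j \<le> y" "y < \<theta> ^ Suc j"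
proof -
  obtain n where n: "y < \<theta> ^ n" using real_arch_pow[OF assms(1)] by blast
  define m where "m = (LEAST n. y < \<theta> ^ n)"
  have m: "y < \<theta> ^ m" unfolding m_def by (rule LeastI[of "\<lambda>n. y < \<theta> ^ n", OF n])
  have "J < m"
  proof (rule ccontr)
    assume "\<not> J < m"
    then have "\<theta> ^ m \<le> \<theta> ^ J" using assms by (intro power_increasing) auto
    then show False using m assms by linarith
  qed
  moreover have "\<not> y < \<theta> ^ (m - 1)" unfolding m_def
    by (rule not_less_Least) (use \<open>J < m\<close> m_def in auto)
  ultimately show ?thesis using m by (intro that[of "m - 1"]) auto
qed

text \<open>Second Borel-Cantelli lemma, phrased for variables so that it applies directly to
  independent block sums. Missing all events of a finite window has probability
  \<open>\<Prod>(1 - q j)\<close>, at most \<open>exp (- \<Sum>q j)\<close>; if missing all events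
  from \<open>J\<close> on had positive probability, the partial sums of \<open>q\<close> would be
  bounded.\<close>

lemma (in prob_space) borel_cantelli_indep_vars:
  assumes ind: "indep_vars N Z (UNIV :: nat set)"
    and P: "\<And>j. {x\<in>space (N j). P j x} \<in> sets (N j)"
    and div: "\<not> summable (\<lambda>j. prob {\<omega>\<in>space M. P j (Z j \<omega>)})"
  shows "AE \<omega> in M. \<exists>\<^sub>F j in sequentially. P j (Z j \<omega>)"
proof -
  have meas [measurable]: "{\<omega>\<in>space M. P j (Z j \<omega>)} \<in> events" for j
  proof -
    have "Z j -` {x\<in>space (N j). P j x} \<inter> space M \<in> events"
      using ind P[of j] by (intro measurable_sets) (auto simp: indep_vars_def)
    moreover have "Z j -` {x\<in>space (N j). P j x} \<inter> space M = {\<omega>\<in>space M. P j (Z j \<omega>)}"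
      using ind by (auto simp: indep_vars_def dest: measurable_space)
    ultimately show ?thesis by simp
  qed
  define q where "q j = prob {\<omega>\<in>space M. P j (Z j \<omega>)}" for j
  have q0: "0 \<le> q j" for j by (simp add: q_def)
  have null: "prob {\<omega>\<in>space M. \<forall>j\<ge>J. \<not> P j (Z j \<omega>)} = 0" for J
  proof -
    have bound: "prob {\<omega>\<in>space M. \<forall>j\<ge>J. \<not> P j (Z j \<omega>)} \<le> exp (- (\<Sum>j\<in>{J..<J+L}. q j))" for L
    proof (cases "L = 0")
      case True then show ?thesis by simp
    next
      case False
      let ?A = "\<lambda>j. {x\<in>space (N j). \<not> P j x}"
      have A: "?A j \<in> sets (N j)" for j
      proof -
        have "?A j = space (N j) - {x\<in>space (N j). P j x}" by auto
        then show ?thesis using P[of j] by auto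
      qed
      have vim: "Z j -` ?A j \<inter> space M = {\<omega>\<in>space M. \<not> P j (Z j \<omega>)}" for j
        using ind by (auto simp: indep_vars_def dest: measurable_space)
      have "prob {\<omega>\<in>space M. \<forall>j\<ge>J. \<not> P j (Z j \<omega>)} \<le> prob (\<Inter>j\<in>{J..<J+L}. Z j -` ?A j \<inter> space M)"
      proof (rule finite_measure_mono)
        show "{\<omega>\<in>space M. \<forall>j\<ge>J. \<not> P j (Z j \<omega>)} \<subseteq> (\<Inter>j\<in>{J..<J+L}. Z j -` ?A j \<inter> space M)"
          unfolding vim by auto
        have "{\<omega>\<in>space M. \<not> P j (Z j \<omega>)} \<in> events" for j by measurable
        then show "(\<Inter>j\<in>{J..<J+L}. Z j -` ?A j \<inter> space M) \<in> events"
          unfolding vim using False by (intro sets.finite_INT) auto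
      qed
      also have "\<dots> = (\<Prod>j\<in>{J..<J+L}. prob (Z j -` ?A j \<inter> space M))"
        using False A by (intro indep_varsD[OF ind]) auto
      also have "\<dots> = (\<Prod>j\<in>{J..<J+L}. 1 - q j)"
        unfolding vim q_def by (intro prod.cong refl prob_neg) simp
      also have "\<dots> \<le> (\<Prod>j\<in>{J..<J+L}. exp (- q j))"
        using exp_ge_add_one_self[of "- q j" for j] by (intro prod_mono) (auto simp: q_def)
      also have "\<dots> = exp (- (\<Sum>j\<in>{J..<J+L}. q j))"
        by (simp add: exp_sum sum_negf[symmetric])
      finally show ?thesis .
    qed
    show ?thesis
    proof (rule ccontr)
      assume "\<not> ?thesis"
      then have pos: "0 < prob {\<omega>\<in>space M. \<forall>j\<ge>J. \<not> P j (Z j \<omega>)}" (is "0 < ?p")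
        by (simp add: zero_less_measure_iff order_less_le)
      have "(\<Sum>j<L. q (j + J)) \<le> - ln ?p" for L
      proof -
        have "ln ?p \<le> ln (exp (- (\<Sum>j\<in>{J..<J+L}. q j)))"
          using bound[of L] pos by (subst ln_le_cancel_iff) auto
        moreover have "(\<Sum>j\<in>{J..<J+L}. q j) = (\<Sum>j<L. q (j + J))"
          using sum.shift_bounds_nat_ivl[of q 0 J L] by (simp add: add.commute atLeast0LessThan)
        ultimately show ?thesis by simp
      qed
      then have "summable (\<lambda>j. q (j + J))" using q0 by (intro summableI_nonneg_bounded) auto
      then have "summable q" by (simp only: summable_iff_shift)
      then show False using div by (simp add: q_def[abs_def])
    qed
  qed
  have "AE \<omega> in M. \<exists>j\<ge>J. P j (Z j \<omega>)" for J
  proof -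
    have "{\<omega>\<in>space M. \<forall>j\<ge>J. \<not> P j (Z j \<omega>)} \<in> events" by measurable
    then have "AE \<omega> in M. \<omega> \<notin> {\<omega>\<in>space M. \<forall>j\<ge>J. \<not> P j (Z j \<omega>)}"
      using null[of J] by (intro prob_eq_0[THEN iffD1]) auto
    with AE_space show ?thesis by eventually_elim auto
  qed
  then have "AE \<omega> in M. \<forall>J. \<exists>j\<ge>J. P j (Z j \<omega>)" by (simp add: AE_all_countable)
  then show ?thesis by (simp add: frequently_sequentially)
qed

section \<open>The two halves of the law of the iterated logarithm\<close>

context lil_sequence
begin

text \<open>Time is cut where \<open>V\<close> passes the powers of \<open>\<rho>\<close>. The
  maximal inequality bounds the chance of exceeding the threshold anywhere before \<open>V\<close>
  reaches \<open>\<rho> ^ Suc j\<close> by a constant times \<open>j powr (- c)\<close> with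
  \<open>c > 1\<close>, so only finitely many thresholds are exceeded; between cuts the monotonicity
  of \<open>lil_scale\<close> suffices.\<close>

lemma lil_upper:
  assumes V: "filterlim V at_top sequentially" and rho: "1 < \<rho>"
  shows "AE \<omega> in M. \<forall>\<^sub>F n in sequentially. S n \<omega> \<le> \<rho> * lil_scale (V n)"
proof -
  \<comment> \<open>Budget of the exponent: squaring the threshold gives
    \<open>\<rho>\<^sup>2\<close>; one \<open>\<rho>\<close> is lost to the ratio of successive cuts
    and one \<open>c\<close> to the moment generating function, used with
    \<open>\<delta> = c - 1\<close>. As \<open>c * c = \<rho>\<close>, exactly \<open>c\<close> is
    left.\<close>
  define c where "c = sqrt \<rho>"
  have c: "1 < c" "c * c = \<rho>" using rho by (auto simp: c_def)
  obtain \<tau>1 where t1: "0 < \<tau>1" and mgf1: "\<And>A t. finite A \<Longrightarrow> \<bar>t\<bar> \<le> \<tau>1 \<Longrightarrow> integrable M (\<lambda>\<omega>. exp (t * (\<Sum>i\<in>A. X i \<omega>)))"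
     "\<And>A t. finite A \<Longrightarrow> \<bar>t\<bar> \<le> \<tau>1 \<Longrightarrow> expectation (\<lambda>\<omega>. exp (t * (\<Sum>i\<in>A. X i \<omega>))) \<le> exp (c * (\<Sum>i\<in>A. d i) * t\<^sup>2 / 2)"
    using mgf_sum[of "c - 1"] c by auto
  obtain \<tau>2 where t2: "0 < \<tau>2" and mgf2: "\<And>i t. \<bar>t\<bar> \<le> \<tau>2 \<Longrightarrow> 1 \<le> expectation (\<lambda>\<omega>. exp (t * X i \<omega>))"
    using mgf[of 1] by auto
  define x where "x j = \<rho> * lil_scale (\<rho> ^ j)" for j :: nat
  \<comment> \<open>The minimiser of
    \<open>c * \<rho> ^ Suc j * t\<^sup>2 / 2 - t * x j\<close>.\<close>
  define t where "t j = x j / (c * \<rho> ^ Suc j)" for j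
  \<comment> \<open>All indices before the cut are included, not just those of one block, so that
    the event is about a maximum over an initial segment; it ends at \<open>N\<close> below because
    \<open>V\<close> tends to infinity.\<close>
  define A where "A j = {\<omega>\<in>space M. \<exists>n. V n < \<rho> ^ Suc j \<and> x j \<le> S n \<omega>}" for j
  have A_meas: "A j \<in> events" for j unfolding A_def by measurable
  have pow: "filterlim (\<lambda>j. \<rho> ^ j) at_top sequentially" using rho by real_asymp
  have "(\<lambda>j. lil_scale (\<rho> ^ j) / \<rho> ^ j / c) \<longlonglongrightarrow> 0 / c"
    using c by (intro tendsto_divide filterlim_compose[OF lil_scale_over_self pow] tendsto_const) auto
  moreover have "t = (\<lambda>j. lil_scale (\<rho> ^ j) / \<rho> ^ j / c)"
    using rho by (auto simp: t_def x_def field_simps)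
  ultimately have "t \<longlonglongrightarrow> 0" by simp
  then have ev_t: "\<forall>\<^sub>F j in sequentially. t j < min \<tau>1 \<tau>2" using t1 t2 by (intro order_tendstoD) auto
  have ev_e: "\<forall>\<^sub>F j in sequentially. exp 1 \<le> \<rho> ^ j" using pow by (simp add: filterlim_at_top)
  have bound: "\<forall>\<^sub>F j in sequentially. norm (prob (A j)) \<le> (ln \<rho>) powr (- c) * real j powr (- c)"
    using ev_t ev_e eventually_gt_at_top[of 0]
  proof eventually_elim
    case (elim j)
    have x0: "0 \<le> x j" using lil_scale_nonneg[OF elim(2)] rho by (simp add: x_def)
    have t0: "0 \<le> t j" using x0 c rho by (simp add: t_def)
    have "\<forall>\<^sub>F n in sequentially. \<rho> ^ Suc j \<le> V n" using V by (simp add: filterlim_at_top)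
    then obtain N0 where N0: "\<And>n. N0 \<le> n \<Longrightarrow> \<rho> ^ Suc j \<le> V n" by (auto simp: eventually_sequentially)
    define N where "N = Max {n. V n < \<rho> ^ Suc j}"
    have fin: "finite {n. V n < \<rho> ^ Suc j}"
      by (rule finite_subset[of _ "{..N0}"]) (use N0 in \<open>force simp: not_less[symmetric]\<close>, simp)
    have "0 \<in> {n. V n < \<rho> ^ Suc j}" using rho by (simp add: V_def)
    then have N: "V N < \<rho> ^ Suc j" using Max_in[OF fin] by (auto simp: N_def)
    have leN: "n \<le> N" if "V n < \<rho> ^ Suc j" for n using that fin by (simp add: N_def)
    have "A j \<subseteq> {\<omega>\<in>space M. \<exists>i\<le>N. x j \<le> S i \<omega>}" using leN by (auto simp: A_def)
    then have "prob (A j) \<le> prob {\<omega>\<in>space M. \<exists>i\<le>N. x j \<le> S i \<omega>}"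
      by (intro finite_measure_mono) auto
    also have "exp (t j * x j) * \<dots> \<le> expectation (\<lambda>\<omega>. exp (t j * S N \<omega>))"
      using t0 elim(1) by (intro exponential_maximal_ineq mgf1 mgf2) auto
    also have "\<dots> \<le> exp (c * V N * (t j)\<^sup>2 / 2)"
      unfolding S_def V_def using t0 elim(1) by (intro mgf1) auto
    also have "\<dots> \<le> exp (c * \<rho> ^ Suc j * (t j)\<^sup>2 / 2)"
      using N c by (simp add: mult_right_mono)
    also have "c * \<rho> ^ Suc j * (t j)\<^sup>2 / 2 = t j * x j / 2"
      using c rho by (simp add: t_def power2_eq_square)
    finally have "exp (t j * x j) * prob (A j) \<le> exp (t j * x j / 2)" by simp
    then have "prob (A j) \<le> exp (t j * x j / 2) / exp (t j * x j)" by (simp add: field_simps)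
    also have "\<dots> = exp (- (t j * x j / 2))" by (simp add: exp_diff[symmetric])
    also have "t j * x j / 2 = c * ln (ln (\<rho> ^ j))"
    proof -
      have "t j * x j = \<rho>\<^sup>2 * (lil_scale (\<rho> ^ j))\<^sup>2 / (c * \<rho> ^ Suc j)"
        by (simp add: t_def x_def power2_eq_square)
      also have "\<dots> = 2 * (\<rho> / c) * ln (ln (\<rho> ^ j))"
        unfolding lil_scale_square[OF elim(2)] using rho c by (simp add: power2_eq_square)
      also have "\<rho> / c = c" using c by (simp add: field_simps)
      finally show ?thesis by simp
    qed
    also have "exp (- (c * ln (ln (\<rho> ^ j)))) = ln (\<rho> ^ j) powr (- c)"
      using ln_ge_one[OF elim(2)] by (simp add: powr_def)
    also have "\<dots> = (ln \<rho>) powr (- c) * real j powr (- c)"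
      using rho by (simp add: ln_realpow powr_mult)
    finally show ?case by simp
  qed
  have "summable (\<lambda>j. prob (A j))"
  proof (rule summable_comparison_test_ev[OF bound summable_mult])
    show "summable (\<lambda>j. real j powr (- c))" using c by (simp add: summable_real_powr_iff)
  qed
  then have "AE \<omega> in M. \<forall>\<^sub>F j in sequentially. \<omega> \<in> space M - A j"
    using A_meas by (intro borel_cantelli_AE1) (auto simp: emeasure_eq_measure)
  then show ?thesis
  proof eventually_elim
    case (elim \<omega>)
    from eventually_conj[OF elim ev_e]
    obtain J where J: "\<And>j. J \<le> j \<Longrightarrow> \<omega> \<in> space M - A j \<and> exp 1 \<le> \<rho> ^ j" by (auto simp: eventually_sequentially)
    have "\<forall>\<^sub>F n in sequentially. \<rho> ^ J \<le> V n" using V by (simp add: filterlim_at_top)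
    then show ?case
    proof eventually_elim
      case (elim n)
      obtain j where j: "J \<le> j" "\<rho> ^ j \<le> V n" "V n < \<rho> ^ Suc j"
        using power_bracket[OF rho elim] by blast
      have "\<not> x j \<le> S n \<omega>" using J[OF j(1)] j(3) by (auto simp: A_def)
      then have "S n \<omega> \<le> \<rho> * lil_scale (\<rho> ^ j)" by (simp add: x_def)
      also have "\<dots> \<le> \<rho> * lil_scale (V n)"
        using J[OF j(1)] j(2) rho by (intro mult_left_mono lil_scale_mono) auto
      finally show ?case .
    qed
  qed
qed

end

context lil_sequence
begin

text \<open>The hypotheses are invariant under negating \<open>X\<close>. In the lower half this
  keeps the sum before a block from cancelling the block.\<close>

lemma lil_lower_envelope:
  assumes V: "filterlim V at_top sequentially" and rho: "1 < \<rho>"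
  shows "AE \<omega> in M. \<forall>\<^sub>F n in sequentially. - \<rho> * lil_scale (V n) \<le> S n \<omega>"
proof -
  interpret neg: lil_sequence M "\<lambda>i \<omega>. - X i \<omega>" d
  proof
    show "indep_vars (\<lambda>_. borel) (\<lambda>i \<omega>. - X i \<omega>) UNIV"
      by (rule indep_vars_compose2[OF indep, of "\<lambda>_ y. - y"]) auto
    show "0 \<le> d i" for i by (rule d_nonneg)
    fix \<delta> :: real assume "0 < \<delta>"
    from mgf[OF this] obtain \<tau> where t: "0 < \<tau>" and
      *: "\<And>i t. \<bar>t\<bar> \<le> \<tau> \<Longrightarrow> integrable M (\<lambda>\<omega>. exp (t * X i \<omega>)) \<and>
        exp ((1 - \<delta>) * d i * t\<^sup>2 / 2) \<le> expectation (\<lambda>\<omega>. exp (t * X i \<omega>)) \<and>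
        expectation (\<lambda>\<omega>. exp (t * X i \<omega>)) \<le> exp ((1 + \<delta>) * d i * t\<^sup>2 / 2)" by blast
    show "\<exists>\<tau>>0. \<forall>i t. \<bar>t\<bar> \<le> \<tau> \<longrightarrow> integrable M (\<lambda>\<omega>. exp (t * - X i \<omega>)) \<and>
        exp ((1 - \<delta>) * d i * t\<^sup>2 / 2) \<le> expectation (\<lambda>\<omega>. exp (t * - X i \<omega>)) \<and>
        expectation (\<lambda>\<omega>. exp (t * - X i \<omega>)) \<le> exp ((1 + \<delta>) * d i * t\<^sup>2 / 2)"
      by (intro exI[of _ \<tau>] conjI allI impI t) (use *[of "- t" for t] in simp_all)
  qed
  have "neg.S n \<omega> = - S n \<omega>" for n \<omega> by (simp add: neg.S_def S_def sum_negf)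
  moreover have "neg.V = V" by (simp add: neg.V_def V_def fun_eq_iff)
  ultimately show ?thesis using neg.lil_upper[of \<rho>] V rho by (simp add: minus_le_iff)
qed

text \<open>Along indices where \<open>V\<close> grows geometrically with a large ratio
  \<open>\<theta>\<close>, the increments \<open>Z j\<close> are independent and carry nearly all
  the variance. Tilting gives them a large value with probability at least
  \<open>1 / (2 * ln (V (n (Suc j))))\<close>, which is harmonic in \<open>j\<close>, so
  Borel-Cantelli yields infinitely many; the earlier part is smaller by about
  \<open>sqrt (K' / \<theta>)\<close>. The ratio condition prevents \<open>V\<close> from jumping
  far beyond \<open>\<theta> ^ j\<close>, which would spoil both the divergence and the share of
  variance.\<close>

lemma lil_lower:
  assumes V: "filterlim V at_top sequentially" and ratio: "\<forall>\<^sub>F n in sequentially. V (Suc n) \<le> K * V n"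
    and rho: "0 < \<rho>" "\<rho> < 1"
  shows "AE \<omega> in M. \<exists>\<^sub>F n in sequentially. \<rho> * lil_scale (V n) \<le> S n \<omega>"
proof -
  \<comment> \<open>The blocks aim at \<open>\<rho>'\<close>; the margin
    \<open>\<rho>' - \<rho>\<close> pays for the window of width \<open>\<epsilon>\<close> and for
    the sum before the block.\<close>
  define \<rho>' where "\<rho>' = (1 + \<rho>) / 2"
  have rho': "\<rho> < \<rho>'" "\<rho>' < 1" "0 < \<rho>'" using rho by (auto simp: \<rho>'_def)
  define K' where "K' = max K 1"
  have K': "1 \<le> K'" and ratio': "\<forall>\<^sub>F n in sequentially. V (Suc n) \<le> K' * V n"
  proof -
    show "1 \<le> K'" by (simp add: K'_def)
    show "\<forall>\<^sub>F n in sequentially. V (Suc n) \<le> K' * V n" using ratio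
    proof eventually_elim
      case (elim n)
      have "K * V n \<le> K' * V n" by (intro mult_right_mono V_nonneg) (simp add: K'_def)
      with elim show ?case by linarith
    qed
  qed
  \<comment> \<open>Two demands on \<open>\<theta>\<close>, with
    \<open>\<epsilon> = 1 / \<theta>\<close>. The first keeps the tail exponent below
    \<open>ln (ln V)\<close>: here \<open>1 + 4 / \<theta>\<close> is twice
    \<open>1/2 + 2 * \<epsilon>\<close>, and \<open>1 - K' / \<theta>\<close> is the share of
    variance in the block. The second keeps the total above \<open>\<rho>\<close> after the loss of
    \<open>1 - \<epsilon>\<close> and of the lower envelope, used with constant 2.\<close>
  have lim1: "((\<lambda>\<theta>. \<rho>'\<^sup>2 * (1 + 4 / \<theta>) / (1 - K' / \<theta>)) \<longlongrightarrow> \<rho>'\<^sup>2 * (1 + 0) / (1 - 0)) at_top"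
    by (intro tendsto_intros tendsto_divide_0[OF tendsto_const] filterlim_at_top_imp_at_infinity filterlim_ident) auto
  have lim2: "((\<lambda>\<theta>. (1 - 1 / \<theta>) * \<rho>' - 2 * sqrt (K' / \<theta>)) \<longlongrightarrow> (1 - 0) * \<rho>' - 2 * sqrt 0) at_top"
    by (intro tendsto_intros tendsto_divide_0[OF tendsto_const] filterlim_at_top_imp_at_infinity filterlim_ident)
  have "\<rho>'\<^sup>2 < 1" using rho' by (simp add: power_less_one_iff)
  then have "\<forall>\<^sub>F \<theta> in at_top. \<rho>'\<^sup>2 * (1 + 4 / \<theta>) / (1 - K' / \<theta>) < 1" using lim1 by (intro order_tendstoD) auto
  moreover have "\<forall>\<^sub>F \<theta> in at_top. \<rho> < (1 - 1 / \<theta>) * \<rho>' - 2 * sqrt (K' / \<theta>)" using lim2 rho' by (intro order_tendstoD) auto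
  moreover note eventually_gt_at_top[of K'] eventually_gt_at_top[of "1::real"]
  ultimately have "\<forall>\<^sub>F \<theta> in at_top. \<rho>'\<^sup>2 * (1 + 4 / \<theta>) / (1 - K' / \<theta>) < 1 \<and>
      \<rho> < (1 - 1 / \<theta>) * \<rho>' - 2 * sqrt (K' / \<theta>) \<and> K' < \<theta> \<and> 1 < \<theta>" by eventually_elim simp
  then obtain \<theta> where th: "\<rho>'\<^sup>2 * (1 + 4 / \<theta>) / (1 - K' / \<theta>) < 1" "\<rho> < (1 - 1 / \<theta>) * \<rho>' - 2 * sqrt (K' / \<theta>)" "K' < \<theta>" "1 < \<theta>"
    using eventually_happens'[OF trivial_limit_at_top_linorder] by fastforce
  define \<epsilon> where "\<epsilon> = 1 / \<theta>"
  have eps: "0 < \<epsilon>" "\<epsilon> \<le> 1" "\<epsilon> < 1" using th by (auto simp: \<epsilon>_def)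
  define \<delta> where "\<delta> = \<epsilon>\<^sup>2 / 10"
  have "0 < \<delta>" using eps by (simp add: \<delta>_def)
  from mgf_sum[OF this] obtain \<tau> where \<tau>: "0 < \<tau>" and mgfA: "\<And>A t. finite A \<Longrightarrow> \<bar>t\<bar> \<le> \<tau> \<Longrightarrow>
      integrable M (\<lambda>\<omega>. exp (t * (\<Sum>i\<in>A. X i \<omega>))) \<and>
        exp ((1 - \<delta>) * (\<Sum>i\<in>A. d i) * t\<^sup>2 / 2) \<le> expectation (\<lambda>\<omega>. exp (t * (\<Sum>i\<in>A. X i \<omega>))) \<and>
        expectation (\<lambda>\<omega>. exp (t * (\<Sum>i\<in>A. X i \<omega>))) \<le> exp ((1 + \<delta>) * (\<Sum>i\<in>A. d i) * t\<^sup>2 / 2)"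
    by blast

  define n where "n j = (LEAST i. \<theta> ^ j \<le> V i)" for j
  have ex: "\<exists>i. \<theta> ^ j \<le> V i" for j
  proof -
    have "\<forall>\<^sub>F i in sequentially. \<theta> ^ j \<le> V i" using V by (simp add: filterlim_at_top)
    then show ?thesis by (auto dest: eventually_happens)
  qed
  have Vn: "\<theta> ^ j \<le> V (n j)" for j unfolding n_def using ex by (rule LeastI_ex)
  have less_n: "V i < \<theta> ^ j" if "i < n j" for i j using not_less_Least[of i "\<lambda>i. \<theta> ^ j \<le> V i"] that by (auto simp: n_def)
  have n_mono: "n i \<le> n j" if "i \<le> j" for i j
  proof -
    have "\<theta> ^ i \<le> \<theta> ^ j" using th that by (intro power_increasing) auto
    then have "\<theta> ^ i \<le> V (n j)" using Vn[of j] by linarith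
    then show ?thesis unfolding n_def[of i] by (rule Least_le)
  qed
  have pow: "filterlim (\<lambda>j. \<theta> ^ j) at_top sequentially" using th(4) by real_asymp
  have Vn_lim: "filterlim (\<lambda>j. V (n j)) at_top sequentially"
    by (rule filterlim_at_top_mono[OF pow]) (simp add: Vn)
  have Vn1_lim: "filterlim (\<lambda>j. V (n (Suc j))) at_top sequentially"
    using Vn_lim by (rule filterlim_compose[OF _ filterlim_Suc])
  have n_lim: "filterlim n at_top sequentially"
    unfolding filterlim_at_top
  proof
    fix N
    have "\<forall>\<^sub>F j in sequentially. V N + 1 \<le> \<theta> ^ j" using pow by (simp add: filterlim_at_top)
    then show "\<forall>\<^sub>F j in sequentially. N \<le> n j"
    proof eventually_elim
      case (elim j)
      show ?case
      proof (rule ccontr)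
        assume "\<not> N \<le> n j"
        then have "V (n j) \<le> V N" by (intro V_mono) auto
        then show False using elim Vn[of j] by linarith
      qed
    qed
  qed
  \<comment> \<open>Just before the first crossing \<open>V\<close> is below
    \<open>\<theta> ^ j\<close>, so one step overshoots by at most \<open>K'\<close>. Hence
    \<open>V (n j)\<close> is at most the fraction \<open>K' / \<theta>\<close> of
    \<open>V (n (Suc j))\<close>, which leaves \<open>\<kappa>\<close> for the block.\<close>
  have Vn_up: "\<forall>\<^sub>F j in sequentially. V (n j) \<le> K' * \<theta> ^ j"
  proof -
    obtain N where N: "\<And>i. N \<le> i \<Longrightarrow> V (Suc i) \<le> K' * V i" using ratio' by (auto simp: eventually_sequentially)
    have "\<forall>\<^sub>F j in sequentially. Suc N \<le> n j" using n_lim by (simp add: filterlim_at_top)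
    then show ?thesis
    proof eventually_elim
      case (elim j)
      then have "V (n j) \<le> K' * V (n j - 1)" using N[of "n j - 1"] by (simp add: Suc_le_eq)
      also have "\<dots> \<le> K' * \<theta> ^ j" using less_n[of "n j - 1" j] elim K' by (intro mult_left_mono) auto
      finally show ?case .
    qed
  qed
  define I where "I j = {n j..<n (Suc j)}" for j
  define W where "W j = (\<Sum>i\<in>I j. d i)" for j
  define Z where "Z j \<omega> = (\<Sum>i\<in>I j. X i \<omega>)" for j \<omega>
  have S_split: "S (n (Suc j)) \<omega> = S (n j) \<omega> + Z j \<omega>" for j \<omega>
    using sum.atLeastLessThan_concat[of 0 "n j" "n (Suc j)" "\<lambda>i. X i \<omega>"] n_mono[of j "Suc j"]
    by (simp add: S_def Z_def I_def atLeast0LessThan)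
  have V_split: "V (n (Suc j)) = V (n j) + W j" for j
    using sum.atLeastLessThan_concat[of 0 "n j" "n (Suc j)" d] n_mono[of j "Suc j"]
    by (simp add: V_def W_def I_def atLeast0LessThan)
  have disj: "disjoint_family_on I UNIV"
    unfolding disjoint_family_on_def
  proof (intro ballI impI)
    have *: "I i \<inter> I j = {}" if "i < j" for i j
      using n_mono[of "Suc i" j] that by (auto simp: I_def)
    show "I i \<inter> I j = {}" if "i \<noteq> j" for i j
      using *[of i j] *[of j i] that by (cases i j rule: linorder_cases) auto
  qed
  have indZ: "indep_vars (\<lambda>_. borel) Z UNIV"
  proof -
    have "indep_vars (\<lambda>j. borel) (\<lambda>j \<omega>. (\<lambda>f. \<Sum>i\<in>I j. f i) (restrict (\<lambda>i. X i \<omega>) (I j))) UNIV"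
      by (rule indep_vars_compose2[OF indep_vars_restrict[OF indep _ disj]])
        (auto intro!: borel_measurable_sum measurable_component_singleton)
    moreover have "(\<Sum>i\<in>I j. restrict (\<lambda>i. X i \<omega>) (I j) i) = Z j \<omega>" for j \<omega>
      by (auto simp: Z_def intro!: sum.cong)
    ultimately show ?thesis by simp
  qed
  have Zm [measurable]: "random_variable borel (Z j)" for j unfolding Z_def by measurable
  define x where "x j = \<rho>' * lil_scale (V (n (Suc j)))" for j
  define \<kappa> where "\<kappa> = 1 - K' / \<theta>"
  have kappa: "0 < \<kappa>" "\<kappa> < 1" using th K' by (auto simp: \<kappa>_def)
  have W_lo: "\<forall>\<^sub>F j in sequentially. \<kappa> * V (n (Suc j)) \<le> W j"
    using Vn_up
  proof eventually_elim
    case (elim j)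
    have "V (n j) \<le> K' / \<theta> * \<theta> ^ Suc j" using elim th by simp
    also have "\<dots> \<le> K' / \<theta> * V (n (Suc j))" using Vn[of "Suc j"] K' th by (intro mult_left_mono) auto
    finally show ?case using V_split[of j] by (simp add: \<kappa>_def algebra_simps)
  qed
  have ev_e: "\<forall>\<^sub>F j in sequentially. exp 1 \<le> V (n (Suc j))" using Vn1_lim by (simp add: filterlim_at_top)
  have "(\<lambda>j. 2 * \<rho>' / \<kappa> * (lil_scale (V (n (Suc j))) / V (n (Suc j)))) \<longlonglongrightarrow> 2 * \<rho>' / \<kappa> * 0"
    by (intro tendsto_mult tendsto_const filterlim_compose[OF lil_scale_over_self Vn1_lim])
  then have ev_t: "\<forall>\<^sub>F j in sequentially. 2 * \<rho>' / \<kappa> * (lil_scale (V (n (Suc j))) / V (n (Suc j))) < \<tau>"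
    using \<tau> by (intro order_tendstoD) auto
  have "filterlim (\<lambda>y. 2 * \<rho>'\<^sup>2 * ln (ln y)) at_top at_top" using rho' by real_asymp
  from filterlim_compose[OF this Vn1_lim]
  have ev_u: "\<forall>\<^sub>F j in sequentially. 8 / \<epsilon>\<^sup>2 \<le> 2 * \<rho>'\<^sup>2 * ln (ln (V (n (Suc j))))"
    by (simp add: filterlim_at_top)
  have prob_lo: "\<forall>\<^sub>F j in sequentially. 1 / (2 * ln (V (n (Suc j)))) \<le> prob {\<omega>\<in>space M. (1 - \<epsilon>) * x j \<le> Z j \<omega>}"
    using W_lo ev_e ev_t ev_u
  proof eventually_elim
    case (elim j)
    let ?v = "V (n (Suc j))"
    have v: "0 < ?v" using elim(2) exp_gt_zero[of "1::real"] by linarith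
    have LL: "0 < ln (ln ?v)"
    proof -
      have "0 < 2 * \<rho>'\<^sup>2 * ln (ln ?v)" using elim(4) eps by (smt (verit) divide_pos_pos zero_less_power)
      then show ?thesis using rho' by (simp add: zero_less_mult_iff)
    qed
    have h: "0 < lil_scale ?v" unfolding lil_scale_def using v LL by simp
    have x: "0 < x j" using h rho' by (simp add: x_def)
    have W: "0 < W j" using elim(1) kappa v by (smt (verit) mult_pos_pos)
    have Wv: "W j \<le> ?v" using V_split[of j] V_nonneg[of "n j"] by linarith
    have xx: "(x j)\<^sup>2 = 2 * \<rho>'\<^sup>2 * ln (ln ?v) * ?v"
      using lil_scale_square[OF elim(2)] by (simp add: x_def power_mult_distrib)
    have large: "8 / \<epsilon>\<^sup>2 \<le> (x j)\<^sup>2 / W j"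
    proof -
      have "8 / \<epsilon>\<^sup>2 \<le> (x j)\<^sup>2 / ?v" using elim(4) v by (simp add: xx)
      also have "\<dots> \<le> (x j)\<^sup>2 / W j" using W Wv by (intro divide_left_mono) auto
      finally show ?thesis .
    qed
    have tau_le: "2 * x j / W j \<le> \<tau>"
    proof -
      have "2 * x j / W j \<le> 2 * x j / (\<kappa> * ?v)" using x elim(1) W v kappa by (intro divide_left_mono) auto
      also have "\<dots> = 2 * \<rho>' / \<kappa> * (lil_scale ?v / ?v)" by (simp add: x_def)
      finally show ?thesis using elim(3) by linarith
    qed
    have "exp (- ((x j)\<^sup>2 / W j) * (1/2 + 2 * \<epsilon>)) / 2 \<le> prob {\<omega>\<in>space M. (1 - \<epsilon>) * x j \<le> Z j \<omega>}"
      by (rule tail_lower_bound_of_mgf[OF Zm W x eps(1,2) \<delta>_def large])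
        (use tau_le mgfA[of "I j"] in \<open>auto simp: Z_def W_def I_def\<close>)
    moreover have "(x j)\<^sup>2 / W j * (1/2 + 2 * \<epsilon>) \<le> ln (ln ?v)"
    proof -
      have "(x j)\<^sup>2 / W j * (1/2 + 2 * \<epsilon>) \<le> (x j)\<^sup>2 / (\<kappa> * ?v) * (1/2 + 2 * \<epsilon>)"
        using elim(1) W v kappa eps by (intro mult_right_mono divide_left_mono) auto
      also have "\<dots> = ln (ln ?v) * (\<rho>'\<^sup>2 * (1 + 4 / \<theta>) / \<kappa>)"
        using v kappa by (simp add: xx \<epsilon>_def field_simps)
      also have "\<dots> \<le> ln (ln ?v) * 1" using th(1) LL by (intro mult_left_mono) (auto simp: \<kappa>_def)
      finally show ?thesis by simp
    qed
    then have "exp (- ln (ln ?v)) / 2 \<le> exp (- ((x j)\<^sup>2 / W j) * (1/2 + 2 * \<epsilon>)) / 2"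
      by (intro divide_right_mono iffD2[OF exp_le_cancel_iff]) simp_all
    moreover have "exp (- ln (ln ?v)) / 2 = 1 / (2 * ln ?v)"
      using ln_ge_one[OF elim(2)] by (simp add: exp_minus field_simps)
    ultimately show ?case by linarith
  qed
  have "\<not> summable (\<lambda>j. prob {\<omega>\<in>space M. (1 - \<epsilon>) * x j \<le> Z j \<omega>})"
  proof
    assume sm: "summable (\<lambda>j. prob {\<omega>\<in>space M. (1 - \<epsilon>) * x j \<le> Z j \<omega>})"
    \<comment> \<open>From \<open>V (n (Suc j)) \<le> K' * \<theta> ^ Suc j\<close> and
      \<open>Suc j \<le> 2 * j\<close>; the leading 2 is the one in \<open>prob_lo\<close>.\<close>
    define C where "C = 2 * (ln K' + 2 * ln \<theta>)"
    have C: "0 < C" using K' th by (simp add: C_def add_nonneg_pos)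
    have Vn1_up: "\<forall>\<^sub>F j in sequentially. V (n (Suc j)) \<le> K' * \<theta> ^ Suc j"
      using Vn_up eventually_sequentially_Suc[of "\<lambda>j. V (n j) \<le> K' * \<theta> ^ j"] by simp
    have "\<forall>\<^sub>F j in sequentially. norm (1 / C * (1 / real j)) \<le> prob {\<omega>\<in>space M. (1 - \<epsilon>) * x j \<le> Z j \<omega>}"
      using prob_lo Vn1_up ev_e eventually_ge_at_top[of 1]
    proof eventually_elim
      case (elim j)
      let ?v = "V (n (Suc j))"
      have v: "0 < ?v" using elim(3) exp_gt_zero[of "1::real"] by linarith
      have "ln ?v \<le> ln (K' * \<theta> ^ Suc j)" using elim(2) v by (subst ln_le_cancel_iff) auto
      also have "\<dots> = ln K' + real (Suc j) * ln \<theta>" using K' th by (simp add: ln_mult ln_realpow del: power_Suc)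
      also have "\<dots> \<le> real j * ln K' + real j * (2 * ln \<theta>)"
      proof -
        have "1 * ln K' \<le> real j * ln K'" using elim(4) K' by (intro mult_right_mono) auto
        moreover have "real (Suc j) * ln \<theta> \<le> (real j * 2) * ln \<theta>" using elim(4) th by (intro mult_right_mono) auto
        ultimately show ?thesis by simp
      qed
      finally have "2 * ln ?v \<le> C * real j" by (simp add: C_def algebra_simps)
      then have "1 / (C * real j) \<le> 1 / (2 * ln ?v)" using ln_ge_one[OF elim(3)] C elim(4)
        by (intro divide_left_mono) auto
      then show ?case using elim(1) C by simp
    qed
    then have "summable (\<lambda>j. 1 / C * (1 / real j))" by (rule summable_comparison_test_ev[OF _ sm])
    then have "summable (\<lambda>j. C * (1 / C * (1 / real j)))" by (rule summable_mult)
    then have "summable (\<lambda>j. inverse (real j))" using C by (simp add: field_simps)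
    then show False using not_summable_harmonic[where 'a=real] by simp
  qed
  then have "AE \<omega> in M. \<exists>\<^sub>F j in sequentially. (1 - \<epsilon>) * x j \<le> Z j \<omega>"
    by (intro borel_cantelli_indep_vars[OF indZ]) auto
  moreover have "AE \<omega> in M. \<forall>\<^sub>F i in sequentially. - 2 * lil_scale (V i) \<le> S i \<omega>"
    using lil_lower_envelope[OF V, of 2] by simp
  ultimately show ?thesis
  proof eventually_elim
    case (elim \<omega>)
    have ev_e0: "\<forall>\<^sub>F j in sequentially. exp 1 \<le> V (n j)" using Vn_lim by (simp add: filterlim_at_top)
    have ev_S: "\<forall>\<^sub>F j in sequentially. - 2 * lil_scale (V (n j)) \<le> S (n j) \<omega>"
      using elim(2) n_lim by (rule eventually_compose_filterlim)
    have "\<exists>\<^sub>F j in sequentially. \<rho> * lil_scale (V (n (Suc j))) \<le> S (n (Suc j)) \<omega>"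
    proof (rule frequently_rev_mp[OF elim(1)])
      show "\<forall>\<^sub>F j in sequentially. (1 - \<epsilon>) * x j \<le> Z j \<omega> \<longrightarrow> \<rho> * lil_scale (V (n (Suc j))) \<le> S (n (Suc j)) \<omega>"
        using ev_S ev_e0 W_lo
      proof eventually_elim
        case (elim j)
        let ?v = "V (n (Suc j))"
        have le: "V (n j) \<le> ?v" using n_mono[of j "Suc j"] by (intro V_mono) simp
        have vpos: "exp 1 \<le> ?v" using le elim(2) by linarith
        have Vle: "V (n j) \<le> K' / \<theta> * ?v" using elim(3) V_split[of j] by (simp add: \<kappa>_def algebra_simps)
        have "0 < V (n j)" using elim(2) exp_gt_zero[of "1::real"] by linarith
        have lnle: "ln (V (n j)) \<le> ln ?v" using le \<open>0 < V (n j)\<close> by (subst ln_le_cancel_iff) auto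
        have "lil_scale (V (n j)) \<le> sqrt (2 * (K' / \<theta> * ?v) * ln (ln ?v))"
          unfolding lil_scale_def
        proof (intro real_sqrt_le_mono mult_mono mult_left_mono Vle)
          show "ln (ln (V (n j))) \<le> ln (ln ?v)" using lnle ln_ge_one[OF elim(2)] by (subst ln_le_cancel_iff) auto
          show "0 \<le> 2 * (K' / \<theta> * ?v)" using K' th V_nonneg[of "n (Suc j)"] by (intro mult_nonneg_nonneg) auto
        qed (use ln_ln_nonneg[OF elim(2)] V_nonneg in auto)
        also have "\<dots> = sqrt (K' / \<theta>) * lil_scale ?v"
          unfolding lil_scale_def real_sqrt_mult[symmetric] by (simp add: mult_ac)
        finally have hle: "lil_scale (V (n j)) \<le> sqrt (K' / \<theta>) * lil_scale ?v" .
        show ?case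
        proof
          assume Z: "(1 - \<epsilon>) * x j \<le> Z j \<omega>"
          have "\<rho> * lil_scale ?v \<le> ((1 - \<epsilon>) * \<rho>' - 2 * sqrt (K' / \<theta>)) * lil_scale ?v"
            using th(2) lil_scale_nonneg[OF vpos] by (intro mult_right_mono) (auto simp: \<epsilon>_def)
          also have "\<dots> = (1 - \<epsilon>) * x j - 2 * (sqrt (K' / \<theta>) * lil_scale ?v)" by (simp add: x_def algebra_simps)
          also have "\<dots> \<le> Z j \<omega> + S (n j) \<omega>" using hle elim(1) Z by linarith
          finally show "\<rho> * lil_scale ?v \<le> S (n (Suc j)) \<omega>" by (simp add: S_split)
        qed
      qed
    qed
    then show ?case
      unfolding frequently_def
      using eventually_compose_filterlim[OF _ filterlim_compose[OF n_lim filterlim_Suc],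
          of "\<lambda>n. \<not> \<rho> * lil_scale (V n) \<le> S n \<omega>"] by blast
  qed
qed

end

section \<open>Counting loose Hamilton cycles through a set of edges\<close>

text \<open>Replacing a falling factorial by a power costs only \<open>exp u\<close>: combine
  \<open>(n / u) ^ u \<le> n choose u\<close> with \<open>u ^ u \<le> exp u * fact u\<close>, a
  single term of the exponential series. A loss exponential in \<open>u\<close> is affordable, as
  \<open>u\<close> will be at most \<open>k\<close> times the number of edges.\<close>

lemma power_times_fact_le:
  assumes "u \<le> n"
  shows "real n ^ u * fact (n - u) \<le> exp (real u) * fact n"
proof (cases "u = 0")
  case False
  have "(\<lambda>i. (real u ^ i) /\<^sub>R fact i) sums exp (real u)" by (rule exp_converges)
  then have "(real u ^ u) /\<^sub>R fact u \<le> exp (real u)"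
    using sum_le_suminf[of "\<lambda>i. (real u ^ i) /\<^sub>R fact i" "{u}"] by (auto simp: sums_iff)
  then have e: "real u ^ u \<le> exp (real u) * fact u" by (simp add: field_simps)
  have "real n ^ u = (real n / real u) ^ u * real u ^ u" using False by (simp add: power_divide)
  also have "\<dots> \<le> real (n choose u) * (exp (real u) * fact u)"
    using binomial_ge_n_over_k_pow_k[OF assms, where 'a=real] e by (intro mult_mono) auto
  finally have "real n ^ u * fact (n - u) \<le> real (n choose u) * (exp (real u) * fact u) * fact (n - u)"
    by (intro mult_right_mono) auto
  also have "\<dots> = exp (real u) * (fact u * fact (n - u) * real (n choose u))" by simp
  also have "fact u * fact (n - u) * real (n choose u) = fact n" using assms by (simp add: binomial_fact)
  finally show ?thesis .
qed auto

text \<open>Composing with the inverse of one fixed extension sends the others injectively to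
  permutations fixing \<open>U\<close> pointwise.\<close>

lemma card_permutes_extending_le:
  assumes "finite A" "U \<subseteq> A"
  shows "card {\<tau>. \<tau> permutes A \<and> restrict \<tau> U = g} \<le> fact (card A - card U)"
proof (cases "{\<tau>. \<tau> permutes A \<and> restrict \<tau> U = g} = {}")
  case False
  then obtain \<tau>0 where t0: "\<tau>0 permutes A" "restrict \<tau>0 U = g" by auto
  have "card {\<tau>. \<tau> permutes A \<and> restrict \<tau> U = g} \<le> card {\<tau>. \<tau> permutes (A - U)}"
  proof (rule card_inj_on_le[where f="\<lambda>\<tau>. inv \<tau>0 \<circ> \<tau>"])
    show "inj_on (\<lambda>\<tau>. inv \<tau>0 \<circ> \<tau>) {\<tau>. \<tau> permutes A \<and> restrict \<tau> U = g}"
    proof (rule inj_onI)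
      fix a b assume "inv \<tau>0 \<circ> a = inv \<tau>0 \<circ> b"
      then have "(\<tau>0 \<circ> inv \<tau>0) \<circ> a = (\<tau>0 \<circ> inv \<tau>0) \<circ> b" by (simp add: comp_assoc)
      then show "a = b" using permutes_inv_o(1)[OF t0(1)] by simp
    qed
    show "(\<lambda>\<tau>. inv \<tau>0 \<circ> \<tau>) ` {\<tau>. \<tau> permutes A \<and> restrict \<tau> U = g} \<subseteq> {\<tau>. \<tau> permutes (A - U)}"
    proof clarsimp
      fix \<tau> assume t: "\<tau> permutes A" "g = restrict \<tau> U"
      have "inv \<tau>0 \<circ> \<tau> permutes A" using t(1) permutes_inv[OF t0(1)] by (rule permutes_compose)
      moreover have "(inv \<tau>0 \<circ> \<tau>) x = x" if "x \<in> A - (A - U)" for x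
      proof -
        have "x \<in> U" using that by auto
        then have "\<tau> x = \<tau>0 x" using t(2) t0(2) by (metis restrict_apply')
        then show ?thesis using permutes_inverses(2)[OF t0(1)] by simp
      qed
      ultimately show "inv \<tau>0 \<circ> \<tau> permutes (A - U)" by (rule permutes_superset)
    qed
    show "finite {\<tau>. \<tau> permutes (A - U)}" using assms by (intro finite_permutations) auto
  qed
  also have "\<dots> = fact (card A - card U)"
    using assms by (intro card_permutations card_Diff_subset) (auto intro: finite_subset)
  finally show ?thesis .
next
  case True
  then show ?thesis unfolding True by simp
qed

text \<open>Quantifying over all subfamilies makes the property hereditary, so that edges can be
  removed one after another. A complete loose cycle does not have it: every edge meets its
  neighbours in two vertices.\<close>

definition peelable :: "'a set set \<Rightarrow> bool" where
  "peelable S \<longleftrightarrow> (\<forall>T\<subseteq>S. T \<noteq> {} \<longrightarrow> (\<exists>e\<in>T. card (e \<inter> \<Union>(T - {e})) \<le> 1))"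

lemma peelable_subset: "peelable S \<Longrightarrow> T \<subseteq> S \<Longrightarrow> peelable T"
  by (auto simp: peelable_def)

text \<open>Averaging over permutations will turn the number of cycles containing \<open>S\<close>
  into the size of this set, with \<open>C\<close> a fixed cycle.\<close>

definition perms_into :: "'a set \<Rightarrow> 'a set set \<Rightarrow> 'a set set \<Rightarrow> ('a \<Rightarrow> 'a) set" where
  "perms_into A C S = {\<tau>. \<tau> permutes A \<and> (\<forall>e\<in>S. \<tau> ` e \<in> C)}"

lemma finite_perms_into: "finite A \<Longrightarrow> finite (perms_into A C S)"
  unfolding perms_into_def by (rule finite_subset[OF _ finite_permutations[of A]]) auto

text \<open>
  Peel off an edge \<open>e\<close> of \<open>S\<close> meeting the others in at most one vertex: if it meets none, its image is any of
  the at most \<open>card A\<close> edges of \<open>C\<close>; if it meets them in \<open>x\<close>, its image is one of the at most two edges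
  through the image of \<open>x\<close>, but then \<open>e\<close> has only \<open>k - 1\<close> new vertices.
\<close>

lemma card_restrict_perms_into:
  fixes A :: "'a set"
  assumes A: "finite A" "A \<noteq> {}" and C: "finite C" "card C \<le> card A" "\<And>f. f \<in> C \<Longrightarrow> finite f \<and> card f = k"
    and deg: "\<And>y. card {f\<in>C. y \<in> f} \<le> 2"
    and S: "finite S" "\<And>e. e \<in> S \<Longrightarrow> finite e \<and> card e = k" "peelable S" and k: "0 < k"
  shows "card ((\<lambda>\<tau>. restrict \<tau> (\<Union>S)) ` perms_into A C S) * card A ^ (card S * (k - 1))
    \<le> (2 * k ^ k) ^ card S * card A ^ card (\<Union>S)"
  using S
proof (induction S rule: finite_remove_induct)
  case empty
  have "(\<lambda>\<tau>. restrict \<tau> (\<Union>{})) ` perms_into A C {} \<subseteq> {\<lambda>_. undefined}" by auto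
  then have "card ((\<lambda>\<tau>. restrict \<tau> (\<Union>{})) ` perms_into A C {}) \<le> card {\<lambda>_::'a. undefined :: 'a}"
    by (intro card_mono) auto
  then show ?case by (simp add: restrict_def)
next
  case (remove S)
  from remove.prems(2) remove.hyps obtain e where e: "e \<in> S" "card (e \<inter> \<Union>(S - {e})) \<le> 1"
    unfolding peelable_def by blast
  define T where "T = S - {e}"
  define R where "R S = (\<lambda>\<tau>. restrict \<tau> (\<Union>S)) ` perms_into A C S" for S
  have fin_e: "finite e" "card e = k" using remove.prems(1) e by auto
  have finS: "finite S" by fact
  have fin_T: "finite (\<Union>T)" using finS remove.prems(1) by (auto simp: T_def)
  have IH: "card (R T) * card A ^ (card T * (k - 1)) \<le> (2 * k ^ k) ^ card T * card A ^ card (\<Union>T)"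
    unfolding R_def T_def using remove e by (intro remove.IH) (auto intro: peelable_subset)
  have cS: "card S = Suc (card T)" unfolding T_def by (rule card.remove[OF finS e(1)])
  have US: "\<Union>S = e \<union> \<Union>T" using e by (auto simp: T_def)
  \<comment> \<open>One number for both effects of an edge disjoint from the rest: a factor
    \<open>card A\<close> for the choice of its image, and one more new vertex. They balance in the
    bound.\<close>
  define j where "j = (if e \<inter> \<Union>T = {} then 1 else 0 :: nat)"
  have cU: "card (\<Union>S) = card (\<Union>T) + (k - 1) + j"
  proof -
    have "card (\<Union>S) + card (e \<inter> \<Union>T) = k + card (\<Union>T)"
      unfolding US using card_Un_Int[OF fin_e(1) fin_T] fin_e by simp
    moreover have "card (e \<inter> \<Union>T) = 1 - j"
    proof (cases "e \<inter> \<Union>T = {}")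
      case False
      then have "card (e \<inter> \<Union>T) \<noteq> 0" using fin_e by simp
      then show ?thesis using e(2) False by (simp add: j_def T_def)
    qed (simp add: j_def)
    ultimately show ?thesis using k by (simp add: j_def split: if_splits)
  qed
  define J where "J g = {f\<in>C. \<forall>x\<in>e \<inter> \<Union>T. g x \<in> f}" for g
  define B where "B g = (\<Union>f\<in>J g. e \<rightarrow>\<^sub>E f)" for g
  have cardJ: "card (J g) \<le> 2 * card A ^ j" for g
  proof (cases "e \<inter> \<Union>T = {}")
    case True
    have "card (J g) \<le> card C" unfolding J_def using C by (intro card_mono) auto
    then show ?thesis using C(2) True by (simp add: j_def)
  next
    case False
    then obtain x where "x \<in> e \<inter> \<Union>T" by auto
    then have "card (J g) \<le> card {f\<in>C. g x \<in> f}" unfolding J_def using C by (intro card_mono) auto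
    then show ?thesis using deg[of "g x"] False by (simp add: j_def)
  qed
  have finJ: "finite (J g)" for g using C by (simp add: J_def)
  have finB: "finite (B g)" for g
    unfolding B_def using finJ fin_e C by (intro finite_UN_I finite_PiE) (auto simp: J_def)
  have cardB: "card (B g) \<le> 2 * card A ^ j * k ^ k" for g
  proof -
    have "card (B g) \<le> (\<Sum>f\<in>J g. card (e \<rightarrow>\<^sub>E f))" unfolding B_def by (rule card_UN_le[OF finJ])
    also have "\<dots> = (\<Sum>f\<in>J g. k ^ k)" using C fin_e by (intro sum.cong) (auto simp: J_def card_PiE)
    also have "\<dots> = card (J g) * k ^ k" by simp
    also have "\<dots> \<le> 2 * card A ^ j * k ^ k" using cardJ by (intro mult_right_mono) auto
    finally show ?thesis .
  qed
  have finR: "finite (R T)" unfolding R_def using A by (intro finite_imageI finite_perms_into)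
  have sub: "R S \<subseteq> (\<lambda>(g, h) y. if y \<in> e then h y else g y) ` (SIGMA g:R T. B g)"
  proof
    fix g assume "g \<in> R S"
    then obtain \<tau> where t: "\<tau> \<in> perms_into A C S" "g = restrict \<tau> (\<Union>S)" by (auto simp: R_def)
    have "\<tau> \<in> perms_into A C T" using t by (auto simp: perms_into_def T_def)
    then have 1: "restrict \<tau> (\<Union>T) \<in> R T" by (auto simp: R_def)
    have "\<tau> ` e \<in> J (restrict \<tau> (\<Union>T))" using t e by (auto simp: J_def perms_into_def)
    moreover have "restrict \<tau> e \<in> e \<rightarrow>\<^sub>E \<tau> ` e" by auto
    ultimately have 2: "restrict \<tau> e \<in> B (restrict \<tau> (\<Union>T))" unfolding B_def by (rule UN_I)
    have 3: "g = (\<lambda>(g, h) y. if y \<in> e then h y else g y) (restrict \<tau> (\<Union>T), restrict \<tau> e)"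
      using t(2) US by (auto simp: fun_eq_iff restrict_def)
    have "(restrict \<tau> (\<Union>T), restrict \<tau> e) \<in> (SIGMA g:R T. B g)"
      unfolding mem_Sigma_iff using 1 2 by (rule conjI)
    from imageI[OF this, of "\<lambda>(g, h) y. if y \<in> e then h y else g y"]
    show "g \<in> (\<lambda>(g, h) y. if y \<in> e then h y else g y) ` (SIGMA g:R T. B g)"
      unfolding 3 .
  qed
  have "card (R S) \<le> card (SIGMA g:R T. B g)"
    using finR finB by (intro surj_card_le[OF _ sub]) auto
  also have "\<dots> = (\<Sum>g\<in>R T. card (B g))" using finR finB by (simp add: card_SigmaI)
  also have "\<dots> \<le> (\<Sum>g\<in>R T. 2 * card A ^ j * k ^ k)" by (intro sum_mono cardB)
  also have "\<dots> = card (R T) * (2 * k ^ k) * card A ^ j" by simp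
  finally have "card (R S) * card A ^ (card S * (k - 1)) \<le>
      card (R T) * (2 * k ^ k) * card A ^ j * card A ^ (card S * (k - 1))" by (rule mult_right_mono) simp
  also have "\<dots> = (card (R T) * card A ^ (card T * (k - 1))) * ((2 * k ^ k) * card A ^ (j + (k - 1)))"
    unfolding cS mult_Suc power_add by (simp only: mult_ac)
  also have "\<dots> \<le> ((2 * k ^ k) ^ card T * card A ^ card (\<Union>T)) * ((2 * k ^ k) * card A ^ (j + (k - 1)))"
    by (intro mult_right_mono IH) simp
  also have "\<dots> = (2 * k ^ k) ^ card S * card A ^ card (\<Union>S)"
    unfolding cS cU power_add power_Suc by (simp only: mult_ac)
  finally show ?case unfolding R_def .
qed

text \<open>Each restriction to \<open>\<Union>S\<close> extends to at most
  \<open>fact (n - u)\<close> permutations, where \<open>u = card (\<Union>S)\<close>. The powers of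
  \<open>n\<close> gained and lost combine into
  \<open>n ^ u * fact (n - u) \<le> exp u * fact n\<close>, and
  \<open>u \<le> card S * k\<close>.\<close>

lemma card_perms_into_le:
  fixes A :: "'a set"
  assumes A: "finite A" "A \<noteq> {}" and C: "finite C" "card C \<le> card A" "\<And>f. f \<in> C \<Longrightarrow> finite f \<and> card f = k"
    and deg: "\<And>y. card {f\<in>C. y \<in> f} \<le> 2"
    and S: "finite S" "\<And>e. e \<in> S \<Longrightarrow> e \<subseteq> A \<and> card e = k" "peelable S" and k: "0 < k"
  shows "real (card (perms_into A C S)) * real (card A) ^ (card S * (k - 1))
    \<le> (2 * real k ^ k * exp (real k)) ^ card S * fact (card A)"
proof -
  let ?U = "\<Union>S" and ?n = "card A"
  let ?R = "(\<lambda>\<tau>. restrict \<tau> ?U) ` perms_into A C S"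
  have UA: "?U \<subseteq> A" using S by auto
  have u: "card ?U \<le> ?n" using UA A by (intro card_mono)
  have finR: "finite ?R" using A by (intro finite_imageI finite_perms_into)
  have us: "card ?U \<le> card S * k"
    using card_UN_le[OF S(1), of "\<lambda>e. e"] S(2) by simp
  have "perms_into A C S \<subseteq> (\<Union>g\<in>?R. {\<tau>. \<tau> permutes A \<and> restrict \<tau> ?U = g})"
    by (auto simp: perms_into_def)
  then have "card (perms_into A C S) \<le> card (\<Union>g\<in>?R. {\<tau>. \<tau> permutes A \<and> restrict \<tau> ?U = g})"
    using finR A by (intro card_mono finite_UN_I) (auto intro: finite_subset[OF _ finite_permutations[OF A(1)]])
  also have "\<dots> \<le> (\<Sum>g\<in>?R. card {\<tau>. \<tau> permutes A \<and> restrict \<tau> ?U = g})"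
    by (rule card_UN_le[OF finR])
  also have "\<dots> \<le> (\<Sum>g\<in>?R. fact (?n - card ?U))"
    by (intro sum_mono card_permutes_extending_le A UA)
  also have "\<dots> = card ?R * fact (?n - card ?U)" by simp
  finally have "card (perms_into A C S) * ?n ^ (card S * (k - 1)) \<le> card ?R * fact (?n - card ?U) * ?n ^ (card S * (k - 1))"
    by (rule mult_right_mono) simp
  also have "\<dots> = (card ?R * ?n ^ (card S * (k - 1))) * fact (?n - card ?U)" by simp
  also have "\<dots> \<le> ((2 * k ^ k) ^ card S * ?n ^ card ?U) * fact (?n - card ?U)"
  proof (rule mult_right_mono[OF card_restrict_perms_into[OF A C deg S(1) _ S(3) k]])
    show "finite e \<and> card e = k" if "e \<in> S" for e
      using S(2)[OF that] finite_subset[OF _ A(1)] by blast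
  qed auto
  finally have "real (card (perms_into A C S) * ?n ^ (card S * (k - 1))) \<le> real (((2 * k ^ k) ^ card S * ?n ^ card ?U) * fact (?n - card ?U))"
    by (rule of_nat_mono)
  then have "real (card (perms_into A C S)) * real ?n ^ (card S * (k - 1)) \<le> (2 * real k ^ k) ^ card S * (real ?n ^ card ?U * fact (?n - card ?U))"
    by (simp only: of_nat_mult of_nat_power of_nat_fact of_nat_numeral mult.assoc)
  also have "\<dots> \<le> (2 * real k ^ k) ^ card S * (exp (real (card S * k)) * fact ?n)"
  proof (intro mult_left_mono)
    have "real ?n ^ card ?U * fact (?n - card ?U) \<le> exp (real (card ?U)) * fact ?n" by (rule power_times_fact_le[OF u])
    also have "\<dots> \<le> exp (real (card S * k)) * fact ?n" using us by (intro mult_right_mono iffD2[OF exp_le_cancel_iff] of_nat_mono) auto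
    finally show "real ?n ^ card ?U * fact (?n - card ?U) \<le> exp (real (card S * k)) * fact ?n" .
  qed simp
  also have "exp (real (card S * k)) = exp (real k) ^ card S" by (simp only: of_nat_mult exp_of_nat_mult)
  finally show ?thesis by (simp only: power_mult_distrib mult.assoc)
qed

section \<open>The edges of one loose cycle, described by positions\<close>

locale loose_cycle =
  fixes k q m n :: nat and v :: "nat \<Rightarrow> nat"
  assumes q: "2 \<le> q" and m: "3 \<le> m" and k: "k = Suc q" and n: "n = m * q"
    and v: "bij_betw v {..<n} {1..n}"
begin

definition blk :: "nat \<Rightarrow> nat set" where
  "blk i = (\<lambda>j. (i * q + j) mod n) ` {..<k}"

definition E :: "nat \<Rightarrow> nat set" where
  "E i = v ` blk i"

definition edges :: "nat set set" where
  "edges = E ` {..<m}"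

text \<open>Only the last position of a block can wrap around. Hereafter the geometry is arithmetic
  of \<open>x div q\<close>: a position lies in block \<open>x div q\<close> and, when it is a
  multiple of \<open>q\<close>, also in the preceding one.\<close>

lemma mem_blk: "i < m \<Longrightarrow> x \<in> blk i \<longleftrightarrow> x < n \<and> (x div q = i \<or> x = (Suc i mod m) * q)"
proof -
  assume i: "i < m"
  have small: "i * q + j < n" if "j < q" for j
  proof -
    have "i * q + j < Suc i * q" using that by simp
    also have "\<dots> \<le> m * q" using i by (intro mult_right_mono) auto
    finally show ?thesis by (simp add: n)
  qed
  have "{..<k} = insert q {..<q}" using k by auto
  then have "blk i = insert ((i * q + q) mod n) ((\<lambda>j. (i * q + j) mod n) ` {..<q})"
    by (simp add: blk_def)
  also have "(i * q + q) mod n = (Suc i mod m) * q"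
    unfolding n by (simp add: mult_mod_left add.commute)
  also have "(\<lambda>j. (i * q + j) mod n) ` {..<q} = (\<lambda>j. i * q + j) ` {..<q}"
    using small by (intro image_cong) auto
  also have "\<dots> = {x. x < n \<and> x div q = i}"
  proof (intro equalityI subsetI)
    fix x assume "x \<in> (\<lambda>j. i * q + j) ` {..<q}"
    then show "x \<in> {x. x < n \<and> x div q = i}" using small q by auto
  next
    fix x assume "x \<in> {x. x < n \<and> x div q = i}"
    then have "x = i * q + x mod q" "x mod q < q" using q by auto
    then show "x \<in> (\<lambda>j. i * q + j) ` {..<q}" by blast
  qed
  finally show ?thesis using m q n by auto
qed

lemma blk_sub: "i < m \<Longrightarrow> blk i \<subseteq> {..<n}"
  by (auto simp: mem_blk)

lemma v_inj: "x < n \<Longrightarrow> y < n \<Longrightarrow> v x = v y \<longleftrightarrow> x = y"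
  using v by (auto simp: bij_betw_def inj_on_def)

lemma succ_inj: "i < m \<Longrightarrow> j < m \<Longrightarrow> Suc i mod m = Suc j mod m \<Longrightarrow> i = j"
  using m by (auto simp: mod_Suc split: if_splits)

lemma card_blk: "i < m \<Longrightarrow> card (blk i) = k"
proof -
  assume i: "i < m"
  have "inj_on (\<lambda>j. (i * q + j) mod n) {..<k}"
  proof (rule inj_onI)
    fix a b assume ab: "a \<in> {..<k}" "b \<in> {..<k}" and eq: "(i * q + a) mod n = (i * q + b) mod n"
    have kn: "k \<le> n"
    proof -
      have "Suc q \<le> 3 * q" using q by simp
      also have "\<dots> \<le> m * q" using m by (intro mult_right_mono) auto
      finally show ?thesis by (simp add: k n)
    qed
    have "[i * q + a = i * q + b] (mod n)" using eq by (simp add: cong_def)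
    then have "[a = b] (mod n)" by (simp add: cong_add_lcancel_nat)
    then show "a = b" using ab kn by (simp add: cong_less_modulus_unique_nat)
  qed
  then show ?thesis by (simp add: blk_def card_image)
qed

lemma E_sub: "i < m \<Longrightarrow> E i \<subseteq> {1..n}"
  using blk_sub v by (auto simp: E_def bij_betw_def)

lemma card_E: "i < m \<Longrightarrow> card (E i) = k"
proof -
  assume i: "i < m"
  have "inj_on v (blk i)" using v blk_sub[OF i] by (auto simp: bij_betw_def intro: inj_on_subset)
  then show ?thesis by (simp add: E_def card_image card_blk[OF i])
qed

lemma mem_E: "i < m \<Longrightarrow> x < n \<Longrightarrow> v x \<in> E i \<longleftrightarrow> x \<in> blk i"
  using blk_sub[of i] v_inj by (auto simp: E_def)

lemma E_inj: "inj_on E {..<m}"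
proof (rule inj_onI)
  fix i j assume ij: "i \<in> {..<m}" "j \<in> {..<m}" and eq: "E i = E j"
  \<comment> \<open>An interior position, which exists as \<open>q \<ge> 2\<close>, belongs to a
    single block; the position \<open>i * q\<close> would not do, being shared with the preceding
    block.\<close>
  let ?x = "i * q + 1"
  have "?x < Suc i * q" using q by simp
  also have "\<dots> \<le> n" unfolding n using ij by (intro mult_right_mono) auto
  finally have x: "?x < n" .
  have d: "?x div q = i" by (rule div_nat_eqI) (use q in simp_all)
  then have "?x \<in> blk i" using ij x by (simp add: mem_blk)
  then have "?x \<in> blk j" using mem_E[of i ?x] mem_E[of j ?x] ij x eq by auto
  then have "?x div q = j \<or> ?x = (Suc j mod m) * q" using ij by (simp add: mem_blk)
  moreover have "?x \<noteq> (Suc j mod m) * q"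
  proof
    assume "?x = (Suc j mod m) * q"
    then have "?x mod q = 0" by (metis mod_mult_self2_is_0)
    then show False using q by (simp add: mod_Suc split: if_splits)
  qed
  ultimately show "i = j" using d by simp
qed

lemma card_edges: "card edges = m"
  by (simp add: edges_def card_image E_inj)

lemma finite_edges: "finite edges"
  by (simp add: edges_def)

lemma edges_sub: "edges \<subseteq> nsets {1..n} k"
proof
  fix e assume "e \<in> edges"
  then obtain i where i: "i < m" "e = E i" by (auto simp: edges_def)
  have "finite e" unfolding i(2) by (rule finite_subset[OF E_sub[OF i(1)]]) simp
  then show "e \<in> nsets {1..n} k" using E_sub[OF i(1)] card_E[OF i(1)] i(2) by (simp add: nsets_def)
qed

lemma edges_degree: "card {e\<in>edges. y \<in> e} \<le> 2"
proof (cases "y \<in> v ` {..<n}")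
  case True
  then obtain x where x: "x < n" "y = v x" by auto
  let ?Q = "{i. i < m \<and> Suc i mod m = x div q}"
  have "{e\<in>edges. y \<in> e} \<subseteq> E ` (insert (x div q) ?Q)"
  proof
    fix e assume "e \<in> {e\<in>edges. y \<in> e}"
    then have e: "e \<in> edges" "y \<in> e" by auto
    then obtain i where i: "i < m" "e = E i" by (auto simp: edges_def)
    then have "x \<in> blk i" using mem_E x e by auto
    then have "x div q = i \<or> Suc i mod m = x div q" using i q by (auto simp: mem_blk)
    then show "e \<in> E ` (insert (x div q) ?Q)" using i by auto
  qed
  then have "card {e\<in>edges. y \<in> e} \<le> card (E ` (insert (x div q) ?Q))" by (intro card_mono) auto
  also have "\<dots> \<le> card (insert (x div q) ?Q)" by (intro card_image_le) auto
  also have "\<dots> \<le> Suc (card ?Q)" by (simp add: card_insert_if)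
  also have "card ?Q \<le> 1" using succ_inj by (auto simp: card_le_Suc0_iff_eq)
  finally show ?thesis by simp
next
  case False
  then have "y \<notin> E i" if "i < m" for i using blk_sub[OF that] by (auto simp: E_def)
  then have "{e\<in>edges. y \<in> e} = {}" by (auto simp: edges_def)
  then show ?thesis by (simp only: card.empty)
qed

text \<open>A nonempty set of indices closed under cyclic succession is everything. So any nonempty
  subfamily of a proper subset has an edge whose successor is missing, and this edge can meet the
  others only in its first vertex \<open>v (i * q)\<close>.\<close>

lemma edges_peelable:
  assumes "S \<subseteq> edges" "S \<noteq> edges"
  shows "peelable S"
  unfolding peelable_def
proof (intro allI impI)
  fix T' assume T': "T' \<subseteq> S" "T' \<noteq> {}"
  define T where "T = {i. i < m \<and> E i \<in> T'}"
  have T'T: "T' = E ` T" using T' assms by (auto simp: T_def edges_def)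
  have "\<exists>i\<in>T. Suc i mod m \<notin> T"
  proof (rule ccontr)
    assume "\<not> ?thesis"
    then have step: "Suc i mod m \<in> T" if "i \<in> T" for i using that by auto
    obtain i0 where i0: "i0 \<in> T" using T' T'T by auto
    have all: "(i0 + j) mod m \<in> T" for j
    proof (induction j)
      case 0 then show ?case using i0 by (simp add: T_def)
    next
      case (Suc j) from step[OF this] show ?case by (simp add: mod_Suc_eq)
    qed
    have "i \<in> T" if "i < m" for i
    proof -
      have "(i0 + (m - i0 + i)) mod m = i" using i0 that by (simp add: T_def)
      then show ?thesis using all[of "m - i0 + i"] by simp
    qed
    then have "edges \<subseteq> T'" using T'T by (auto simp: edges_def)
    then show False using T' assms by auto
  qed
  then obtain i where i: "i \<in> T" "Suc i mod m \<notin> T" by auto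
  have im: "i < m" using i by (simp add: T_def)
  have "E i \<inter> \<Union>(T' - {E i}) \<subseteq> {v (i * q)}"
  proof
    fix y assume "y \<in> E i \<inter> \<Union>(T' - {E i})"
    then obtain j where j: "j \<in> T" "j \<noteq> i" "y \<in> E i" "y \<in> E j" using T'T by auto
    have jm: "j < m" using j by (simp add: T_def)
    obtain x where x: "x \<in> blk i" "y = v x" using j by (auto simp: E_def)
    have xn: "x < n" using x im by (simp add: mem_blk)
    have xj: "x \<in> blk j" using j x mem_E[OF jm xn] by simp
    have "x div q = i"
    proof (rule ccontr)
      assume "x div q \<noteq> i"
      then have xi: "x = (Suc i mod m) * q" using x im by (simp add: mem_blk)
      then have "x div q = Suc i mod m" using q by simp
      then have "x div q \<noteq> j" using i j by auto
      then have "x = (Suc j mod m) * q" using xj jm by (simp add: mem_blk)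
      then have "Suc i mod m = Suc j mod m" using xi q by simp
      then show False using succ_inj[OF im jm] j by simp
    qed
    then have "x div q \<noteq> j" using j by simp
    then have "x = (Suc j mod m) * q" using xj jm by (simp add: mem_blk)
    then have "x = i * q" using \<open>x div q = i\<close> q by simp
    then show "y \<in> {v (i * q)}" using x by simp
  qed
  then have "card (E i \<inter> \<Union>(T' - {E i})) \<le> card {v (i * q)}" by (intro card_mono) auto
  moreover have "E i \<in> T'" using i by (simp add: T_def)
  ultimately show "\<exists>e\<in>T'. card (e \<inter> \<Union>(T' - {e})) \<le> 1" by auto
qed

end

lemma loose_hamilton_cycle_iff:
  assumes "2 \<le> q"
  shows "loose_hamilton_cycle (Suc q) (m * q) C \<longleftrightarrow>
    (\<exists>v. bij_betw v {..<m * q} {1..m * q} \<and>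
      C = (\<lambda>i. v ` ((\<lambda>j. (i * q + j) mod (m * q)) ` {..<Suc q})) ` {..<m})"
  using assms unfolding loose_hamilton_cycle_def by (simp add: image_image)

lemma loose_hamilton_cycleE:
  assumes "loose_hamilton_cycle k n C" "k = Suc q" "n = m * q" "2 \<le> q" "3 \<le> m"
  obtains v where "loose_cycle k q m n v" "C = loose_cycle.edges k q m n v"
proof -
  obtain v where v': "bij_betw v {..<m * q} {1..m * q}"
      "C = (\<lambda>i. v ` ((\<lambda>j. (i * q + j) mod (m * q)) ` {..<Suc q})) ` {..<m}"
    using assms loose_hamilton_cycle_iff by auto
  interpret loose_cycle k q m n v by standard (use assms v' in auto)
  have "C = edges" unfolding edges_def E_def blk_def using v'(2) assms by simp
  with loose_cycle_axioms show ?thesis by (rule that)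
qed

lemma card_nsets: "finite A \<Longrightarrow> card (nsets A k) = card A choose k"
proof -
  assume A: "finite A"
  then have "nsets A k = {B. B \<subseteq> A \<and> card B = k}"
    by (auto simp: nsets_def intro: finite_subset)
  then show ?thesis using n_subsets[OF A, of k] by simp
qed

section \<open>The family of all cycles: symmetry and extension counts\<close>

definition lhcs :: "nat \<Rightarrow> nat \<Rightarrow> nat set set set" where
  "lhcs k n = {C. loose_hamilton_cycle k n C}"

lemma loose_hamilton_cycle_permute:
  assumes "loose_hamilton_cycle k n C" "\<sigma> permutes {1..n}"
  shows "loose_hamilton_cycle k n ((`) \<sigma> ` C)"
proof -
  obtain v where v: "(k - 1) dvd n" "bij_betw v {..<n} {1..n}"
      "C = (\<lambda>i. (\<lambda>j. v ((i * (k - 1) + j) mod n)) ` {..<k}) ` {..<n div (k - 1)}"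
    using assms(1) by (auto simp: loose_hamilton_cycle_def)
  have "bij_betw (\<sigma> \<circ> v) {..<n} {1..n}"
    using v(2) permutes_imp_bij[OF assms(2)] by (rule bij_betw_trans)
  moreover have "(`) \<sigma> ` C = (\<lambda>i. (\<lambda>j. (\<sigma> \<circ> v) ((i * (k - 1) + j) mod n)) ` {..<k}) ` {..<n div (k - 1)}"
    unfolding v(3) by (simp add: image_image)
  ultimately show ?thesis using v(1) unfolding loose_hamilton_cycle_def by blast
qed

text \<open>The only symmetry in use: with a singleton \<open>S\<close> it gives equal degrees, with
  all \<open>\<sigma>\<close> together it gives the averaging argument.\<close>

lemma bij_betw_lhcs_permute:
  assumes "\<sigma> permutes {1..n}"
  shows "bij_betw (\<lambda>C. (`) \<sigma> ` C) {C \<in> lhcs k n. S \<subseteq> C} {C \<in> lhcs k n. (`) \<sigma> ` S \<subseteq> C}"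
proof (rule bij_betw_byWitness[where f'="\<lambda>C. (`) (inv \<sigma>) ` C"])
  have inv: "inv \<sigma> permutes {1..n}" using assms by (rule permutes_inv)
  have 1: "(`) (inv \<sigma>) ` ((`) \<sigma> ` C) = C" for C
    by (simp add: image_image permutes_inverses[OF assms])
  have 2: "(`) \<sigma> ` ((`) (inv \<sigma>) ` C) = C" for C
    by (simp add: image_image permutes_inverses[OF assms])
  show "\<forall>C\<in>{C \<in> lhcs k n. S \<subseteq> C}. (`) (inv \<sigma>) ` ((`) \<sigma> ` C) = C" using 1 by blast
  show "\<forall>C\<in>{C \<in> lhcs k n. (`) \<sigma> ` S \<subseteq> C}. (`) \<sigma> ` ((`) (inv \<sigma>) ` C) = C" using 2 by blast
  show "(\<lambda>C. (`) \<sigma> ` C) ` {C \<in> lhcs k n. S \<subseteq> C} \<subseteq> {C \<in> lhcs k n. (`) \<sigma> ` S \<subseteq> C}"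
    using loose_hamilton_cycle_permute[OF _ assms] by (auto simp: lhcs_def)
  show "(\<lambda>C. (`) (inv \<sigma>) ` C) ` {C \<in> lhcs k n. (`) \<sigma> ` S \<subseteq> C} \<subseteq> {C \<in> lhcs k n. S \<subseteq> C}"
  proof
    fix D assume "D \<in> (\<lambda>C. (`) (inv \<sigma>) ` C) ` {C \<in> lhcs k n. (`) \<sigma> ` S \<subseteq> C}"
    then obtain C where C: "C \<in> lhcs k n" "(`) \<sigma> ` S \<subseteq> C" "D = (`) (inv \<sigma>) ` C" by blast
    have "S \<subseteq> D" using image_mono[OF C(2), of "(`) (inv \<sigma>)"] unfolding 1 C(3) .
    then show "D \<in> {C \<in> lhcs k n. S \<subseteq> C}"
      using C loose_hamilton_cycle_permute[OF _ inv] by (auto simp: lhcs_def)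
  qed
qed

lemma ex_permutes_image:
  assumes "finite A" "e \<subseteq> A" "f \<subseteq> A" "card e = card f"
  obtains \<sigma> where "\<sigma> permutes A" "\<sigma> ` e = f"
proof -
  have fin: "finite e" "finite f" using assms finite_subset by auto
  obtain g where g: "bij_betw g e f" using finite_same_card_bij[OF fin assms(4)] by auto
  have "card (A - e) = card (A - f)" using assms fin by (simp add: card_Diff_subset)
  then obtain h where h: "bij_betw h (A - e) (A - f)" using finite_same_card_bij[of "A - e" "A - f"] assms by auto
  define s where "s x = (if x \<in> e then g x else if x \<in> A then h x else x)" for x
  have 1: "bij_betw s e f" using g by (rule bij_betw_cong[THEN iffD1, rotated]) (auto simp: s_def)
  have 2: "bij_betw s (A - e) (A - f)" using h by (rule bij_betw_cong[THEN iffD1, rotated]) (auto simp: s_def)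
  have "bij_betw s (e \<union> (A - e)) (f \<union> (A - f))" by (rule bij_betw_combine[OF 1 2]) auto
  then have "bij_betw s A A" using assms(2,3) by (simp add: Un_absorb1)
  then have "s permutes A" by (rule bij_imp_permutes) (use assms(2) in \<open>auto simp: s_def\<close>)
  moreover have "s ` e = f" using 1 by (simp add: bij_betw_def)
  ultimately show ?thesis by (rule that)
qed

locale lhc_params =
  fixes k q m n :: nat
  assumes q: "2 \<le> q" and m: "3 \<le> m" and k: "k = Suc q" and n: "n = m * q"
begin

lemma lhcs_cycle:
  assumes "C \<in> lhcs k n"
  obtains v where "loose_cycle k q m n v" "C = loose_cycle.edges k q m n v"
  using loose_hamilton_cycleE[of k n C q m] assms k n q m by (auto simp: lhcs_def)

lemma lhcs_sub: "C \<in> lhcs k n \<Longrightarrow> C \<subseteq> nsets {1..n} k"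
  by (elim lhcs_cycle) (simp only: loose_cycle.edges_sub)

lemma lhcs_card: "C \<in> lhcs k n \<Longrightarrow> card C = m"
  by (elim lhcs_cycle) (simp add: loose_cycle.card_edges)

lemma lhcs_finite: "C \<in> lhcs k n \<Longrightarrow> finite C"
  by (elim lhcs_cycle) (simp add: loose_cycle.finite_edges)

lemma finite_lhcs: "finite (lhcs k n)"
  by (rule finite_subset[of _ "Pow (nsets {1..n} k)"]) (use lhcs_sub in \<open>auto simp: finite_imp_finite_nsets\<close>)

lemma lhcs_nonempty: "lhcs k n \<noteq> {}"
proof -
  have "bij_betw Suc {..<m * q} {1..m * q}"
    by (rule bij_betw_imageI) (auto simp: image_Suc_lessThan)
  then have "\<exists>C. loose_hamilton_cycle (Suc q) (m * q) C"
    using loose_hamilton_cycle_iff[OF q] by blast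
  then show ?thesis unfolding k n lhcs_def by blast
qed

lemma n_pos: "0 < n" using q m n by simp

text \<open>Count pairs of a permutation \<open>\<tau>\<close> and a cycle \<open>C\<close>
  containing the image of \<open>S\<close> in two ways. By symmetry every \<open>\<tau>\<close>
  contributes the number of cycles through \<open>S\<close>; every \<open>C\<close> contributes
  \<open>card (perms_into {1..n} C S)\<close>, which is bounded because a proper subset of a cycle
  is peelable.\<close>

lemma card_lhcs_superset_proper:
  assumes C0: "C0 \<in> lhcs k n" and S: "S \<subset> C0"
  shows "real (card {C \<in> lhcs k n. S \<subseteq> C}) * real n ^ (card S * (k - 1))
    \<le> real (card (lhcs k n)) * (2 * real k ^ k * exp (real k)) ^ card S"
proof -
  let ?A = "{1..n}" and ?L = "lhcs k n" and ?D = "2 * real k ^ k * exp (real k)"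
  let ?P = "{\<tau>. \<tau> permutes ?A}"
  have finP: "finite ?P" by (simp add: finite_permutations)
  have "(\<Sum>\<tau>\<in>?P. card {C \<in> ?L. (`) \<tau> ` S \<subseteq> C}) = (\<Sum>\<tau>\<in>?P. card {C \<in> ?L. S \<subseteq> C})"
    by (intro sum.cong refl bij_betw_same_card[OF bij_betw_lhcs_permute, symmetric]) auto
  also have "\<dots> = fact n * card {C \<in> ?L. S \<subseteq> C}" by (simp add: card_permutations)
  also have "(\<Sum>\<tau>\<in>?P. card {C \<in> ?L. (`) \<tau> ` S \<subseteq> C}) = (\<Sum>C\<in>?L. card (perms_into ?A C S))"
    by (rule sum_multicount_gen[OF finP finite_lhcs]) (auto simp: perms_into_def intro!: arg_cong[where f=card])
  finally have eq: "fact n * card {C \<in> ?L. S \<subseteq> C} = (\<Sum>C\<in>?L. card (perms_into ?A C S))" by simp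
  obtain v where v: "loose_cycle k q m n v" "C0 = loose_cycle.edges k q m n v" by (rule lhcs_cycle[OF C0])
  have peel: "peelable S" using loose_cycle.edges_peelable[OF v(1)] S v(2) by auto
  have bound: "real (card (perms_into ?A C S)) * real n ^ (card S * (k - 1)) \<le> ?D ^ card S * fact n" if C: "C \<in> ?L" for C
  proof -
    obtain w where w: "loose_cycle k q m n w" "C = loose_cycle.edges k q m n w" by (rule lhcs_cycle[OF C])
    have "real (card (perms_into ?A C S)) * real (card ?A) ^ (card S * (k - 1)) \<le> ?D ^ card S * fact (card ?A)"
    proof (rule card_perms_into_le[OF _ _ lhcs_finite[OF C] _ _ _ _ _ peel])
      show "card C \<le> card ?A" using lhcs_card[OF C] n q by simp
      show "finite f \<and> card f = k" if "f \<in> C" for f using lhcs_sub[OF C] that by (auto simp: nsets_def)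
      show "card {f \<in> C. y \<in> f} \<le> 2" for y unfolding w(2) by (rule loose_cycle.edges_degree[OF w(1)])
      show "finite S" using S lhcs_finite[OF C0] finite_subset by blast
      show "e \<subseteq> ?A \<and> card e = k" if "e \<in> S" for e using S lhcs_sub[OF C0] that by (auto simp: nsets_def)
    qed (use n_pos k in auto)
    then show ?thesis by simp
  qed
  have "real (card {C \<in> ?L. S \<subseteq> C}) * real n ^ (card S * (k - 1)) * fact n =
      real (fact n * card {C \<in> ?L. S \<subseteq> C}) * real n ^ (card S * (k - 1))" by simp
  also have "\<dots> = (\<Sum>C\<in>?L. real (card (perms_into ?A C S)) * real n ^ (card S * (k - 1)))"
    unfolding eq by (simp add: sum_distrib_right)
  also have "\<dots> \<le> (\<Sum>C\<in>?L. ?D ^ card S * fact n)" by (rule sum_mono[OF bound])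
  also have "\<dots> = real (card ?L) * ?D ^ card S * fact n" by simp
  finally show ?thesis by (rule mult_right_le_imp_le) simp
qed

text \<open>Only the full cycle is new. Dropping one edge from it costs \<open>n ^ (k - 1)\<close>,
  at most \<open>2 ^ (n * (k - 1))\<close>; since \<open>n = m * (k - 1)\<close> and
  \<open>card S = m\<close>, this is the \<open>m\<close>-th power of
  \<open>2 ^ ((k - 1)\<^sup>2)\<close>, whence the extra constant.\<close>

lemma card_lhcs_superset:
  assumes C0: "C0 \<in> lhcs k n" and S: "S \<subseteq> C0"
  shows "real (card {C \<in> lhcs k n. S \<subseteq> C})
    \<le> real (card (lhcs k n)) * ((2 * real k ^ k * exp (real k)) * 2 ^ ((k - 1)\<^sup>2) / real n ^ (k - 1)) ^ card S"
proof -
  let ?L = "lhcs k n" and ?D = "2 * real k ^ k * exp (real k)" and ?B = "(2::real) ^ ((k - 1)\<^sup>2)"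
  have D1: "1 \<le> ?D"
  proof -
    have "1 \<le> real k ^ k" using k by (intro one_le_power) auto
    moreover have "1 \<le> exp (real k)" by simp
    ultimately have "1 * 1 \<le> (2 * real k ^ k) * exp (real k)" by (intro mult_mono) auto
    then show ?thesis by simp
  qed
  have B1: "1 \<le> ?B" by simp
  have npos: "0 < real n" using n_pos by simp
  have "real (card {C \<in> ?L. S \<subseteq> C}) * real n ^ (card S * (k - 1)) \<le> real (card ?L) * (?D * ?B) ^ card S"
  proof (cases "S = C0")
    case False
    then have "real (card {C \<in> ?L. S \<subseteq> C}) * real n ^ (card S * (k - 1)) \<le> real (card ?L) * ?D ^ card S"
      using card_lhcs_superset_proper[OF C0, of S] S by blast
    also have "\<dots> \<le> real (card ?L) * (?D * ?B) ^ card S"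
      using D1 mult_left_mono[OF B1, of ?D] by (intro mult_left_mono power_mono) linarith+
    finally show ?thesis .
  next
    case True
    have cS: "card S = m" using lhcs_card[OF C0] True by simp
    then have "S \<noteq> {}" using m by auto
    then obtain e where e: "e \<in> S" by auto
    define T where "T = S - {e}"
    have cT: "m = Suc (card T)" unfolding T_def cS[symmetric]
      by (rule card.remove[OF _ e]) (use lhcs_finite[OF C0] True in simp)
    have "real (card {C \<in> ?L. S \<subseteq> C}) \<le> real (card {C \<in> ?L. T \<subseteq> C})"
      using finite_lhcs by (intro of_nat_mono card_mono) (auto simp: T_def)
    then have "real (card {C \<in> ?L. S \<subseteq> C}) * real n ^ (card S * (k - 1))
        \<le> real (card {C \<in> ?L. T \<subseteq> C}) * real n ^ (card S * (k - 1))" by (intro mult_right_mono) auto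
    also have "\<dots> = (real (card {C \<in> ?L. T \<subseteq> C}) * real n ^ (card T * (k - 1))) * real n ^ (k - 1)"
      unfolding cS cT mult_Suc power_add by (simp only: mult_ac)
    also have "\<dots> \<le> (real (card ?L) * ?D ^ card T) * real n ^ (k - 1)"
      using card_lhcs_superset_proper[OF C0, of T] e True by (intro mult_right_mono) (auto simp: T_def)
    also have "\<dots> \<le> (real (card ?L) * ?D ^ m) * ?B ^ m"
    proof (intro mult_mono mult_left_mono)
      show "?D ^ card T \<le> ?D ^ m" using D1 cT by (intro power_increasing) auto
      have "real n ^ (k - 1) \<le> (2 ^ n) ^ (k - 1)" by (intro power_mono) (auto simp: less_imp_le of_nat_less_two_power)
      also have "\<dots> = ?B ^ m" unfolding n k by (simp add: power_mult[symmetric] power2_eq_square mult_ac)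
      finally show "real n ^ (k - 1) \<le> ?B ^ m" .
    qed auto
    finally show ?thesis by (simp add: cS power_mult_distrib mult_ac)
  qed
  then show ?thesis
    using npos by (simp add: power_divide power_mult[symmetric] field_simps)
qed

text \<open>Permutations act transitively on the \<open>k\<close>-sets, so all degrees agree, and
  counting incidences gives their common value.\<close>

lemma lhcs_degree:
  assumes e: "e \<in> nsets {1..n} k"
  shows "card {C \<in> lhcs k n. e \<in> C} * (n choose k) = card (lhcs k n) * m"
proof -
  let ?N = "nsets {1..n} k" and ?L = "lhcs k n"
  have reg: "card {C \<in> ?L. f \<in> C} = card {C \<in> ?L. e \<in> C}" if f: "f \<in> ?N" for f
  proof -
    obtain \<sigma> where s: "\<sigma> permutes {1..n}" "\<sigma> ` e = f"
      using ex_permutes_image[of "{1..n}" e f] e f by (auto simp: nsets_def)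
    show ?thesis using bij_betw_same_card[OF bij_betw_lhcs_permute[OF s(1), of k "{e}"]] s(2) by simp
  qed
  have "(\<Sum>f\<in>?N. card {C \<in> ?L. f \<in> C}) = (\<Sum>C\<in>?L. m)"
  proof (rule sum_multicount_gen[OF _ finite_lhcs], simp add: finite_imp_finite_nsets, rule ballI)
    fix C assume C: "C \<in> ?L"
    have "{f \<in> ?N. f \<in> C} = C" using lhcs_sub[OF C] by auto
    then show "card {f \<in> ?N. f \<in> C} = m" using lhcs_card[OF C] by simp
  qed
  then show ?thesis using reg by (simp add: card_nsets mult.commute)
qed

end

section \<open>Polynomials in independent Bernoulli variables\<close>

definition bern_mgf :: "real \<Rightarrow> real \<Rightarrow> real" where
  "bern_mgf p t = p * exp (t * (1 - p)) + (1 - p) * exp (- (t * p))"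

lemma bern_mgf_pos: "0 < p \<Longrightarrow> p < 1 \<Longrightarrow> 0 < bern_mgf p t"
  unfolding bern_mgf_def by (intro add_pos_pos mult_pos_pos) auto

lemma ln_bern_mgf_limit:
  assumes "0 < p" "p < 1"
  shows "((\<lambda>t. ln (bern_mgf p t) / t\<^sup>2) \<longlongrightarrow> p * (1 - p) / 2) (at_right 0)"
proof -
  have "((\<lambda>t. ln (bern_mgf p t) / t\<^sup>2) \<longlongrightarrow> p * ((1 - p) * (1 - p)) / 2 + (1 - p) * (p * p) / 2) (at_right 0)"
    unfolding bern_mgf_def using assms by real_asymp
  also have "p * ((1 - p) * (1 - p)) / 2 + (1 - p) * (p * p) / 2 = p * (1 - p) / 2"
    by (simp add: field_simps)
  finally show ?thesis .
qed

lemma bern_mgf_bounds_right: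
  assumes p: "0 < p" "p < 1" and \<delta>: "0 < \<delta>"
  shows "\<exists>\<tau>>0. \<forall>t. 0 < t \<longrightarrow> t \<le> \<tau> \<longrightarrow> exp ((1 - \<delta>) * (p * (1 - p)) * t\<^sup>2 / 2) \<le> bern_mgf p t \<and>
      bern_mgf p t \<le> exp ((1 + \<delta>) * (p * (1 - p)) * t\<^sup>2 / 2)"
proof -
  define c where "c = p * (1 - p) / 2"
  have c: "0 < c" using p by (simp add: c_def)
  note lim = ln_bern_mgf_limit[OF p, folded c_def]
  have "\<forall>\<^sub>F t in at_right 0. (1 - \<delta>) * c < ln (bern_mgf p t) / t\<^sup>2"
    using c \<delta> by (intro order_tendstoD(1)[OF lim]) simp
  moreover have "\<forall>\<^sub>F t in at_right 0. ln (bern_mgf p t) / t\<^sup>2 < (1 + \<delta>) * c"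
    using c \<delta> by (intro order_tendstoD(2)[OF lim]) simp
  ultimately have "\<forall>\<^sub>F t in at_right 0. (1 - \<delta>) * c < ln (bern_mgf p t) / t\<^sup>2 \<and>
      ln (bern_mgf p t) / t\<^sup>2 < (1 + \<delta>) * c" by (rule eventually_conj)
  then obtain b where b: "0 < b" and ab: "\<And>t. 0 < t \<Longrightarrow> t < b \<Longrightarrow> (1 - \<delta>) * c < ln (bern_mgf p t) / t\<^sup>2 \<and>
      ln (bern_mgf p t) / t\<^sup>2 < (1 + \<delta>) * c"
    unfolding eventually_at_right_field by auto
  show ?thesis
  proof (intro exI[of _ "b / 2"] conjI allI impI)
    show "0 < b / 2" using b by simp
    fix t :: real assume t: "0 < t" "t \<le> b / 2"
    then have t2: "0 < t\<^sup>2" "t < b" using b by auto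
    have pos: "0 < bern_mgf p t" by (rule bern_mgf_pos[OF p])
    have "(1 - \<delta>) * (p * (1 - p)) * t\<^sup>2 / 2 < ln (bern_mgf p t)" "ln (bern_mgf p t) < (1 + \<delta>) * (p * (1 - p)) * t\<^sup>2 / 2"
      using ab[OF t(1) t2(2)] t2(1) by (simp_all add: c_def pos_less_divide_eq pos_divide_less_eq mult_ac)
    then show "exp ((1 - \<delta>) * (p * (1 - p)) * t\<^sup>2 / 2) \<le> bern_mgf p t"
       "bern_mgf p t \<le> exp ((1 + \<delta>) * (p * (1 - p)) * t\<^sup>2 / 2)"
      using pos by (metis exp_ln exp_le_cancel_iff less_imp_le)+
  qed
qed

text \<open>Exchanging success and failure turns \<open>t\<close> into \<open>- t\<close> and
  \<open>p\<close> into \<open>1 - p\<close> and keeps the variance, so the one-sided estimate is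
  applied to both parameters.\<close>

lemma bern_mgf_bounds:
  assumes p: "0 < p" "p < 1" and \<delta>: "0 < \<delta>"
  shows "\<exists>\<tau>>0. \<forall>t. \<bar>t\<bar> \<le> \<tau> \<longrightarrow> exp ((1 - \<delta>) * (p * (1 - p)) * t\<^sup>2 / 2) \<le> bern_mgf p t \<and>
      bern_mgf p t \<le> exp ((1 + \<delta>) * (p * (1 - p)) * t\<^sup>2 / 2)"
proof -
  obtain a where a: "0 < a" "\<And>t. 0 < t \<Longrightarrow> t \<le> a \<Longrightarrow> exp ((1 - \<delta>) * (p * (1 - p)) * t\<^sup>2 / 2) \<le> bern_mgf p t \<and>
      bern_mgf p t \<le> exp ((1 + \<delta>) * (p * (1 - p)) * t\<^sup>2 / 2)"
    using bern_mgf_bounds_right[OF assms] by blast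
  obtain b where b: "0 < b" "\<And>t. 0 < t \<Longrightarrow> t \<le> b \<Longrightarrow> exp ((1 - \<delta>) * ((1 - p) * (1 - (1 - p))) * t\<^sup>2 / 2) \<le> bern_mgf (1 - p) t \<and>
      bern_mgf (1 - p) t \<le> exp ((1 + \<delta>) * ((1 - p) * (1 - (1 - p))) * t\<^sup>2 / 2)"
    using bern_mgf_bounds_right[of "1 - p"] p \<delta> by auto
  have sym: "bern_mgf (1 - p) (- t) = bern_mgf p t" for t by (simp add: bern_mgf_def)
  have comm: "(1 - p) * (1 - (1 - p)) = p * (1 - p)" by simp
  show ?thesis
  proof (intro exI[of _ "min a b"] conjI[of "0 < _"] allI impI)
    show "0 < min a b" using a b by simp
    fix t :: real assume t: "\<bar>t\<bar> \<le> min a b"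
    show "exp ((1 - \<delta>) * (p * (1 - p)) * t\<^sup>2 / 2) \<le> bern_mgf p t \<and> bern_mgf p t \<le> exp ((1 + \<delta>) * (p * (1 - p)) * t\<^sup>2 / 2)"
    proof (cases t "0::real" rule: linorder_cases)
      case less
      then show ?thesis using b(2)[of "- t"] t unfolding sym comm by simp
    next
      case equal
      then show ?thesis by (simp add: bern_mgf_def)
    next
      case greater
      then show ?thesis using a(2)[of t] t by simp
    qed
  qed
qed

section \<open>Sums over subsets and almost sure limits\<close>

lemma sum_Pow_power_card:
  fixes x :: "'a :: comm_semiring_1"
  assumes "finite A"
  shows "(\<Sum>S\<in>Pow A. x ^ card S) = (1 + x) ^ card A"
proof -
  have "(1 + x) ^ card A = (\<Prod>a\<in>A. x + 1)" by (simp add: add.commute)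
  also have "\<dots> = (\<Sum>S\<in>Pow A. (\<Prod>a\<in>S. x) * (\<Prod>a\<in>A - S. 1))" by (rule prod_add[OF assms])
  finally show ?thesis by simp
qed

text \<open>Read in both directions later: with \<open>x = (1 - p) / p\<close> it expands a summand
  of \<open>overlap_sum\<close> over common subsets of two cycles, and with a smaller
  \<open>x\<close> it sums the resulting bounds up again.\<close>

lemma sum_Pow_power_card_ge2:
  fixes x :: real
  assumes "finite A"
  shows "(\<Sum>S | S \<subseteq> A \<and> 2 \<le> card S. x ^ card S) = (1 + x) ^ card A - 1 - x * card A"
proof -
  let ?P = "\<lambda>j. {S. S \<subseteq> A \<and> card S = j}"
  have fin: "finite (Pow A)" using assms by simp
  have "Pow A = ?P 0 \<union> ?P 1 \<union> {S. S \<subseteq> A \<and> 2 \<le> card S}" by auto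
  then have "(\<Sum>S\<in>Pow A. x ^ card S) = (\<Sum>S\<in>?P 0 \<union> ?P 1 \<union> {S. S \<subseteq> A \<and> 2 \<le> card S}. x ^ card S)" by simp
  also have "\<dots> = (\<Sum>S\<in>?P 0. x ^ card S) + (\<Sum>S\<in>?P 1. x ^ card S) + (\<Sum>S | S \<subseteq> A \<and> 2 \<le> card S. x ^ card S)"
    by (subst sum.union_disjoint; (subst sum.union_disjoint)?) (auto intro: finite_subset[OF _ fin])
  also have "(\<Sum>S\<in>?P 0. x ^ card S) = 1" using n_subsets[OF assms, of 0] by simp
  also have "(\<Sum>S\<in>?P 1. x ^ card S) = x * card A" using n_subsets[OF assms, of 1] by simp
  finally show ?thesis using sum_Pow_power_card[OF assms, of x] by simp
qed

lemma binomial_remainder_le: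
  fixes w :: real
  assumes "0 \<le> w" "real m * w \<le> 1"
  shows "(1 + w) ^ m - 1 - w * m \<le> (real m * w)\<^sup>2"
proof -
  have "(1 + w) ^ m \<le> exp w ^ m" using assms exp_ge_add_one_self[of w] by (intro power_mono) auto
  also have "\<dots> = exp (real m * w)" by (simp add: exp_of_nat_mult)
  also have "\<dots> \<le> 1 + real m * w + (real m * w)\<^sup>2" using assms by (intro exp_bound) auto
  finally show ?thesis by (simp add: mult.commute)
qed

text \<open>The series of squares has finite expectation, so it converges almost surely and its
  terms tend to 0.\<close>

lemma (in prob_space) AE_tendsto_0_of_summable_second_moment:
  fixes Y :: "nat \<Rightarrow> 'a \<Rightarrow> real"
  assumes [measurable]: "\<And>i. random_variable borel (Y i)"
    and int: "\<And>i. integrable M (\<lambda>\<omega>. (Y i \<omega>)\<^sup>2)"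
    and sm: "summable (\<lambda>i. expectation (\<lambda>\<omega>. (Y i \<omega>)\<^sup>2))"
  shows "AE \<omega> in M. (\<lambda>i. Y i \<omega>) \<longlonglongrightarrow> 0"
proof -
  have "(\<integral>\<^sup>+\<omega>. (\<Sum>i. ennreal ((Y i \<omega>)\<^sup>2)) \<partial>M) = (\<Sum>i. \<integral>\<^sup>+\<omega>. ennreal ((Y i \<omega>)\<^sup>2) \<partial>M)"
    by (rule nn_integral_suminf) simp
  also have "\<dots> = (\<Sum>i. ennreal (expectation (\<lambda>\<omega>. (Y i \<omega>)\<^sup>2)))"
    by (intro suminf_cong nn_integral_eq_integral int) auto
  also have "\<dots> = ennreal (\<Sum>i. expectation (\<lambda>\<omega>. (Y i \<omega>)\<^sup>2))"
    by (intro suminf_ennreal2 sm integral_nonneg) auto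
  finally have "(\<integral>\<^sup>+\<omega>. (\<Sum>i. ennreal ((Y i \<omega>)\<^sup>2)) \<partial>M) \<noteq> \<infinity>" by simp
  then have "AE \<omega> in M. (\<Sum>i. ennreal ((Y i \<omega>)\<^sup>2)) \<noteq> \<infinity>"
    by (intro nn_integral_PInf_AE) auto
  then show ?thesis
  proof eventually_elim
    case (elim \<omega>)
    have "summable (\<lambda>i. (Y i \<omega>)\<^sup>2)" using elim by (intro summable_suminf_not_top) auto
    then have "(\<lambda>i. (Y i \<omega>)\<^sup>2) \<longlonglongrightarrow> 0" by (rule summable_LIMSEQ_zero)
    then have "(\<lambda>i. sqrt ((Y i \<omega>)\<^sup>2)) \<longlonglongrightarrow> sqrt 0" by (intro tendsto_real_sqrt)
    then show ?case by (simp add: tendsto_rabs_zero_iff)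
  qed
qed

text \<open>In the application \<open>x\<close> is the normalised edge count, \<open>c\<close> the
  quotient of the normalisations and \<open>y\<close> the remainder. Once \<open>c n\<close> is
  positive, multiplying by it preserves the comparison of \<open>x n\<close> with a constant, and
  \<open>c n * s + y n\<close> tends to \<open>s\<close>.\<close>

lemma limsup_affine_eq_1:
  fixes x y c :: "nat \<Rightarrow> real"
  assumes up: "\<And>\<rho>. 1 < \<rho> \<Longrightarrow> \<forall>\<^sub>F n in sequentially. x n \<le> \<rho>"
    and lo: "\<And>\<rho>. 0 < \<rho> \<Longrightarrow> \<rho> < 1 \<Longrightarrow> \<exists>\<^sub>F n in sequentially. \<rho> \<le> x n"
    and c: "c \<longlonglongrightarrow> 1" and y: "y \<longlonglongrightarrow> 0"
  shows "limsup (\<lambda>n. ereal (c n * x n + y n)) = 1"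
proof (rule antisym)
  have cpos: "\<forall>\<^sub>F n in sequentially. 0 < c n" using c by (intro order_tendstoD) auto
  show "limsup (\<lambda>n. ereal (c n * x n + y n)) \<le> 1"
    unfolding Limsup_le_iff
  proof (intro allI impI)
    fix z :: ereal assume "1 < z"
    then obtain r where r: "1 < r" "ereal r < z" using ereal_dense2[of 1 z] by auto
    obtain s where s: "1 < s" "s < r" using dense[OF r(1)] by auto
    have "(\<lambda>n. c n * s + y n) \<longlonglongrightarrow> 1 * s + 0" by (intro tendsto_intros c y)
    then have "\<forall>\<^sub>F n in sequentially. c n * s + y n < r" using s by (intro order_tendstoD) auto
    then show "\<forall>\<^sub>F n in sequentially. ereal (c n * x n + y n) < z" using up[OF s(1)] cpos
    proof eventually_elim
      case (elim n)
      have "c n * x n \<le> c n * s" using elim by (intro mult_left_mono) auto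
      then have "c n * x n + y n < r" using elim by linarith
      then show ?case using r(2) by (meson ereal_less_eq(3) less_le_trans less_imp_le le_less_trans)
    qed
  qed
  show "1 \<le> limsup (\<lambda>n. ereal (c n * x n + y n))"
  proof (rule ccontr)
    assume "\<not> ?thesis"
    then have "limsup (\<lambda>n. ereal (c n * x n + y n)) < 1" by simp
    \<comment> \<open>The maximum with 0 makes \<open>r\<close>, and thus \<open>s\<close>,
      positive, as \<open>lo\<close> requires.\<close>
    then have "max 0 (limsup (\<lambda>n. ereal (c n * x n + y n))) < 1" by simp
    then obtain r where r: "max 0 (limsup (\<lambda>n. ereal (c n * x n + y n))) < ereal r" "ereal r < 1"
      using ereal_dense2 by blast
    then have r': "0 < r" "r < 1" "limsup (\<lambda>n. ereal (c n * x n + y n)) < ereal r" by auto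
    then have ev: "\<forall>\<^sub>F n in sequentially. ereal (c n * x n + y n) < ereal r" by (intro Limsup_lessD)
    obtain s where s: "r < s" "s < 1" using dense[OF r'(2)] by auto
    have "(\<lambda>n. c n * s + y n) \<longlonglongrightarrow> 1 * s + 0" by (intro tendsto_intros c y)
    then have "\<forall>\<^sub>F n in sequentially. r < c n * s + y n" using s by (intro order_tendstoD) auto
    then have "\<forall>\<^sub>F n in sequentially. \<not> s \<le> x n" using ev cpos
    proof eventually_elim
      case (elim n)
      show ?case
      proof
        assume "s \<le> x n"
        then have "c n * s \<le> c n * x n" using elim by (intro mult_left_mono) auto
        moreover have "c n * x n + y n < r" using elim by simp
        ultimately show False using elim(1) by linarith
      qed
    qed
    then show False using lo[of s] s r' by (simp add: frequently_def)
  qed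
qed

section \<open>Independent Bernoulli coordinates\<close>

locale bernoulli_process =
  fixes I :: "'i set" and p :: real
  assumes I_nonempty: "I \<noteq> {}" and p: "0 < p" "p < 1"
begin

definition P :: "('i \<Rightarrow> bool) measure" where "P = PiM I (\<lambda>_. measure_pmf (bernoulli_pmf p))"

sublocale product_prob_space "\<lambda>_::'i. measure_pmf (bernoulli_pmf p)" I
  by unfold_locales

sublocale prob_space P
  unfolding P_def by (intro prob_space_PiM measure_pmf.prob_space_axioms)

lemma measurable_coord: "i \<in> I \<Longrightarrow> (\<lambda>\<omega>. \<omega> i) \<in> measurable P (measure_pmf (bernoulli_pmf p))"
  unfolding P_def by (rule measurable_component_singleton)

lemma measurable_coord_fun: "i \<in> I \<Longrightarrow> (\<lambda>\<omega>. f (\<omega> i)) \<in> measurable P borel"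
  by (rule measurable_compose[OF measurable_coord]) simp_all

text \<open>The joint law of the coordinates is the product measure itself, as
  \<open>restrict\<close> acts as the identity on its space.\<close>

lemma indep_coord: "indep_vars (\<lambda>_. measure_pmf (bernoulli_pmf p)) (\<lambda>i \<omega>. \<omega> i) I"
proof (subst indep_vars_iff_distr_eq_PiM'[OF I_nonempty])
  show "random_variable (measure_pmf (bernoulli_pmf p)) (\<lambda>\<omega>. \<omega> i)" if "i \<in> I" for i
    by (rule measurable_coord[OF that])
  have "distr P (PiM I (\<lambda>_. measure_pmf (bernoulli_pmf p))) (\<lambda>\<omega>. restrict \<omega> I) = distr P P (\<lambda>\<omega>. \<omega>)"
    unfolding P_def by (rule distr_cong) (auto simp: space_PiM)
  also have "\<dots> = P" by (rule distr_id)
  also have "P = PiM I (\<lambda>i. distr P (measure_pmf (bernoulli_pmf p)) (\<lambda>\<omega>. \<omega> i))"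
    unfolding P_def by (rule PiM_cong) (auto simp: PiM_component)
  finally show "distr P (PiM I (\<lambda>_. measure_pmf (bernoulli_pmf p))) (\<lambda>\<omega>. \<lambda>i\<in>I. \<omega> i) =
      PiM I (\<lambda>i. distr P (measure_pmf (bernoulli_pmf p)) (\<lambda>\<omega>. \<omega> i))" by simp
qed

lemma indep_coord_fun: "indep_vars (\<lambda>_. borel) (\<lambda>i \<omega>. f i (\<omega> i) :: real) I"
  by (rule indep_vars_compose2[OF indep_coord]) simp

lemma expectation_coord:
  fixes f :: "bool \<Rightarrow> real"
  assumes "i \<in> I"
  shows "expectation (\<lambda>\<omega>. f (\<omega> i)) = p * f True + (1 - p) * f False"
proof -
  have "expectation (\<lambda>\<omega>. f (\<omega> i)) = integral\<^sup>L (distr P (measure_pmf (bernoulli_pmf p)) (\<lambda>\<omega>. \<omega> i)) f"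
    by (subst integral_distr[OF measurable_coord[OF assms]]) auto
  also have "\<dots> = p * f True + (1 - p) * f False"
    unfolding P_def PiM_component[OF assms] using p by simp
  finally show ?thesis .
qed

lemma integrable_coord:
  fixes f :: "bool \<Rightarrow> real"
  assumes "i \<in> I"
  shows "integrable P (\<lambda>\<omega>. f (\<omega> i))"
proof (rule integrable_const_bound[of _ "\<bar>f True\<bar> + \<bar>f False\<bar>"])
  have "norm (f b) \<le> \<bar>f True\<bar> + \<bar>f False\<bar>" for b by (cases b) auto
  then show "AE \<omega> in P. norm (f (\<omega> i)) \<le> \<bar>f True\<bar> + \<bar>f False\<bar>" by simp
qed (rule measurable_coord_fun[OF assms])

lemma
  fixes f :: "'i \<Rightarrow> bool \<Rightarrow> real"
  assumes "finite A" "A \<subseteq> I"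
  shows expectation_prod_coord: "expectation (\<lambda>\<omega>. \<Prod>i\<in>A. f i (\<omega> i)) = (\<Prod>i\<in>A. p * f i True + (1 - p) * f i False)"
    and integrable_prod_coord: "integrable P (\<lambda>\<omega>. \<Prod>i\<in>A. f i (\<omega> i))"
proof -
  have ind: "indep_vars (\<lambda>_. borel) (\<lambda>i \<omega>. f i (\<omega> i)) A"
    by (rule indep_vars_subset[OF indep_coord_fun assms(2)])
  have int: "integrable P (\<lambda>\<omega>. f i (\<omega> i))" if "i \<in> A" for i
    using integrable_coord that assms by blast
  show "integrable P (\<lambda>\<omega>. \<Prod>i\<in>A. f i (\<omega> i))" by (rule indep_vars_integrable[OF assms(1) ind int])
  have "expectation (\<lambda>\<omega>. \<Prod>i\<in>A. f i (\<omega> i)) = (\<Prod>i\<in>A. expectation (\<lambda>\<omega>. f i (\<omega> i)))"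
    by (rule indep_vars_lebesgue_integral[OF assms(1) ind int])
  also have "\<dots> = (\<Prod>i\<in>A. p * f i True + (1 - p) * f i False)"
    using assms by (intro prod.cong refl expectation_coord) auto
  finally show "expectation (\<lambda>\<omega>. \<Prod>i\<in>A. f i (\<omega> i)) = (\<Prod>i\<in>A. p * f i True + (1 - p) * f i False)" .
qed

definition centred_sum :: "'i set \<Rightarrow> ('i \<Rightarrow> bool) \<Rightarrow> real" where
  "centred_sum A \<omega> = (\<Sum>i\<in>A. of_bool (\<omega> i) - p)"

lemma
  assumes "finite A" "A \<subseteq> I"
  shows mgf_centred_sum: "expectation (\<lambda>\<omega>. exp (t * centred_sum A \<omega>)) = bern_mgf p t ^ card A"
    and integrable_exp_centred_sum: "integrable P (\<lambda>\<omega>. exp (t * centred_sum A \<omega>))"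
proof -
  have eq: "exp (t * centred_sum A \<omega>) = (\<Prod>i\<in>A. (\<lambda>b. exp (t * (of_bool b - p))) (\<omega> i))" for \<omega>
    unfolding centred_sum_def sum_distrib_left using assms(1) by (rule exp_sum)
  show "expectation (\<lambda>\<omega>. exp (t * centred_sum A \<omega>)) = bern_mgf p t ^ card A"
    unfolding eq using expectation_prod_coord[OF assms, of "\<lambda>_ b. exp (t * (of_bool b - p))"]
    by (simp add: bern_mgf_def)
  show "integrable P (\<lambda>\<omega>. exp (t * centred_sum A \<omega>))"
    unfolding eq using integrable_prod_coord[OF assms, of "\<lambda>_ b. exp (t * (of_bool b - p))"] by simp
qed

end

lemma (in prob_space)
  fixes f :: "'i \<Rightarrow> 'a \<Rightarrow> real" and g :: "'j \<Rightarrow> 'a \<Rightarrow> real"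
  assumes "\<And>i j. i \<in> A \<Longrightarrow> j \<in> B \<Longrightarrow> integrable M (\<lambda>\<omega>. f i \<omega> * g j \<omega>)"
  shows expectation_sum_product: "expectation (\<lambda>\<omega>. (\<Sum>i\<in>A. f i \<omega>) * (\<Sum>j\<in>B. g j \<omega>)) = (\<Sum>i\<in>A. \<Sum>j\<in>B. expectation (\<lambda>\<omega>. f i \<omega> * g j \<omega>))"
    and integrable_sum_product: "integrable M (\<lambda>\<omega>. (\<Sum>i\<in>A. f i \<omega>) * (\<Sum>j\<in>B. g j \<omega>))"
  using assms by (simp_all add: sum_product Bochner_Integration.integral_sum)

section \<open>Second moments of sums of monomials\<close>

context bernoulli_process
begin

definition monomial :: "'i set \<Rightarrow> ('i \<Rightarrow> bool) \<Rightarrow> real" where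
  "monomial C \<omega> = of_bool (\<forall>i\<in>C. \<omega> i)"

lemma monomial_prod: "finite C \<Longrightarrow> monomial C \<omega> = (\<Prod>i\<in>C. of_bool (\<omega> i))"
  unfolding monomial_def by (induction C rule: finite_induct) auto

lemma monomial_mult: "monomial C \<omega> * monomial D \<omega> = monomial (C \<union> D) \<omega>"
  by (auto simp: monomial_def)

lemma
  assumes "finite C" "C \<subseteq> I"
  shows expectation_monomial: "expectation (monomial C) = p ^ card C"
    and integrable_monomial: "integrable P (monomial C)"
  using expectation_prod_coord[OF assms, of "\<lambda>_. of_bool"] integrable_prod_coord[OF assms, of "\<lambda>_. of_bool"]
  by (simp_all add: monomial_prod[OF assms(1), abs_def])

lemma
  assumes C: "finite C" "C \<subseteq> I" and D: "finite D" "D \<subseteq> I"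
  shows expectation_monomial_cov: "expectation (\<lambda>\<omega>. (monomial C \<omega> - p ^ card C) * (monomial D \<omega> - p ^ card D)) =
      p ^ card (C \<union> D) - p ^ card C * p ^ card D" (is ?E)
    and integrable_monomial_cov: "integrable P (\<lambda>\<omega>. (monomial C \<omega> - p ^ card C) * (monomial D \<omega> - p ^ card D))" (is ?I)
proof -
  have CD: "finite (C \<union> D)" "C \<union> D \<subseteq> I" using C D by auto
  have eq: "(monomial C \<omega> - p ^ card C) * (monomial D \<omega> - p ^ card D) =
      monomial (C \<union> D) \<omega> - p ^ card D * monomial C \<omega> - p ^ card C * monomial D \<omega> + p ^ card C * p ^ card D" for \<omega>
    unfolding monomial_mult[symmetric] by (simp add: algebra_simps)
  note ints = integrable_monomial[OF C] integrable_monomial[OF D] integrable_monomial[OF CD]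
  show ?I unfolding eq using ints by simp
  show ?E unfolding eq using ints
    by (simp add: expectation_monomial[OF C] expectation_monomial[OF D] expectation_monomial[OF CD] prob_space)
qed

text \<open>Seen as a sum of singleton monomials, the linear part has the same shape as
  \<open>dev\<close>, so one covariance formula provides all three second moments.\<close>

lemma centred_sum_monomial: "centred_sum A \<omega> = (\<Sum>e\<in>A. monomial {e} \<omega> - p ^ card {e})"
  by (simp add: centred_sum_def monomial_def)

end

text \<open>
  The last assumption says that all elements of \<open>E\<close> have the same degree in \<open>L\<close>, stated without division.
\<close>

locale uniform_family = bernoulli_process I p for I :: "'i set" and p :: real +
  fixes L :: "'i set set" and E :: "'i set" and m :: nat
  assumes finite_L: "finite L" and finite_E: "finite E" and E_sub: "E \<subseteq> I" and E_ne: "E \<noteq> {}"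
    and L_sub: "C \<in> L \<Longrightarrow> C \<subseteq> E" and L_card: "C \<in> L \<Longrightarrow> card C = m"
    and degree: "e \<in> E \<Longrightarrow> card {C\<in>L. e \<in> C} * card E = card L * m"
begin

definition dev :: "('i \<Rightarrow> bool) \<Rightarrow> real" where
  "dev \<omega> = (\<Sum>C\<in>L. monomial C \<omega>) - card L * p ^ m"

text \<open>The regression coefficient of \<open>dev\<close> on \<open>centred_sum E\<close>: the
  covariance \<open>card L * m * (p ^ m * (1 - p))\<close> divided by the variance
  \<open>card E * (p * (1 - p))\<close>.\<close>

definition slope :: real where
  "slope = p ^ m / p * (card L * m / card E)"

definition rest :: "('i \<Rightarrow> bool) \<Rightarrow> real" where
  "rest \<omega> = dev \<omega> - slope * centred_sum E \<omega>"

definition overlap_sum :: real where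
  "overlap_sum = (\<Sum>C\<in>L. \<Sum>D\<in>L. (1 / p) ^ card (C \<inter> D) - 1 - (1 - p) / p * card (C \<inter> D))"

lemma L_finite: "C \<in> L \<Longrightarrow> finite C"
  using L_sub finite_E finite_subset by blast

lemma L_I: "C \<in> L \<Longrightarrow> C \<subseteq> I"
  using L_sub E_sub by blast

lemma N_pos: "0 < card E"
  using finite_E E_ne by (simp add: card_gt_0_iff)

lemma dev_sum: "dev \<omega> = (\<Sum>C\<in>L. monomial C \<omega> - p ^ card C)"
  by (simp add: dev_def sum_subtractf L_card)

lemma
  shows expectation_dev_square: "expectation (\<lambda>\<omega>. dev \<omega> * dev \<omega>) = (p ^ m)\<^sup>2 * (\<Sum>C\<in>L. \<Sum>D\<in>L. (1 / p) ^ card (C \<inter> D) - 1)"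
    and integrable_dev_square: "integrable P (\<lambda>\<omega>. dev \<omega> * dev \<omega>)"
proof -
  have int: "integrable P (\<lambda>\<omega>. (monomial C \<omega> - p ^ card C) * (monomial D \<omega> - p ^ card D))" if "C \<in> L" "D \<in> L" for C D
    using that by (intro integrable_monomial_cov L_finite L_I)
  show "integrable P (\<lambda>\<omega>. dev \<omega> * dev \<omega>)" unfolding dev_sum by (rule integrable_sum_product[OF int])
  have cov: "p ^ card (C \<union> D) - p ^ card C * p ^ card D = (p ^ m)\<^sup>2 * ((1 / p) ^ card (C \<inter> D) - 1)" if "C \<in> L" "D \<in> L" for C D
  proof -
    have "card (C \<union> D) + card (C \<inter> D) = m + m"
      using card_Un_Int[OF L_finite[OF that(1)] L_finite[OF that(2)]] L_card that by simp
    then have "p ^ card (C \<union> D) * p ^ card (C \<inter> D) = p ^ m * p ^ m" by (simp add: power_add[symmetric])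
    then show ?thesis using p by (simp add: L_card that power_divide power2_eq_square field_simps)
  qed
  have "expectation (\<lambda>\<omega>. dev \<omega> * dev \<omega>) = (\<Sum>C\<in>L. \<Sum>D\<in>L. p ^ card (C \<union> D) - p ^ card C * p ^ card D)"
    unfolding dev_sum
    by (subst expectation_sum_product, erule (1) int)
      (intro sum.cong refl expectation_monomial_cov L_finite L_I)
  also have "\<dots> = (\<Sum>C\<in>L. \<Sum>D\<in>L. (p ^ m)\<^sup>2 * ((1 / p) ^ card (C \<inter> D) - 1))"
    by (intro sum.cong refl cov)
  finally show "expectation (\<lambda>\<omega>. dev \<omega> * dev \<omega>) = (p ^ m)\<^sup>2 * (\<Sum>C\<in>L. \<Sum>D\<in>L. (1 / p) ^ card (C \<inter> D) - 1)"
    by (simp only: sum_distrib_left)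
qed

lemma
  shows expectation_dev_centred: "expectation (\<lambda>\<omega>. dev \<omega> * centred_sum E \<omega>) = card L * m * (p ^ m * (1 - p))"
    and integrable_dev_centred: "integrable P (\<lambda>\<omega>. dev \<omega> * centred_sum E \<omega>)"
proof -
  have int: "integrable P (\<lambda>\<omega>. (monomial C \<omega> - p ^ card C) * (monomial {e} \<omega> - p ^ card {e}))" if "C \<in> L" "e \<in> E" for C e
    using that E_sub by (intro integrable_monomial_cov[OF L_finite[OF that(1)] L_I[OF that(1)]]) auto
  show "integrable P (\<lambda>\<omega>. dev \<omega> * centred_sum E \<omega>)"
    unfolding dev_sum centred_sum_monomial by (rule integrable_sum_product[OF int])
  have "expectation (\<lambda>\<omega>. dev \<omega> * centred_sum E \<omega>) = (\<Sum>C\<in>L. \<Sum>e\<in>E. p ^ card (C \<union> {e}) - p ^ card C * p ^ card {e})"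
    unfolding dev_sum centred_sum_monomial
    by (subst expectation_sum_product, erule (1) int, intro sum.cong refl expectation_monomial_cov)
      (use E_sub L_finite L_I in auto)
  also have "\<dots> = (\<Sum>C\<in>L. \<Sum>e\<in>E. if e \<in> C then p ^ m * (1 - p) else 0)"
  proof (intro sum.cong refl)
    fix C e assume C: "C \<in> L" and e: "e \<in> E"
    show "p ^ card (C \<union> {e}) - p ^ card C * p ^ card {e} = (if e \<in> C then p ^ m * (1 - p) else 0)"
      using L_finite[OF C] L_card[OF C] by (simp add: insert_absorb algebra_simps)
  qed
  also have "\<dots> = (\<Sum>C\<in>L. m * (p ^ m * (1 - p)))"
  proof (intro sum.cong refl)
    fix C assume C: "C \<in> L"
    have "E \<inter> C = C" using L_sub[OF C] by auto
    then show "(\<Sum>e\<in>E. if e \<in> C then p ^ m * (1 - p) else 0) = m * (p ^ m * (1 - p))"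
      using finite_E by (simp add: sum.inter_restrict[symmetric] L_card[OF C])
  qed
  finally show "expectation (\<lambda>\<omega>. dev \<omega> * centred_sum E \<omega>) = card L * m * (p ^ m * (1 - p))" by simp
qed

lemma
  shows expectation_centred_square: "expectation (\<lambda>\<omega>. centred_sum E \<omega> * centred_sum E \<omega>) = card E * (p * (1 - p))"
    and integrable_centred_square: "integrable P (\<lambda>\<omega>. centred_sum E \<omega> * centred_sum E \<omega>)"
proof -
  have int: "integrable P (\<lambda>\<omega>. (monomial {e} \<omega> - p ^ card {e}) * (monomial {f} \<omega> - p ^ card {f}))" if "e \<in> E" "f \<in> E" for e f
    using that E_sub by (intro integrable_monomial_cov) auto
  show "integrable P (\<lambda>\<omega>. centred_sum E \<omega> * centred_sum E \<omega>)"
    unfolding centred_sum_monomial by (rule integrable_sum_product[OF int])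
  have "expectation (\<lambda>\<omega>. centred_sum E \<omega> * centred_sum E \<omega>) = (\<Sum>e\<in>E. \<Sum>f\<in>E. p ^ card ({e} \<union> {f}) - p ^ card {e} * p ^ card {f})"
    unfolding centred_sum_monomial
    by (subst expectation_sum_product, erule (1) int, intro sum.cong refl expectation_monomial_cov)
      (use E_sub in auto)
  also have "\<dots> = (\<Sum>e\<in>E. \<Sum>f\<in>E. if f = e then p * (1 - p) else 0)"
    by (intro sum.cong refl) (auto simp: algebra_simps power2_eq_square)
  also have "\<dots> = card E * (p * (1 - p))" using finite_E by simp
  finally show "expectation (\<lambda>\<omega>. centred_sum E \<omega> * centred_sum E \<omega>) = card E * (p * (1 - p))" .
qed

text \<open>Counted by edges, the sum is that of the squared degrees, and all degrees are equal.
  This is where regularity makes the linear terms of the variance coincide with the variance of the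
  projection.\<close>

lemma sum_overlap: "(\<Sum>C\<in>L. \<Sum>D\<in>L. real (card (C \<inter> D))) = (card L * m)\<^sup>2 / card E"
proof -
  have deg: "real (card {C\<in>L. e \<in> C}) = card L * m / card E" if "e \<in> E" for e
    using degree[OF that] N_pos by (simp add: field_simps flip: of_nat_mult)
  have cap: "real (card (C \<inter> D)) = (\<Sum>e\<in>E. of_bool (e \<in> C) * of_bool (e \<in> D))" if "C \<in> L" "D \<in> L" for C D
  proof -
    have "C \<inter> D = E \<inter> {e. e \<in> C \<and> e \<in> D}" using L_sub that by auto
    then show ?thesis using finite_E by (simp flip: of_bool_conj)
  qed
  have "(\<Sum>C\<in>L. \<Sum>D\<in>L. real (card (C \<inter> D))) = (\<Sum>C\<in>L. \<Sum>D\<in>L. \<Sum>e\<in>E. of_bool (e \<in> C) * of_bool (e \<in> D))"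
    by (intro sum.cong refl cap)
  also have "\<dots> = (\<Sum>C\<in>L. \<Sum>e\<in>E. \<Sum>D\<in>L. of_bool (e \<in> C) * of_bool (e \<in> D))"
    by (intro sum.cong refl sum.swap)
  also have "\<dots> = (\<Sum>e\<in>E. \<Sum>C\<in>L. \<Sum>D\<in>L. of_bool (e \<in> C) * of_bool (e \<in> D))"
    by (rule sum.swap)
  also have "\<dots> = (\<Sum>e\<in>E. real (card {C\<in>L. e \<in> C}) * real (card {C\<in>L. e \<in> C}))"
  proof (intro sum.cong refl)
    fix e
    have "real (card {C\<in>L. e \<in> C}) = (\<Sum>C\<in>L. of_bool (e \<in> C))"
      using finite_L by (simp add: Collect_conj_eq)
    then show "(\<Sum>C\<in>L. \<Sum>D\<in>L. of_bool (e \<in> C) * of_bool (e \<in> D)) =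
        real (card {C\<in>L. e \<in> C}) * real (card {C\<in>L. e \<in> C})"
      by (simp only: sum_product)
  qed
  also have "\<dots> = (\<Sum>e\<in>E. (card L * m / card E) * (card L * m / card E))"
    by (intro sum.cong refl) (simp add: deg)
  also have "\<dots> = (card L * m)\<^sup>2 / card E" using N_pos by (simp add: power2_eq_square)
  finally show ?thesis .
qed

text \<open>Pythagoras: by the choice of \<open>slope\<close>, \<open>rest\<close> is orthogonal to
  \<open>centred_sum E\<close> (fact \<open>1\<close>), and by \<open>sum_overlap\<close> the second
  moment of the linear part is what \<open>overlap_sum\<close> subtracts (fact
  \<open>2\<close>).\<close>

lemma integrable_rest_square: "integrable P (\<lambda>\<omega>. (rest \<omega>)\<^sup>2)"
  and expectation_rest_square: "expectation (\<lambda>\<omega>. (rest \<omega>)\<^sup>2) = (p ^ m)\<^sup>2 * overlap_sum"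
  and expectation_dev_square_split:
    "expectation (\<lambda>\<omega>. (dev \<omega>)\<^sup>2) = slope\<^sup>2 * (card E * (p * (1 - p))) + (p ^ m)\<^sup>2 * overlap_sum"
proof -
  note ints = integrable_dev_square integrable_dev_centred integrable_centred_square
  have eq: "(rest \<omega>)\<^sup>2 = dev \<omega> * dev \<omega> - 2 * slope * (dev \<omega> * centred_sum E \<omega>) +
      slope\<^sup>2 * (centred_sum E \<omega> * centred_sum E \<omega>)" for \<omega>
    by (simp add: rest_def power2_eq_square algebra_simps)
  show "integrable P (\<lambda>\<omega>. (rest \<omega>)\<^sup>2)" unfolding eq using ints by simp
  have 1: "slope * (card L * m * (p ^ m * (1 - p))) = slope\<^sup>2 * (card E * (p * (1 - p)))"
    using N_pos p by (simp add: slope_def power2_eq_square field_simps)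
  have 2: "slope\<^sup>2 * (card E * (p * (1 - p))) = (p ^ m)\<^sup>2 * ((1 - p) / p * ((card L * m)\<^sup>2 / card E))"
    using N_pos p by (simp add: slope_def power2_eq_square field_simps)
  have ov: "overlap_sum = (\<Sum>C\<in>L. \<Sum>D\<in>L. (1 / p) ^ card (C \<inter> D) - 1)
      - (1 - p) / p * (\<Sum>C\<in>L. \<Sum>D\<in>L. real (card (C \<inter> D)))"
    unfolding overlap_sum_def sum_distrib_left by (simp only: sum_subtractf)
  have 3: "expectation (\<lambda>\<omega>. dev \<omega> * dev \<omega>) = slope\<^sup>2 * (card E * (p * (1 - p))) + (p ^ m)\<^sup>2 * overlap_sum"
    unfolding expectation_dev_square 2 ov sum_overlap by (simp add: algebra_simps)
  then show "expectation (\<lambda>\<omega>. (dev \<omega>)\<^sup>2) = slope\<^sup>2 * (card E * (p * (1 - p))) + (p ^ m)\<^sup>2 * overlap_sum"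
    by (simp add: power2_eq_square)
  have "expectation (\<lambda>\<omega>. (rest \<omega>)\<^sup>2) = expectation (\<lambda>\<omega>. dev \<omega> * dev \<omega>)
      - 2 * slope * expectation (\<lambda>\<omega>. dev \<omega> * centred_sum E \<omega>)
      + slope\<^sup>2 * expectation (\<lambda>\<omega>. centred_sum E \<omega> * centred_sum E \<omega>)"
    unfolding eq using ints by simp
  also have "\<dots> = (p ^ m)\<^sup>2 * overlap_sum"
    unfolding 3 expectation_dev_centred expectation_centred_square using 1 by linarith
  finally show "expectation (\<lambda>\<omega>. (rest \<omega>)\<^sup>2) = (p ^ m)\<^sup>2 * overlap_sum" .
qed

text \<open>For fixed \<open>C\<close>, each summand is expanded over the subsets \<open>S\<close>
  of \<open>C \<inter> D\<close> with at least two elements, those of size 0 and 1 having cancelled.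
  Exchanging sums leaves the number of \<open>D\<close> containing \<open>S\<close>, bounded by
  \<open>sup\<close>, and summing over \<open>S\<close> gives a binomial remainder, quadratic in
  \<open>m * b\<close>.\<close>

lemma overlap_sum_le:
  fixes b :: real
  assumes b: "0 \<le> b" and small: "m * ((1 - p) / p * b) \<le> 1"
    and sup: "\<And>C S. C \<in> L \<Longrightarrow> S \<subseteq> C \<Longrightarrow> real (card {D\<in>L. S \<subseteq> D}) \<le> card L * b ^ card S"
  shows "overlap_sum \<le> (real (card L))\<^sup>2 * (m * ((1 - p) / p * b))\<^sup>2"
proof -
  let ?l = "(1 - p) / p"
  have l: "0 \<le> ?l" and l1: "1 + ?l = 1 / p" using p by (simp_all add: field_simps)
  have "(\<Sum>D\<in>L. (1 / p) ^ card (C \<inter> D) - 1 - ?l * card (C \<inter> D)) \<le> card L * (m * (?l * b))\<^sup>2" if C: "C \<in> L" for C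
  proof -
    let ?Q = "{S. S \<subseteq> C \<and> 2 \<le> card S}"
    have finQ: "finite ?Q" by (rule finite_subset[of _ "Pow C"]) (use L_finite[OF C] in auto)
    have "(\<Sum>D\<in>L. (1 / p) ^ card (C \<inter> D) - 1 - ?l * card (C \<inter> D)) = (\<Sum>D\<in>L. \<Sum>S | S \<subseteq> C \<inter> D \<and> 2 \<le> card S. ?l ^ card S)"
      by (intro sum.cong refl) (simp only: l1 sum_Pow_power_card_ge2[OF finite_subset[OF Int_lower1 L_finite[OF C]]])
    also have "\<dots> = (\<Sum>D\<in>L. \<Sum>S\<in>?Q. of_bool (S \<subseteq> D) * ?l ^ card S)"
    proof (rule sum.cong[OF refl])
      fix D
      have "{S. S \<subseteq> C \<inter> D \<and> 2 \<le> card S} = ?Q \<inter> {S. S \<subseteq> D}" by auto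
      then show "(\<Sum>S | S \<subseteq> C \<inter> D \<and> 2 \<le> card S. ?l ^ card S) = (\<Sum>S\<in>?Q. of_bool (S \<subseteq> D) * ?l ^ card S)"
        using finQ by (simp add: sum.inter_restrict of_bool_def if_distrib[of "\<lambda>x. x * _"] cong: if_cong)
    qed
    also have "\<dots> = (\<Sum>S\<in>?Q. \<Sum>D\<in>L. of_bool (S \<subseteq> D) * ?l ^ card S)" by (rule sum.swap)
    also have "\<dots> = (\<Sum>S\<in>?Q. card {D\<in>L. S \<subseteq> D} * ?l ^ card S)"
      using finite_L by (intro sum.cong refl) (simp add: sum_distrib_right[symmetric] Collect_conj_eq)
    also have "\<dots> \<le> (\<Sum>S\<in>?Q. (card L * b ^ card S) * ?l ^ card S)"
      using l sup[OF C] by (intro sum_mono mult_right_mono) auto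
    also have "\<dots> = card L * (\<Sum>S\<in>?Q. (?l * b) ^ card S)"
      unfolding sum_distrib_left power_mult_distrib by (simp only: mult_ac)
    also have "(\<Sum>S\<in>?Q. (?l * b) ^ card S) = (1 + ?l * b) ^ m - 1 - ?l * b * m"
      using sum_Pow_power_card_ge2[OF L_finite[OF C], of "?l * b"] L_card[OF C] by simp
    also have "card L * \<dots> \<le> card L * (m * (?l * b))\<^sup>2"
      using small by (intro mult_left_mono binomial_remainder_le mult_nonneg_nonneg[OF l b]) auto
    finally show ?thesis .
  qed
  then have "overlap_sum \<le> (\<Sum>C\<in>L. card L * (m * (?l * b))\<^sup>2)" unfolding overlap_sum_def by (rule sum_mono)
  also have "\<dots> = (real (card L))\<^sup>2 * (m * (?l * b))\<^sup>2" by (simp add: power2_eq_square)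
  finally show ?thesis .
qed

end

section \<open>The iterated logarithm for counts over growing index sets\<close>

locale growing_bernoulli = bernoulli_process I p for I :: "'i set" and p :: real +
  fixes A :: "nat \<Rightarrow> 'i set"
  assumes A_fin: "finite (A n)" and A_sub: "A n \<subseteq> I" and A_mono: "A n \<subseteq> A (Suc n)" and A_0: "A 0 = {}"
begin

definition incr :: "nat \<Rightarrow> ('i \<Rightarrow> bool) \<Rightarrow> real" where
  "incr i = centred_sum (A (Suc i) - A i)"

definition incr_var :: "nat \<Rightarrow> real" where
  "incr_var i = p * (1 - p) * card (A (Suc i) - A i)"

lemma A_mono': "i \<le> j \<Longrightarrow> A i \<subseteq> A j"
  using lift_Suc_mono_le[of A, OF A_mono] by blast

text \<open>The increments may grow without bound, yet the \<open>\<tau>\<close> of a single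
  coordinate serves them all: both sides of its estimate are raised to the power
  \<open>card (A (Suc i) - A i)\<close>.\<close>

sublocale lil: lil_sequence P incr incr_var
proof
  have disj: "disjoint_family_on (\<lambda>i. A (Suc i) - A i) UNIV"
    unfolding disjoint_family_on_def
  proof (intro ballI impI)
    have *: "(A (Suc i) - A i) \<inter> (A (Suc j) - A j) = {}" if "i < j" for i j
      using A_mono'[of "Suc i" j] that by auto
    show "(A (Suc i) - A i) \<inter> (A (Suc j) - A j) = {}" if "i \<noteq> j" for i j
      using *[of i j] *[of j i] that by (cases i j rule: linorder_cases) auto
  qed
  have "indep_vars (\<lambda>_. borel) (\<lambda>i \<omega>. (\<lambda>f. \<Sum>e\<in>A (Suc i) - A i. f e) (restrict (\<lambda>e. of_bool (\<omega> e) - p) (A (Suc i) - A i))) UNIV"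
    by (rule indep_vars_compose2[OF indep_vars_restrict[OF indep_coord_fun[of "\<lambda>_ b. of_bool b - p"] _ disj]])
      (use A_sub in \<open>auto intro!: borel_measurable_sum measurable_component_singleton\<close>)
  moreover have "(\<Sum>e\<in>A (Suc i) - A i. restrict (\<lambda>e. of_bool (\<omega> e) - p) (A (Suc i) - A i) e) = incr i \<omega>" for i \<omega>
    by (auto simp: incr_def centred_sum_def intro!: sum.cong)
  ultimately show "indep_vars (\<lambda>_. borel) incr UNIV" by simp
  show "0 \<le> incr_var i" for i using p by (simp add: incr_var_def)
  fix \<delta> :: real assume "0 < \<delta>"
  from bern_mgf_bounds[OF p this] obtain \<tau> where \<tau>: "0 < \<tau>" and b: "\<And>t. \<bar>t\<bar> \<le> \<tau> \<Longrightarrow>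
      exp ((1 - \<delta>) * (p * (1 - p)) * t\<^sup>2 / 2) \<le> bern_mgf p t \<and> bern_mgf p t \<le> exp ((1 + \<delta>) * (p * (1 - p)) * t\<^sup>2 / 2)"
    by blast
  show "\<exists>\<tau>>0. \<forall>i t. \<bar>t\<bar> \<le> \<tau> \<longrightarrow> integrable P (\<lambda>\<omega>. exp (t * incr i \<omega>)) \<and>
        exp ((1 - \<delta>) * incr_var i * t\<^sup>2 / 2) \<le> expectation (\<lambda>\<omega>. exp (t * incr i \<omega>)) \<and>
        expectation (\<lambda>\<omega>. exp (t * incr i \<omega>)) \<le> exp ((1 + \<delta>) * incr_var i * t\<^sup>2 / 2)"
  proof (intro exI[of _ \<tau>] conjI[of "0 < \<tau>"] allI impI \<tau>)
    fix i t assume t: "\<bar>t\<bar> \<le> \<tau>"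
    let ?D = "A (Suc i) - A i"
    have D: "finite ?D" "?D \<subseteq> I" using A_fin A_sub by auto
    have ex: "exp (c * incr_var i * t\<^sup>2 / 2) = exp (c * (p * (1 - p)) * t\<^sup>2 / 2) ^ card ?D" for c
      unfolding incr_var_def exp_of_nat_mult[symmetric] by (simp add: mult_ac)
    show "integrable P (\<lambda>\<omega>. exp (t * incr i \<omega>)) \<and>
        exp ((1 - \<delta>) * incr_var i * t\<^sup>2 / 2) \<le> expectation (\<lambda>\<omega>. exp (t * incr i \<omega>)) \<and>
        expectation (\<lambda>\<omega>. exp (t * incr i \<omega>)) \<le> exp ((1 + \<delta>) * incr_var i * t\<^sup>2 / 2)"
      unfolding incr_def mgf_centred_sum[OF D] ex
      using integrable_exp_centred_sum[OF D] b[OF t] bern_mgf_pos[OF p, of t]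
      by (auto intro!: power_mono)
  qed
qed

lemma lil_S: "lil.S n = centred_sum (A n)"
proof
  fix \<omega>
  show "lil.S n \<omega> = centred_sum (A n) \<omega>"
  proof (induction n)
    case 0 then show ?case by (simp add: lil.S_def centred_sum_def A_0)
  next
    case (Suc n)
    have "centred_sum (A (Suc n)) \<omega> = centred_sum (A n) \<omega> + incr n \<omega>"
      unfolding centred_sum_def incr_def using sum.subset_diff[OF A_mono A_fin] by (simp add: add.commute)
    then show ?case using Suc by (simp add: lil.S_def)
  qed
qed

lemma lil_V: "lil.V n = p * (1 - p) * card (A n)"
proof (induction n)
  case 0 then show ?case by (simp add: lil.V_def A_0)
next
  case (Suc n)
  have "card (A (Suc n)) = card (A n) + card (A (Suc n) - A n)"
    using card_Diff_subset[OF A_fin A_mono] card_mono[OF A_fin A_mono] by simp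
  moreover have "lil.V (Suc n) = lil.V n + incr_var n" by (simp add: lil.V_def)
  ultimately show ?case unfolding Suc incr_var_def by (simp only: of_nat_add distrib_left)
qed

end

section \<open>The number of loose Hamilton cycles\<close>

text \<open>The filter of large multiples of \<open>q\<close> is the image of
  \<open>sequentially\<close> under multiplication by \<open>q\<close>.\<close>

lemma Limsup_dvd:
  fixes f :: "nat \<Rightarrow> 'a :: complete_linorder"
  assumes q: "0 < q"
  shows "Limsup (inf sequentially (principal {n. q dvd n})) f = limsup (\<lambda>m. f (m * q))"
proof -
  have "inf sequentially (principal {n. q dvd n}) = filtermap (\<lambda>m. m * q) sequentially"
  proof (rule filter_eqI)
    fix Q
    have "(\<exists>N. \<forall>n\<ge>N. q dvd n \<longrightarrow> Q n) \<longleftrightarrow> (\<exists>M. \<forall>m\<ge>M. Q (m * q))"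
    proof
      assume "\<exists>N. \<forall>n\<ge>N. q dvd n \<longrightarrow> Q n"
      then obtain N where N: "\<And>n. N \<le> n \<Longrightarrow> q dvd n \<Longrightarrow> Q n" by blast
      have "Q (m * q)" if "N \<le> m" for m
        using N[of "m * q"] that q by (metis dvd_triv_right le_trans mult.right_neutral mult_le_mono2 One_nat_def Suc_leI)
      then show "\<exists>M. \<forall>m\<ge>M. Q (m * q)" by blast
    next
      assume "\<exists>M. \<forall>m\<ge>M. Q (m * q)"
      then obtain M where M: "\<And>m. M \<le> m \<Longrightarrow> Q (m * q)" by blast
      have "Q n" if "M * q \<le> n" "q dvd n" for n
        using that q M by (auto elim!: dvdE simp: mult.commute[of q])
      then show "\<exists>N. \<forall>n\<ge>N. q dvd n \<longrightarrow> Q n" by blast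
    qed
    then show "eventually Q (inf sequentially (principal {n. q dvd n})) = eventually Q (filtermap (\<lambda>m. m * q) sequentially)"
      by (simp add: eventually_inf_principal eventually_filtermap eventually_sequentially)
  qed
  moreover have "inj (\<lambda>m. m * q)" using q by (simp add: inj_on_def)
  ultimately show ?thesis by (simp add: Limsup_filtermap_eq)
qed

lemma binomial_bounds:
  assumes "k \<le> n" "0 < k"
  shows "real n ^ k / real k ^ k \<le> real (n choose k)" "real (n choose k) \<le> real n ^ k"
proof -
  show "real n ^ k / real k ^ k \<le> real (n choose k)"
    using binomial_ge_n_over_k_pow_k[OF assms(1), where 'a=real] by (simp add: power_divide)
  show "real (n choose k) \<le> real n ^ k"
    using binomial_le_pow[OF assms(1)] by (metis of_nat_le_iff of_nat_power)
qed

text \<open>A polynomial change of the argument multiplies \<open>ln\<close> by about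
  \<open>k\<close> and thus shifts \<open>ln (ln x)\<close> only by a bounded amount.\<close>

lemma ln_ln_ratio_tendsto_1:
  fixes V x :: "nat \<Rightarrow> real"
  assumes x: "filterlim x at_top sequentially" and c: "0 < c" and C: "0 < C" and k: "0 < k"
    and lo: "\<forall>\<^sub>F n in sequentially. c * x n ^ k \<le> V n" and up: "\<forall>\<^sub>F n in sequentially. V n \<le> C * x n ^ k"
  shows "(\<lambda>n. ln (ln (V n)) / ln (ln (x n))) \<longlonglongrightarrow> 1"
proof -
  have lim: "(\<lambda>n. ln (ln (a * x n ^ k)) / ln (ln (x n))) \<longlonglongrightarrow> 1" if a: "0 < a" for a
  proof -
    have kpos: "0 < real k" using k by simp
    have "((\<lambda>y. ln (ln (a * y powr real k)) / ln (ln y)) \<longlongrightarrow> 1) at_top"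
      using a kpos by real_asymp
    from filterlim_compose[OF this x]
    have *: "(\<lambda>n. ln (ln (a * x n powr real k)) / ln (ln (x n))) \<longlonglongrightarrow> 1" .
    have "\<forall>\<^sub>F n in sequentially. 1 \<le> x n" using x by (simp add: filterlim_at_top)
    then have "\<forall>\<^sub>F n in sequentially. ln (ln (a * x n powr real k)) / ln (ln (x n)) = ln (ln (a * x n ^ k)) / ln (ln (x n))"
      by eventually_elim (simp add: powr_realpow)
    from Lim_transform_eventually[OF * this] show ?thesis .
  qed
  have "filterlim (\<lambda>y. c * y powr real k) at_top at_top" using c k by real_asymp
  from filterlim_compose[OF this x] have "filterlim (\<lambda>n. c * x n powr real k) at_top sequentially" .
  then have big: "\<forall>\<^sub>F n in sequentially. exp 1 \<le> c * x n powr real k" by (simp add: filterlim_at_top)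
  have x3: "\<forall>\<^sub>F n in sequentially. exp 1 \<le> x n" using x by (simp add: filterlim_at_top)
  have mono: "ln (ln a) / ln (ln z) \<le> ln (ln b) / ln (ln z)" if "exp 1 \<le> a" "a \<le> b" "exp 1 \<le> z" for a b z :: real
  proof -
    have "0 < a" using that exp_gt_zero[of "1::real"] by linarith
    then have "ln a \<le> ln b" using that by simp
    moreover have "1 \<le> ln a" using ln_ge_one that by blast
    ultimately have "ln (ln a) \<le> ln (ln b)" by simp
    then show ?thesis using ln_ln_nonneg[OF that(3)] by (rule divide_right_mono)
  qed
  show ?thesis
  proof (rule tendsto_sandwich[OF _ _ lim[OF c] lim[OF C]])
    show "\<forall>\<^sub>F n in sequentially. ln (ln (c * x n ^ k)) / ln (ln (x n)) \<le> ln (ln (V n)) / ln (ln (x n))"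
      using big x3 lo
    proof eventually_elim
      case (elim n)
      have "0 < x n" using elim(2) exp_gt_zero[of "1::real"] by linarith
      then show ?case using elim by (intro mono) (simp_all add: powr_realpow)
    qed
    show "\<forall>\<^sub>F n in sequentially. ln (ln (V n)) / ln (ln (x n)) \<le> ln (ln (C * x n ^ k)) / ln (ln (x n))"
      using big x3 lo up
    proof eventually_elim
      case (elim n)
      have "0 < x n" using elim(2) exp_gt_zero[of "1::real"] by linarith
      then show ?case using elim by (intro mono) (simp_all add: powr_realpow)
    qed
  qed
qed

section \<open>Assembly for the random hypergraph\<close>

locale loose_lil =
  fixes k q :: nat and p :: real
  assumes k_eq: "k = Suc q" and q3: "3 \<le> q" and p01: "0 < p" "p < 1"
begin

definition ground :: "nat set set" where "ground = nsets {1..} k"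

text \<open>The process is indexed by the number \<open>m\<close> of edges of a cycle; one step adds
  \<open>q\<close> vertices.\<close>

definition A :: "nat \<Rightarrow> nat set set" where "A m = nsets {1..m * q} k"

sublocale growing_bernoulli ground p A
proof
  have "{1..k} \<in> nsets {1..} k" by (auto simp: nsets_def)
  then show "ground \<noteq> {}" unfolding ground_def by blast
  show "0 < p" "p < 1" by (rule p01)+
  show "finite (A m)" for m by (simp add: A_def finite_imp_finite_nsets)
  show "A m \<subseteq> ground" for m unfolding A_def ground_def by (rule nsets_mono) auto
  show "A m \<subseteq> A (Suc m)" for m unfolding A_def by (rule nsets_mono) auto
  have "0 < k" using k_eq by simp
  then show "A 0 = {}" by (simp add: A_def nsets_empty_iff)
qed

abbreviation L :: "nat \<Rightarrow> nat set set set" where "L m \<equiv> lhcs k (m * q)"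

lemma P_eq: "random_hypergraph k p = P"
  unfolding random_hypergraph_def P_def unfolding ground_def ..

text \<open>For small \<open>n\<close> the blocks of a cycle may degenerate to other sizes. Keeping
  the condition \<open>C \<subseteq> nsets {1..n} k\<close> makes the index set finite for every
  \<open>n\<close>, which gives measurability without exceptions.\<close>

lemma num_lhc_eq: "num_lhc k n \<omega> = (\<Sum>C | C \<in> lhcs k n \<and> C \<subseteq> nsets {1..n} k. monomial C \<omega>)"
proof -
  let ?L = "{C. C \<in> lhcs k n \<and> C \<subseteq> nsets {1..n} k}"
  have fin: "finite ?L"
    by (rule finite_subset[of _ "Pow (nsets {1..n} k)"]) (auto simp: finite_imp_finite_nsets)
  have "{C. loose_hamilton_cycle k n C \<and> C \<subseteq> edges_upto k n \<omega>} = ?L \<inter> {C. \<forall>e\<in>C. \<omega> e}"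
    by (auto simp: lhcs_def edges_upto_def)
  then show ?thesis using fin by (simp add: num_lhc_def monomial_def)
qed

lemma measurable_monomial: "finite C \<Longrightarrow> C \<subseteq> ground \<Longrightarrow> monomial C \<in> borel_measurable P"
  by (rule borel_measurable_integrable[OF integrable_monomial])

lemma measurable_num_lhc [measurable]: "num_lhc k n \<in> borel_measurable P"
proof -
  have "finite C \<and> C \<subseteq> ground" if "C \<subseteq> nsets {1..n} k" for C
    using that nsets_mono[of "{1..n}" "{1..}" k] finite_subset[OF that]
    by (auto simp: finite_imp_finite_nsets ground_def)
  then show ?thesis unfolding num_lhc_eq[abs_def] by (intro borel_measurable_sum measurable_monomial) auto
qed

lemma card_A: "card (A m) = (m * q) choose k"
  by (simp add: A_def card_nsets)

lemma lhc_params: "3 \<le> m \<Longrightarrow> lhc_params k q m (m * q)"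
  using q3 k_eq by unfold_locales auto

lemma uniform_family:
  assumes m: "3 \<le> m"
  shows "uniform_family ground p (L m) (A m) m"
proof -
  interpret lp: lhc_params k q m "m * q" by (rule lhc_params[OF m])
  show ?thesis
  proof
    show "finite (L m)" by (rule lp.finite_lhcs)
    show "finite (A m)" by (rule A_fin)
    show "A m \<subseteq> ground" by (rule A_sub)
    show "C \<subseteq> A m" "card C = m" if "C \<in> L m" for C
      using lp.lhcs_sub[OF that] lp.lhcs_card[OF that] by (simp_all only: A_def)
    show "card {C \<in> L m. e \<in> C} * card (A m) = card (L m) * m" if "e \<in> A m" for e
      unfolding card_A by (rule lp.lhcs_degree[OF that[unfolded A_def]])
    obtain C where C: "C \<in> L m" using lp.lhcs_nonempty by blast
    then have "C \<noteq> {}" using lp.lhcs_card[OF C] m by auto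
    then show "A m \<noteq> {}" using lp.lhcs_sub[OF C] unfolding A_def by blast
  qed
qed

text \<open>The locale \<open>uniform_family\<close> is interpreted for one \<open>m \<ge> 3\<close>
  at a time; these names make its quantities into sequences in \<open>m\<close>.\<close>

definition dev :: "nat \<Rightarrow> (nat set \<Rightarrow> bool) \<Rightarrow> real" where
  "dev m = uniform_family.dev p (L m) m"

definition rest :: "nat \<Rightarrow> (nat set \<Rightarrow> bool) \<Rightarrow> real" where
  "rest m = uniform_family.rest p (L m) (A m) m"

definition slope :: "nat \<Rightarrow> real" where
  "slope m = uniform_family.slope p (L m) (A m) m"

text \<open>The second moment of \<open>rest\<close> relative to that of the linear part;
  \<open>lil.V m\<close> is the variance of the centred edge count. The variance of \<open>X\<close>
  is thus the linear one times \<open>1 + relvar m\<close>.\<close>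

definition relvar :: "nat \<Rightarrow> real" where
  "relvar m = (p ^ m)\<^sup>2 * uniform_family.overlap_sum p (L m) / ((slope m)\<^sup>2 * lil.V m)"

lemma
  assumes m: "3 \<le> m"
  shows num_lhc_dev: "num_lhc k (m * q) \<omega> - lhc_mean k p (m * q) = dev m \<omega>"
    and lhc_sd_eq: "lhc_sd k p (m * q) = sqrt (expectation (\<lambda>\<omega>. (dev m \<omega>)\<^sup>2))"
proof -
  interpret lp: lhc_params k q m "m * q" by (rule lhc_params[OF m])
  interpret uf: uniform_family ground p "L m" "A m" m by (rule uniform_family[OF m])
  have eq: "num_lhc k (m * q) \<omega> = (\<Sum>C\<in>L m. monomial C \<omega>)" for \<omega>
    unfolding num_lhc_eq using lp.lhcs_sub by (intro sum.cong) auto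
  have mon: "integrable P (monomial C)" "expectation (monomial C) = p ^ m" if "C \<in> L m" for C
    using integrable_monomial[OF uf.L_finite uf.L_I] expectation_monomial[OF uf.L_finite uf.L_I] uf.L_card that by auto
  have mean: "lhc_mean k p (m * q) = card (L m) * p ^ m"
    unfolding lhc_mean_def P_eq eq using mon by (simp add: Bochner_Integration.integral_sum)
  show *: "num_lhc k (m * q) \<omega> - lhc_mean k p (m * q) = dev m \<omega>" for \<omega>
    by (simp add: eq mean dev_def uf.dev_def)
  show "lhc_sd k p (m * q) = sqrt (expectation (\<lambda>\<omega>. (dev m \<omega>)\<^sup>2))"
    unfolding lhc_sd_def P_eq *[symmetric] lhc_mean_def P_eq ..
qed

lemma card_A_pos: "3 \<le> m \<Longrightarrow> 0 < card (A m)"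
  by (rule uniform_family.N_pos[OF uniform_family])

lemma V_pos: "3 \<le> m \<Longrightarrow> 0 < lil.V m"
  using card_A_pos p01 by (simp add: lil_V)

lemma card_L_pos: "3 \<le> m \<Longrightarrow> 0 < card (L m)"
  using lhc_params.finite_lhcs[OF lhc_params] lhc_params.lhcs_nonempty[OF lhc_params] by (simp add: card_gt_0_iff)

lemma slope_pos: "3 \<le> m \<Longrightarrow> 0 < slope m"
  using card_A_pos card_L_pos p01 uniform_family.slope_def[OF uniform_family, of m] by (simp add: slope_def)

lemma
  assumes m: "3 \<le> m"
  shows expectation_rest: "expectation (\<lambda>\<omega>. (rest m \<omega> / (slope m * sqrt (lil.V m)))\<^sup>2) = relvar m"
    and integrable_rest: "integrable P (\<lambda>\<omega>. (rest m \<omega> / (slope m * sqrt (lil.V m)))\<^sup>2)"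
    and sd_relvar: "lhc_sd k p (m * q) = slope m * sqrt (lil.V m) * sqrt (1 + relvar m)"
    and relvar_nonneg: "0 \<le> relvar m"
proof -
  interpret uf: uniform_family ground p "L m" "A m" m by (rule uniform_family[OF m])
  have sl: "slope m = uf.slope" by (simp add: slope_def)
  have V: "lil.V m = card (A m) * (p * (1 - p))" by (simp add: lil_V)
  have eq: "(rest m \<omega> / (slope m * sqrt (lil.V m)))\<^sup>2 = (uf.rest \<omega>)\<^sup>2 / ((slope m)\<^sup>2 * lil.V m)" for \<omega>
    using V_pos[OF m] by (simp add: rest_def power_divide power_mult_distrib)
  show 1: "expectation (\<lambda>\<omega>. (rest m \<omega> / (slope m * sqrt (lil.V m)))\<^sup>2) = relvar m"
    unfolding eq by (simp add: uf.expectation_rest_square relvar_def)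
  show "integrable P (\<lambda>\<omega>. (rest m \<omega> / (slope m * sqrt (lil.V m)))\<^sup>2)"
    unfolding eq using uf.integrable_rest_square by simp
  show "0 \<le> relvar m" unfolding 1[symmetric] by simp
  define W where "W = (slope m)\<^sup>2 * lil.V m"
  have W: "0 < W" using slope_pos[OF m] V_pos[OF m] by (simp add: W_def)
  have "W * (1 + relvar m) = W + (p ^ m)\<^sup>2 * uf.overlap_sum"
    using W by (simp add: relvar_def W_def[symmetric] distrib_left)
  also have "\<dots> = uf.slope\<^sup>2 * (card (A m) * (p * (1 - p))) + (p ^ m)\<^sup>2 * uf.overlap_sum"
    by (simp add: W_def sl V)
  also have "\<dots> = expectation (\<lambda>\<omega>. (dev m \<omega>)\<^sup>2)" by (simp add: uf.expectation_dev_square_split dev_def)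
  finally have "lhc_sd k p (m * q) = sqrt ((slope m)\<^sup>2 * lil.V m * (1 + relvar m))"
    by (simp add: lhc_sd_eq[OF m] W_def)
  then show "lhc_sd k p (m * q) = slope m * sqrt (lil.V m) * sqrt (1 + relvar m)"
    using slope_pos[OF m] by (simp add: real_sqrt_mult)
qed

lemma ev_large: "\<forall>\<^sub>F m in sequentially. c \<le> real m"
  using filterlim_real_sequentially by (simp add: filterlim_at_top)

text \<open>With \<open>b = B / n ^ (k - 1)\<close> the overlap bound becomes
  \<open>lam * b\<^sup>2 * card (A m)\<close>, and at most \<open>n ^ k\<close> edges leave
  \<open>lam * B\<^sup>2 / n ^ (k - 2)\<close>. Here \<open>k \<ge> 4\<close> gives the summable
  inverse square.\<close>

lemma relvar_le: "\<exists>c. \<forall>\<^sub>F m in sequentially. relvar m \<le> c / (real m)\<^sup>2"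
proof -
  define lam where "lam = (1 - p) / p"
  define B where "B = 2 * real k ^ k * exp (real k) * 2 ^ ((k - 1)\<^sup>2)"
  have l: "0 < lam" using p01 by (simp add: lam_def)
  have B: "0 < B" using k_eq by (simp add: B_def)
  show ?thesis
  proof (intro exI)
    show "\<forall>\<^sub>F m in sequentially. relvar m \<le> lam * B\<^sup>2 / (real m)\<^sup>2"
      \<comment> \<open>From \<open>lam * B \<le> m\<close> follows the smallness condition of
        \<open>overlap_sum_le\<close>; \<open>k \<le> m\<close> gives room for an edge.\<close>
      using ev_large[of "lam * B"] eventually_ge_at_top[of k] eventually_ge_at_top[of 3]
    proof eventually_elim
      case (elim m)
      let ?n = "m * q"
      interpret lp: lhc_params k q m ?n by (rule lhc_params[OF elim(3)])
      interpret uf: uniform_family ground p "L m" "A m" m by (rule uniform_family[OF elim(3)])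
      define b where "b = B / real ?n ^ (k - 1)"
      have "m \<le> ?n" using q3 by simp
      then have n: "0 < real ?n" "real m \<le> real ?n" "1 \<le> real ?n" "k \<le> ?n"
        using elim(2,3) by (linarith, simp only: of_nat_le_iff, linarith, linarith)
      have b: "0 \<le> b" using B by (simp add: b_def)
      have mpos: "0 < real m" using elim(3) by simp
      have n2: "(real m)\<^sup>2 \<le> real ?n ^ (k - 2)"
      proof -
        have "(real m)\<^sup>2 \<le> (real ?n)\<^sup>2" using n by (intro power_mono) auto
        also have "\<dots> \<le> real ?n ^ (k - 2)" using n q3 k_eq by (intro power_increasing) auto
        finally show ?thesis .
      qed
      have overlap_ok: "m * (lam * b) \<le> 1"
      proof -
        have "real m * (lam * B) \<le> real m * real m" using elim(1) by (intro mult_left_mono) auto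
        also have "\<dots> \<le> real ?n ^ (k - 2)" using n2 by (simp add: power2_eq_square)
        also have "\<dots> \<le> real ?n ^ (k - 1)" using n by (intro power_increasing) auto
        finally have "real m * (lam * B) / real ?n ^ (k - 1) \<le> 1"
          using n(1) by (subst divide_le_eq_1_pos) (simp_all only: zero_less_power)
        then show ?thesis unfolding b_def times_divide_eq_right .
      qed
      have "uf.overlap_sum \<le> (real (card (L m)))\<^sup>2 * (m * (lam * b))\<^sup>2"
        unfolding lam_def
      proof (rule uf.overlap_sum_le[OF b])
        show "real m * ((1 - p) / p * b) \<le> 1" using overlap_ok by (simp only: lam_def)
        show "real (card {D \<in> L m. S \<subseteq> D}) \<le> real (card (L m)) * b ^ card S" if "C \<in> L m" "S \<subseteq> C" for C S
          using lp.card_lhcs_superset[OF that] by (simp only: b_def B_def)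
      qed
      then have "relvar m \<le> (p ^ m)\<^sup>2 * ((real (card (L m)))\<^sup>2 * (m * (lam * b))\<^sup>2) / ((slope m)\<^sup>2 * lil.V m)"
        unfolding relvar_def using V_pos[OF elim(3)] by (intro divide_right_mono mult_left_mono) auto
      \<comment> \<open>Here \<open>(slope m)\<^sup>2 * lil.V m\<close> equals
        \<open>lam * (p ^ m * card (L m) * m)\<^sup>2 / card (A m)\<close>, so the unknown number of
        cycles cancels.\<close>
      also have "\<dots> = lam * b\<^sup>2 * card (A m)"
        using card_A_pos[OF elim(3)] card_L_pos[OF elim(3)] mpos p01
        unfolding slope_def uf.slope_def lil_V lam_def by (simp add: power2_eq_square field_simps)
      also have "\<dots> \<le> lam * b\<^sup>2 * real ?n ^ k"
      proof (rule mult_left_mono)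
        have "0 < k" using k_eq by simp
        then show "real (card (A m)) \<le> real ?n ^ k" unfolding card_A by (rule binomial_bounds(2)[OF n(4)])
      qed (use l in simp)
      also have "\<dots> = lam * B\<^sup>2 / real ?n ^ (k - 2)"
      proof -
        have "real ?n ^ (k - 1) * real ?n ^ (k - 1) = real ?n ^ k * real ?n ^ (k - 2)"
          unfolding power_add[symmetric] using k_eq q3 by (intro arg_cong2[where f=power]) auto
        moreover have "lam * (B / X)\<^sup>2 * Y = lam * B\<^sup>2 / Z" if "X * X = Y * Z" "0 < Y" for X Y Z :: real
          using that by (simp add: power_divide power2_eq_square[of X])
        ultimately show ?thesis unfolding b_def using zero_less_power[OF n(1), of k] by blast
      qed
      also have "\<dots> \<le> lam * B\<^sup>2 / (real m)\<^sup>2"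
      proof (rule divide_left_mono[OF n2])
        show "0 \<le> lam * B\<^sup>2" using l by simp
        show "0 < real ?n ^ (k - 2) * (real m)\<^sup>2" using mpos by (intro mult_pos_pos zero_less_power n(1))
      qed
      finally show ?case .
    qed
  qed
qed

lemma relvar_tendsto_0: "relvar \<longlonglongrightarrow> 0"
proof -
  obtain c where c: "\<forall>\<^sub>F m in sequentially. relvar m \<le> c / (real m)\<^sup>2" using relvar_le by blast
  have "(\<lambda>m. c / (real m)\<^sup>2) \<longlonglongrightarrow> 0" by real_asymp
  moreover have "\<forall>\<^sub>F m in sequentially. 0 \<le> relvar m"
    using eventually_ge_at_top[of 3] by eventually_elim (rule relvar_nonneg)
  ultimately show ?thesis by (intro tendsto_sandwich[OF _ c tendsto_const])
qed

lemma AE_rest: "AE \<omega> in P. (\<lambda>m. rest m \<omega> / (slope m * sqrt (lil.V m))) \<longlonglongrightarrow> 0"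
proof -
  \<comment> \<open>Shifted by 3, so that every term is covered by the moment formulas.\<close>
  let ?Y = "\<lambda>m \<omega>. rest (m + 3) \<omega> / (slope (m + 3) * sqrt (lil.V (m + 3)))"
  obtain c where c: "\<forall>\<^sub>F m in sequentially. relvar m \<le> c / (real m)\<^sup>2" using relvar_le by blast
  have "\<forall>\<^sub>F m in sequentially. norm (relvar m) \<le> c * (1 / (real m)\<^sup>2)"
    using c eventually_ge_at_top[of 3] by eventually_elim (simp add: relvar_nonneg)
  moreover have "summable (\<lambda>m. c * (1 / (real m)\<^sup>2))"
    using inverse_power_summable[of 2, where 'a=real] by (intro summable_mult) (simp add: field_simps)
  ultimately have "summable relvar" by (rule summable_comparison_test_ev)
  then have sm: "summable (\<lambda>m. relvar (m + 3))" by (simp only: summable_iff_shift)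
  have "AE \<omega> in P. (\<lambda>m. ?Y m \<omega>) \<longlonglongrightarrow> 0"
  proof (rule AE_tendsto_0_of_summable_second_moment)
    show "integrable P (\<lambda>\<omega>. (?Y i \<omega>)\<^sup>2)" for i by (rule integrable_rest) simp
    show "summable (\<lambda>i. expectation (\<lambda>\<omega>. (?Y i \<omega>)\<^sup>2))"
      using sm by (simp add: expectation_rest del: power_divide)
    show "?Y i \<in> borel_measurable P" for i
    proof -
      interpret uf: uniform_family ground p "L (i + 3)" "A (i + 3)" "i + 3" by (rule uniform_family) simp
      have "uf.dev \<in> borel_measurable P"
        unfolding uf.dev_def[abs_def] using uf.L_finite uf.L_I
        by (intro borel_measurable_diff borel_measurable_sum measurable_monomial) auto
      moreover have "centred_sum (A (i + 3)) \<in> borel_measurable P"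
        using lil.measurable_S[of "i + 3"] by (simp add: lil_S)
      ultimately show ?thesis unfolding rest_def uf.rest_def by measurable
    qed
  qed
  then show ?thesis by eventually_elim (rule LIMSEQ_offset)
qed

lemma n_lim: "filterlim (\<lambda>m. real (m * q)) at_top sequentially"
proof (rule filterlim_at_top_mono[OF filterlim_real_sequentially])
  show "\<forall>\<^sub>F m in sequentially. real m \<le> real (m * q)"
    using q3 by (intro always_eventually allI of_nat_mono) simp
qed

lemma V_bounds:
  assumes "k \<le> m"
  shows "p * (1 - p) / real k ^ k * real (m * q) ^ k \<le> lil.V m" "lil.V m \<le> p * (1 - p) * real (m * q) ^ k"
proof -
  have n: "k \<le> m * q" "0 < k" using assms q3 k_eq by (auto intro: le_trans)
  have pp: "0 \<le> p * (1 - p)" using p01 by simp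
  show "p * (1 - p) / real k ^ k * real (m * q) ^ k \<le> lil.V m"
    using mult_left_mono[OF binomial_bounds(1)[OF n] pp] by (simp add: lil_V card_A)
  show "lil.V m \<le> p * (1 - p) * real (m * q) ^ k"
    using mult_left_mono[OF binomial_bounds(2)[OF n] pp] by (simp add: lil_V card_A)
qed

lemma V_lim: "filterlim lil.V at_top sequentially"
proof (rule filterlim_at_top_mono)
  have c: "0 < p * (1 - p) / real k ^ k" using p01 k_eq by simp
  have "0 < k" using k_eq by simp
  then show "filterlim (\<lambda>m. p * (1 - p) / real k ^ k * real (m * q) ^ k) at_top sequentially"
    using c by (intro filterlim_tendsto_pos_mult_at_top[OF tendsto_const] filterlim_pow_at_top n_lim)
  show "\<forall>\<^sub>F m in sequentially. p * (1 - p) / real k ^ k * real (m * q) ^ k \<le> lil.V m"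
    using eventually_ge_at_top[of k] by eventually_elim (rule V_bounds)
qed

text \<open>The factor \<open>2 ^ k\<close> comes from \<open>Suc m * q \<le> 2 * (m * q)\<close>,
  and \<open>k ^ k\<close> is the gap between the two bounds for the binomial coefficient.\<close>

lemma V_ratio: "\<forall>\<^sub>F m in sequentially. lil.V (Suc m) \<le> (2 * real k) ^ k * lil.V m"
  using eventually_ge_at_top[of k]
proof eventually_elim
  case (elim m)
  have k0: "0 < real k" "1 \<le> m" using k_eq elim by auto
  have pp: "0 \<le> p * (1 - p)" using p01 by simp
  have "lil.V (Suc m) \<le> p * (1 - p) * real (Suc m * q) ^ k" using elim by (intro V_bounds) auto
  also have "\<dots> \<le> p * (1 - p) * (2 * real (m * q)) ^ k"
  proof (intro mult_left_mono power_mono pp)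
    have "Suc m * q \<le> 2 * (m * q)" using k0 by (simp add: algebra_simps)
    then show "real (Suc m * q) \<le> 2 * real (m * q)" by (metis of_nat_le_iff of_nat_mult of_nat_numeral)
  qed auto
  also have "\<dots> = (2 * real k) ^ k * (p * (1 - p) / real k ^ k * real (m * q) ^ k)"
    using k0 by (simp add: power_mult_distrib)
  also have "\<dots> \<le> (2 * real k) ^ k * lil.V m" using V_bounds(1)[OF elim] by (intro mult_left_mono) auto
  finally show ?case .
qed

text \<open>The exceptional null set must not depend on \<open>\<rho>\<close>, so the law is used
  for countably many constants approaching 1 from either side.\<close>

lemma AE_lil_centred:
  "AE \<omega> in P. (\<forall>\<rho>>1. \<forall>\<^sub>F m in sequentially. centred_sum (A m) \<omega> / lil_scale (lil.V m) \<le> \<rho>) \<and>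
     (\<forall>\<rho>. 0 < \<rho> \<longrightarrow> \<rho> < 1 \<longrightarrow> (\<exists>\<^sub>F m in sequentially. \<rho> \<le> centred_sum (A m) \<omega> / lil_scale (lil.V m)))"
proof -
  have up: "AE \<omega> in P. \<forall>i. \<forall>\<^sub>F m in sequentially. lil.S m \<omega> \<le> (1 + 1 / real (Suc i)) * lil_scale (lil.V m)"
    unfolding AE_all_countable by (intro allI lil.lil_upper V_lim) simp
  \<comment> \<open>The double successor keeps the constant positive at
    \<open>i = 0\<close>.\<close>
  have lo: "AE \<omega> in P. \<forall>i. \<exists>\<^sub>F m in sequentially. (1 - 1 / real (Suc (Suc i))) * lil_scale (lil.V m) \<le> lil.S m \<omega>"
    unfolding AE_all_countable by (intro allI lil.lil_lower[OF V_lim V_ratio]) (simp_all add: field_simps)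
  have pos: "\<forall>\<^sub>F m in sequentially. 0 < lil_scale (lil.V m)"
  proof -
    have "filterlim (\<lambda>y. ln (ln y)) at_top (at_top :: real filter)" by real_asymp
    from filterlim_compose[OF this V_lim] have "\<forall>\<^sub>F m in sequentially. 1 \<le> ln (ln (lil.V m))"
      by (simp add: filterlim_at_top)
    then show ?thesis using eventually_ge_at_top[of 3]
      by eventually_elim (simp add: lil_scale_def V_pos)
  qed
  from up lo show ?thesis
  proof eventually_elim
    case (elim \<omega>)
    show ?case
    proof (intro conjI allI impI)
      fix \<rho> :: real assume "1 < \<rho>"
      then obtain i where i: "1 / real (Suc i) < \<rho> - 1" using nat_approx_posE[of "\<rho> - 1"] by auto
      show "\<forall>\<^sub>F m in sequentially. centred_sum (A m) \<omega> / lil_scale (lil.V m) \<le> \<rho>"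
        using elim(1)[rule_format, of i] pos
      proof eventually_elim
        case (elim m)
        have "(1 + 1 / real (Suc i)) * lil_scale (lil.V m) \<le> \<rho> * lil_scale (lil.V m)"
          using i elim(2) by (intro mult_right_mono) linarith+
        then have "centred_sum (A m) \<omega> \<le> \<rho> * lil_scale (lil.V m)"
          using elim(1) unfolding lil_S by linarith
        then show ?case using elim(2) by (simp add: pos_divide_le_eq)
      qed
    next
      fix \<rho> :: real assume r: "0 < \<rho>" "\<rho> < 1"
      then obtain i where i: "1 / real (Suc i) < 1 - \<rho>" using nat_approx_posE[of "1 - \<rho>"] by auto
      have i2: "1 / real (Suc (Suc i)) \<le> 1 / real (Suc i)" by (intro divide_left_mono) auto
      show "\<exists>\<^sub>F m in sequentially. \<rho> \<le> centred_sum (A m) \<omega> / lil_scale (lil.V m)"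
      proof (rule frequently_rev_mp[OF elim(2)[rule_format, of i]])
        show "\<forall>\<^sub>F m in sequentially. (1 - 1 / real (Suc (Suc i))) * lil_scale (lil.V m) \<le> lil.S m \<omega> \<longrightarrow>
           \<rho> \<le> centred_sum (A m) \<omega> / lil_scale (lil.V m)"
          using pos
        proof eventually_elim
          case (elim m)
          have "\<rho> * lil_scale (lil.V m) \<le> (1 - 1 / real (Suc (Suc i))) * lil_scale (lil.V m)"
            using i i2 elim by (intro mult_right_mono) linarith+
          then show ?case unfolding lil_S pos_le_divide_eq[OF elim] by linarith
        qed
      qed
    qed
  qed
qed

text \<open>Splitting \<open>dev\<close> into linear part and \<open>rest\<close> writes the
  quotient as \<open>c m * x m + y m\<close>. The factor \<open>c\<close> compares both the iterated
  logarithms and the standard deviations; \<open>y\<close> vanishes since the relative remainder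
  tends to 0 even before the division by \<open>sqrt (2 * LL m)\<close>.\<close>

lemma AE_limsup:
  "AE \<omega> in P. limsup (\<lambda>m. ereal ((num_lhc k (m * q) \<omega> - lhc_mean k p (m * q)) /
      (lhc_sd k p (m * q) * sqrt (2 * ln (ln (real (m * q))))))) = 1"
  using AE_lil_centred AE_rest
proof eventually_elim
  case (elim \<omega>)
  define LL where "LL m = ln (ln (real (m * q)))" for m
  define c where "c m = sqrt (ln (ln (lil.V m)) / LL m) / sqrt (1 + relvar m)" for m
  define x where "x m = centred_sum (A m) \<omega> / lil_scale (lil.V m)" for m
  define y where "y m = rest m \<omega> / (slope m * sqrt (lil.V m)) * (1 / sqrt (1 + relvar m)) * (1 / sqrt (2 * LL m))" for m
  have LL_lim: "filterlim LL at_top sequentially"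
  proof -
    have "filterlim (\<lambda>y. ln (ln y)) at_top (at_top :: real filter)" by real_asymp
    from filterlim_compose[OF this n_lim] show ?thesis by (simp only: LL_def[abs_def])
  qed
  have VL_lim: "filterlim (\<lambda>m. ln (ln (lil.V m))) at_top sequentially"
  proof -
    have "filterlim (\<lambda>y. ln (ln y)) at_top (at_top :: real filter)" by real_asymp
    from filterlim_compose[OF this V_lim] show ?thesis .
  qed
  have rv: "(\<lambda>m. sqrt (1 + relvar m)) \<longlonglongrightarrow> 1"
    using tendsto_real_sqrt[OF tendsto_add[OF tendsto_const[of 1] relvar_tendsto_0]] by simp
  have "(\<lambda>m. ln (ln (lil.V m)) / LL m) \<longlonglongrightarrow> 1"
    unfolding LL_def
  proof (rule ln_ln_ratio_tendsto_1[OF n_lim])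
    show "0 < p * (1 - p) / real k ^ k" "0 < p * (1 - p)" "0 < k" using p01 k_eq by auto
    show "\<forall>\<^sub>F m in sequentially. p * (1 - p) / real k ^ k * real (m * q) ^ k \<le> lil.V m"
      using eventually_ge_at_top[of k] by eventually_elim (rule V_bounds)
    show "\<forall>\<^sub>F m in sequentially. lil.V m \<le> p * (1 - p) * real (m * q) ^ k"
      using eventually_ge_at_top[of k] by eventually_elim (rule V_bounds)
  qed
  then have "c \<longlonglongrightarrow> sqrt 1 / 1"
    unfolding c_def by (intro tendsto_divide tendsto_real_sqrt rv) auto
  then have c: "c \<longlonglongrightarrow> 1" by simp
  have "filterlim (\<lambda>z. sqrt (2 * z)) at_top at_top" by real_asymp
  then have "filterlim (\<lambda>m. sqrt (2 * LL m)) at_top sequentially" by (rule filterlim_compose[OF _ LL_lim])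
  then have "(\<lambda>m. 1 / sqrt (2 * LL m)) \<longlonglongrightarrow> 0"
    by (intro tendsto_divide_0[OF tendsto_const] filterlim_at_top_imp_at_infinity)
  then have "y \<longlonglongrightarrow> 0 * (1 / 1) * 0"
    unfolding y_def by (intro tendsto_mult elim(2) tendsto_divide rv tendsto_const) auto
  then have y: "y \<longlonglongrightarrow> 0" by simp
  have "limsup (\<lambda>m. ereal (c m * x m + y m)) = 1"
    by (rule limsup_affine_eq_1[OF _ _ c y]) (use elim(1) in \<open>auto simp: x_def\<close>)
  moreover have "\<forall>\<^sub>F m in sequentially. (num_lhc k (m * q) \<omega> - lhc_mean k p (m * q)) /
      (lhc_sd k p (m * q) * sqrt (2 * LL m)) = c m * x m + y m"
  proof -
    have "\<forall>\<^sub>F m in sequentially. 1 \<le> LL m" "\<forall>\<^sub>F m in sequentially. 1 \<le> ln (ln (lil.V m))"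
      using LL_lim VL_lim by (simp_all add: filterlim_at_top)
    then show ?thesis using eventually_ge_at_top[of 3]
    proof eventually_elim
      case (elim m)
      interpret uf: uniform_family ground p "L m" "A m" m by (rule uniform_family[OF elim(3)])
      define s where "s = slope m * sqrt (lil.V m)"
      define r where "r = sqrt (1 + relvar m)"
      define z where "z = sqrt (2 * LL m)"
      have pos: "0 < s" "0 < r" "0 < z" "0 < lil.V m" "0 < slope m"
        using slope_pos V_pos relvar_nonneg elim by (auto simp: s_def r_def z_def intro: add_pos_nonneg)
      have "dev m \<omega> = slope m * centred_sum (A m) \<omega> + rest m \<omega>"
        by (simp add: dev_def rest_def slope_def uf.rest_def)
      then have "(num_lhc k (m * q) \<omega> - lhc_mean k p (m * q)) / (lhc_sd k p (m * q) * z) =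
          slope m * centred_sum (A m) \<omega> / (s * r * z) + rest m \<omega> / (s * r * z)"
        unfolding num_lhc_dev[OF elim(3)] sd_relvar[OF elim(3)] s_def[symmetric] r_def[symmetric]
        by (simp add: add_divide_distrib)
      moreover have "rest m \<omega> / (s * r * z) = y m"
        by (simp add: y_def s_def r_def z_def)
      moreover have "slope m * centred_sum (A m) \<omega> / (s * r * z) = c m * x m"
      proof -
        have "lil_scale (lil.V m) = sqrt 2 * sqrt (lil.V m) * sqrt (ln (ln (lil.V m)))"
          by (simp add: lil_scale_def real_sqrt_mult)
        moreover have "z = sqrt 2 * sqrt (LL m)" by (simp add: z_def real_sqrt_mult)
        ultimately show ?thesis
          using pos elim unfolding c_def x_def r_def[symmetric] s_def
          by (simp add: real_sqrt_divide field_simps)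
      qed
      ultimately show ?case by (simp add: z_def)
    qed
  qed
  then have "limsup (\<lambda>m. ereal ((num_lhc k (m * q) \<omega> - lhc_mean k p (m * q)) /
      (lhc_sd k p (m * q) * sqrt (2 * LL m)))) = limsup (\<lambda>m. ereal (c m * x m + y m))"
    by (intro Limsup_eq) (auto elim: eventually_mono)
  ultimately show ?case by (simp only: LL_def)
qed

end

theorem theorem1p8:
  fixes p :: real and k :: nat
  assumes "0 < p" and "p < 1" and "k \<ge> 4"
  shows "prob_space.prob (random_hypergraph k p)
    {\<omega> \<in> space (random_hypergraph k p).
      Limsup (inf sequentially (principal {n. (k - 1) dvd n}))
        (\<lambda>n. ereal ((num_lhc k n \<omega> - lhc_mean k p n) /
                      (lhc_sd k p n * sqrt (2 * ln (ln (real n)))))) = 1} = 1"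
proof -
  interpret loose_lil k "k - 1" p by standard (use assms in auto)
  have "0 < k - 1" using assms by simp
  then show ?thesis
    unfolding P_eq Limsup_dvd[OF \<open>0 < k - 1\<close>]
    by (subst prob_Collect_eq_1) (measurable, rule AE_limsup)
qed

end
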